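(* Let $p$ be an odd prime, $n\ge1$, and $L/K$ a cyclic Galois extension of degree $p^n$ with group $G=\langle\sigma\rangle$. For $0\le r,s<p^{n-1}$, $H_r\cong H_s$ as $K$-Hopf algebras if and only if $r=s$.
   Context: Let $N=\langle\eta\rangle$ be cyclic of order $p^n$ and $\delta\in\mathrm{Aut}(N)$ the $(p-1)$-th power of a generator of the cyclic group $\mathrm{Aut}(N)$. Let $\rho(\eta)\in\mathrm{Perm}(N)$ be $x\mapsto x\eta^{-1}$ and $\lambda_N(\nu)(x)=\nu x$. For $0\le s<p^{n-1}$ let $\beta_s:G\to\mathrm{Perm}(N)$ be the homomorphism with $\beta_s(\sigma)=\rho(\eta)\circ\delta^{s}$ (an element of $\mathrm{Hol}(N)$ with translation part $\rho(\eta)$ and automorphism part $\delta^s$). Let $b_s:G\to N$, $b_s(g)=\beta_s(g)(1_N)$ (a bijection), and $\alpha_s:N\to\mathrm{Perm}(G)$, $\alpha_s(\nu)=b_s^{-1}\circ\lambda_N(\nu)\circ b_s$. Then $\alpha_s(N)$ is a regular subgroup of $\mathrm{Perm}(G)$ normalized by the left regular representation $\lambda(G)$, and $H_s=L[\alpha_s(N)]^G$, where $G$ acts on $L$ as Galois automorphisms and on $\alpha_s(N)$ by $g\ast\nu=\lambda(g)\nu\lambda(g)^{-1}$. *)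

theory Defs
  imports "HOL-Algebra.Algebra" "HOL-Computational_Algebra.Primes"
begin

section \<open>Free modules and tensor products\<close>

text \<open>
  Formal \<open>R\<close>-linear combinations of elements of \<open>B\<close> are functions of finite support that vanish
  outside \<open>B\<close>. The ring part of the record (\<open>mult\<close>, \<open>one\<close>) plays no role for a module and is
  left unspecified.
\<close>

definition free_module :: "('a, 'r) ring_scheme \<Rightarrow> 'x set \<Rightarrow> ('a, 'x \<Rightarrow> 'a) module" where
  "free_module R B =
    \<lparr>carrier = {u. (\<forall>x\<in>B. u x \<in> carrier R) \<and> (\<forall>x. x \<notin> B \<longrightarrow> u x = \<zero>\<^bsub>R\<^esub>)
                   \<and> finite {x. u x \<noteq> \<zero>\<^bsub>R\<^esub>}},
     monoid.mult = undefined,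
     monoid.one = undefined,
     ring.zero = (\<lambda>_. \<zero>\<^bsub>R\<^esub>),
     ring.add = (\<lambda>u v x. u x \<oplus>\<^bsub>R\<^esub> v x),
     module.smult = (\<lambda>c u x. c \<otimes>\<^bsub>R\<^esub> u x)\<rparr>"

definition single :: "('a, 'r) ring_scheme \<Rightarrow> 'x \<Rightarrow> ('x \<Rightarrow> 'a)" where
  "single R x = (\<lambda>y. if y = x then \<one>\<^bsub>R\<^esub> else \<zero>\<^bsub>R\<^esub>)"

text \<open>The map \<open>\<Sum> u\<^sub>x x \<mapsto> \<Sum> u\<^sub>x \<phi>(x)\<close> of formal linear combinations.\<close>

definition free_map :: "('a, 'r) ring_scheme \<Rightarrow> ('x \<Rightarrow> 'y) \<Rightarrow> ('x \<Rightarrow> 'a) \<Rightarrow> ('y \<Rightarrow> 'a)" where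
  "free_map R \<phi> u = (\<lambda>y. finsum R u {x. u x \<noteq> \<zero>\<^bsub>R\<^esub> \<and> \<phi> x = y})"

text \<open>
  \<open>V \<otimes>\<^sub>R W\<close> is the free module on \<open>V \<times> W\<close> modulo the submodule generated by the bilinearity
  relations; its elements are cosets of that submodule.
\<close>

definition bilinear_relations ::
  "('a, 'r) ring_scheme \<Rightarrow> ('a, 'v, 'e) module_scheme \<Rightarrow> ('a, 'w, 'f) module_scheme
    \<Rightarrow> ('v \<times> 'w \<Rightarrow> 'a) set" where
  "bilinear_relations R V W = (let F = free_module R (carrier V \<times> carrier W) in
      {single R (v \<oplus>\<^bsub>V\<^esub> v', w) \<ominus>\<^bsub>F\<^esub> (single R (v, w) \<oplus>\<^bsub>F\<^esub> single R (v', w)) | v v' w.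
         v \<in> carrier V \<and> v' \<in> carrier V \<and> w \<in> carrier W}
    \<union> {single R (v, w \<oplus>\<^bsub>W\<^esub> w') \<ominus>\<^bsub>F\<^esub> (single R (v, w) \<oplus>\<^bsub>F\<^esub> single R (v, w')) | v w w'.
         v \<in> carrier V \<and> w \<in> carrier W \<and> w' \<in> carrier W}
    \<union> {single R (c \<odot>\<^bsub>V\<^esub> v, w) \<ominus>\<^bsub>F\<^esub> (c \<odot>\<^bsub>F\<^esub> single R (v, w)) | c v w.
         c \<in> carrier R \<and> v \<in> carrier V \<and> w \<in> carrier W}
    \<union> {single R (v, c \<odot>\<^bsub>W\<^esub> w) \<ominus>\<^bsub>F\<^esub> (c \<odot>\<^bsub>F\<^esub> single R (v, w)) | c v w.
         c \<in> carrier R \<and> v \<in> carrier V \<and> w \<in> carrier W})"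

definition tensor_kernel ::
  "('a, 'r) ring_scheme \<Rightarrow> ('a, 'v, 'e) module_scheme \<Rightarrow> ('a, 'w, 'f) module_scheme
    \<Rightarrow> ('v \<times> 'w \<Rightarrow> 'a) set" where
  "tensor_kernel R V W =
    \<Inter> {S. submodule S R (free_module R (carrier V \<times> carrier W)) \<and> bilinear_relations R V W \<subseteq> S}"

definition tensor_class ::
  "('a, 'r) ring_scheme \<Rightarrow> ('a, 'v, 'e) module_scheme \<Rightarrow> ('a, 'w, 'f) module_scheme
    \<Rightarrow> ('v \<times> 'w \<Rightarrow> 'a) \<Rightarrow> ('v \<times> 'w \<Rightarrow> 'a) set" where
  "tensor_class R V W u = tensor_kernel R V W +>\<^bsub>free_module R (carrier V \<times> carrier W)\<^esub> u"

definition tensor_carrier ::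
  "('a, 'r) ring_scheme \<Rightarrow> ('a, 'v, 'e) module_scheme \<Rightarrow> ('a, 'w, 'f) module_scheme
    \<Rightarrow> ('v \<times> 'w \<Rightarrow> 'a) set set" where
  "tensor_carrier R V W = tensor_class R V W ` carrier (free_module R (carrier V \<times> carrier W))"

text \<open>
  The map \<open>\<Sum> c (v \<otimes> w) \<mapsto> \<Sum> c (f v \<otimes> g w)\<close> into \<open>V' \<otimes>\<^sub>R W'\<close>. The source may be a tensor product
  over \<open>R\<close> or over a subring of \<open>R\<close>. For \<open>f\<close>, \<open>g\<close> linear over the ring of the source, all
  representatives \<open>u\<close> of \<open>t\<close> give the same class, so that the union is that class.
\<close>

definition tensor_map ::
  "('a, 'r) ring_scheme \<Rightarrow> ('a, 'v2, 'e) module_scheme \<Rightarrow> ('a, 'w2, 'f) module_scheme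
    \<Rightarrow> ('v \<Rightarrow> 'v2) \<Rightarrow> ('w \<Rightarrow> 'w2) \<Rightarrow> ('v \<times> 'w \<Rightarrow> 'a) set \<Rightarrow> ('v2 \<times> 'w2 \<Rightarrow> 'a) set" where
  "tensor_map R V' W' f g t = (\<Union>u\<in>t. tensor_class R V' W' (free_map R (map_prod f g) u))"


section \<open>Hopf algebras\<close>

text \<open>
  The data of a Hopf algebra \<open>H\<close>. The ground ring \<open>R\<close> is passed separately, as for modules;
  \<open>comult\<close> takes values in \<open>tensor_carrier R H H\<close>.
\<close>

record ('a, 'b) hopf = "('a, 'b) module" +
  comult :: "'b \<Rightarrow> ('b \<times> 'b \<Rightarrow> 'a) set"
  counit :: "'b \<Rightarrow> 'a"
  antipode :: "'b \<Rightarrow> 'b"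

definition hopf_iso ::
  "('a, 'r) ring_scheme \<Rightarrow> ('a, 'b, 'e) hopf_scheme \<Rightarrow> ('a, 'c, 'f) hopf_scheme
    \<Rightarrow> ('b \<Rightarrow> 'c) set" where
  "hopf_iso R H H' = {f \<in> ring_iso H H'.
      (\<forall>c\<in>carrier R. \<forall>h\<in>carrier H. f (c \<odot>\<^bsub>H\<^esub> h) = c \<odot>\<^bsub>H'\<^esub> f h) \<and>
      (\<forall>h\<in>carrier H. comult H' (f h) = tensor_map R H' H' f f (comult H h)) \<and>
      (\<forall>h\<in>carrier H. counit H' (f h) = counit H h) \<and>
      (\<forall>h\<in>carrier H. antipode H' (f h) = f (antipode H h))}"

definition hopf_isomorphic ::
  "('a, 'r) ring_scheme \<Rightarrow> ('a, 'b, 'e) hopf_scheme \<Rightarrow> ('a, 'c, 'f) hopf_scheme \<Rightarrow> bool" where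
  "hopf_isomorphic R H H' \<longleftrightarrow> hopf_iso R H H' \<noteq> {}"


section \<open>Group algebras\<close>

text \<open>The group algebra \<open>R[M]\<close> with \<open>\<Delta>(m) = m \<otimes> m\<close>, \<open>\<epsilon>(m) = 1\<close>, \<open>S(m) = m\<^sup>-\<^sup>1\<close> for \<open>m \<in> M\<close>.\<close>

definition group_algebra ::
  "('a, 'r) ring_scheme \<Rightarrow> ('m, 's) monoid_scheme \<Rightarrow> ('a, 'm \<Rightarrow> 'a) module" where
  "group_algebra R M = (free_module R (carrier M))
    \<lparr>monoid.mult := (\<lambda>a b. free_map R (\<lambda>(x, y). x \<otimes>\<^bsub>M\<^esub> y) (\<lambda>(x, y). a x \<otimes>\<^bsub>R\<^esub> b y)),
     monoid.one := single R \<one>\<^bsub>M\<^esub>\<rparr>"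

definition group_hopf ::
  "('a, 'r) ring_scheme \<Rightarrow> ('m, 's) monoid_scheme \<Rightarrow> ('a, 'm \<Rightarrow> 'a) hopf" where
  "group_hopf R M = module.extend (group_algebra R M)
    \<lparr>comult = (\<lambda>a. tensor_class R (group_algebra R M) (group_algebra R M)
                     (free_map R (\<lambda>m. (single R m, single R m)) a)),
     counit = (\<lambda>a. finsum R a {m. a m \<noteq> \<zero>\<^bsub>R\<^esub>}),
     antipode = free_map R (\<lambda>m. inv\<^bsub>M\<^esub> m)\<rparr>"


section \<open>Galois extensions and descent\<close>

definition galois_group :: "('a, 'r) ring_scheme \<Rightarrow> 'a set \<Rightarrow> ('a \<Rightarrow> 'a) monoid" where
  "galois_group L K = (BijGroup (carrier L))
    \<lparr>carrier := {g \<in> ring_hom L L \<inter> Bij (carrier L). \<forall>k\<in>K. g k = k}\<rparr>"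

definition galois_extension :: "('a, 'r) ring_scheme \<Rightarrow> 'a set \<Rightarrow> bool" where
  "galois_extension L K \<longleftrightarrow> field L \<and> subfield K L \<and> ring.finite_dimension L K (carrier L) \<and>
     {x \<in> carrier L. \<forall>g\<in>carrier (galois_group L K). g x = x} = K"

definition left_regular :: "('g, 's) monoid_scheme \<Rightarrow> 'g \<Rightarrow> ('g \<Rightarrow> 'g)" where
  "left_regular G g = (\<lambda>x\<in>carrier G. g \<otimes>\<^bsub>G\<^esub> x)"

definition conj_left_regular ::
  "('g, 's) monoid_scheme \<Rightarrow> 'g \<Rightarrow> ('g \<Rightarrow> 'g) \<Rightarrow> ('g \<Rightarrow> 'g)" where
  "conj_left_regular G g m =
     left_regular G g \<otimes>\<^bsub>BijGroup (carrier G)\<^esub> m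
       \<otimes>\<^bsub>BijGroup (carrier G)\<^esub> inv\<^bsub>BijGroup (carrier G)\<^esub> (left_regular G g)"

text \<open>\<open>g \<cdot> \<Sum> a\<^sub>m m = \<Sum> g(a\<^sub>m) (\<lambda>(g) m \<lambda>(g)\<^sup>-\<^sup>1)\<close>, for \<open>g\<close> in a group \<open>G\<close> of automorphisms of \<open>L\<close>.\<close>

definition descent_action ::
  "('a, 'r) ring_scheme \<Rightarrow> ('a \<Rightarrow> 'a, 's) monoid_scheme \<Rightarrow> ('a \<Rightarrow> 'a)
    \<Rightarrow> ((('a \<Rightarrow> 'a) \<Rightarrow> ('a \<Rightarrow> 'a)) \<Rightarrow> 'a) \<Rightarrow> ((('a \<Rightarrow> 'a) \<Rightarrow> ('a \<Rightarrow> 'a)) \<Rightarrow> 'a)" where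
  "descent_action L G g a = free_map L (conj_left_regular G g) (\<lambda>m. g (a m))"

text \<open>
  The \<open>K\<close>-Hopf algebra \<open>H = L[M]\<^sup>G\<close>, for \<open>G\<close> the Galois group of \<open>L/K\<close> and \<open>M\<close> a regular subgroup of
  \<open>Perm(G)\<close> normalized by \<open>\<lambda>(G)\<close>. All operations are those of \<open>L[M]\<close>. For the comultiplication this
  means that \<open>\<Delta>(h)\<close> is the element of \<open>H \<otimes>\<^sub>K H\<close> whose image under the (injective) canonical map
  \<open>H \<otimes>\<^sub>K H \<rightarrow> L[M] \<otimes>\<^sub>L L[M]\<close> is the comultiplication of \<open>h\<close> in \<open>L[M]\<close>.
\<close>

definition descent_hopf ::
  "('a, 'r) ring_scheme \<Rightarrow> 'a set \<Rightarrow> (('a \<Rightarrow> 'a) \<Rightarrow> ('a \<Rightarrow> 'a), 's) monoid_scheme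
    \<Rightarrow> ('a, (('a \<Rightarrow> 'a) \<Rightarrow> ('a \<Rightarrow> 'a)) \<Rightarrow> 'a) hopf" where
  "descent_hopf L K M =
    (let G = galois_group L K;
         A = group_hopf L M;
         H = A\<lparr>carrier := {a \<in> carrier A. \<forall>g\<in>carrier G. descent_action L G g a = a}\<rparr>
     in H\<lparr>comult := (\<lambda>h. THE t. t \<in> tensor_carrier (L\<lparr>carrier := K\<rparr>) H H \<and>
                              tensor_map L A A (\<lambda>a. a) (\<lambda>a. a) t = comult A h)\<rparr>)"


section \<open>The regular subgroups attached to a cyclic group\<close>

definition right_regular :: "('n, 's) monoid_scheme \<Rightarrow> 'n \<Rightarrow> ('n \<Rightarrow> 'n)" where
  "right_regular N \<nu> = (\<lambda>x\<in>carrier N. x \<otimes>\<^bsub>N\<^esub> inv\<^bsub>N\<^esub> \<nu>)"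

text \<open>
  \<open>beta G \<sigma> N \<eta> \<delta> s\<close> is the homomorphism \<open>\<beta>\<^sub>s : G \<rightarrow> Perm(N)\<close> with \<open>\<beta>\<^sub>s(\<sigma>) = \<rho>(\<eta>) \<circ> \<delta>\<^sup>s\<close>; extensionality
  makes it unique as a function on the whole type.
\<close>

definition beta ::
  "('g, 's) monoid_scheme \<Rightarrow> 'g \<Rightarrow> ('n, 't) monoid_scheme \<Rightarrow> 'n \<Rightarrow> ('n \<Rightarrow> 'n) \<Rightarrow> nat
    \<Rightarrow> 'g \<Rightarrow> ('n \<Rightarrow> 'n)" where
  "beta G \<sigma> N \<eta> \<delta> s =
    (THE f. f \<in> hom G (BijGroup (carrier N)) \<and> f \<in> extensional (carrier G) \<and>
       f \<sigma> = right_regular N \<eta> \<otimes>\<^bsub>BijGroup (carrier N)\<^esub> (\<delta> [^]\<^bsub>AutoGroup N\<^esub> s))"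

definition b_map ::
  "('g, 's) monoid_scheme \<Rightarrow> 'g \<Rightarrow> ('n, 't) monoid_scheme \<Rightarrow> 'n \<Rightarrow> ('n \<Rightarrow> 'n) \<Rightarrow> nat
    \<Rightarrow> 'g \<Rightarrow> 'n" where
  "b_map G \<sigma> N \<eta> \<delta> s g = beta G \<sigma> N \<eta> \<delta> s g \<one>\<^bsub>N\<^esub>"

definition alpha ::
  "('g, 's) monoid_scheme \<Rightarrow> 'g \<Rightarrow> ('n, 't) monoid_scheme \<Rightarrow> 'n \<Rightarrow> ('n \<Rightarrow> 'n) \<Rightarrow> nat
    \<Rightarrow> 'n \<Rightarrow> ('g \<Rightarrow> 'g)" where
  "alpha G \<sigma> N \<eta> \<delta> s \<nu> =
    (\<lambda>x\<in>carrier G. inv_into (carrier G) (b_map G \<sigma> N \<eta> \<delta> s)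
                      (left_regular N \<nu> (b_map G \<sigma> N \<eta> \<delta> s x)))"

definition alpha_group ::
  "('g, 's) monoid_scheme \<Rightarrow> 'g \<Rightarrow> ('n, 't) monoid_scheme \<Rightarrow> 'n \<Rightarrow> ('n \<Rightarrow> 'n) \<Rightarrow> nat
    \<Rightarrow> ('g \<Rightarrow> 'g) monoid" where
  "alpha_group G \<sigma> N \<eta> \<delta> s =
    (BijGroup (carrier G))\<lparr>carrier := alpha G \<sigma> N \<eta> \<delta> s ` carrier N\<rparr>"

definition hopf_galois_structure ::
  "('a, 'r) ring_scheme \<Rightarrow> 'a set \<Rightarrow> ('a \<Rightarrow> 'a) \<Rightarrow> ('n, 't) monoid_scheme \<Rightarrow> 'n
    \<Rightarrow> ('n \<Rightarrow> 'n) \<Rightarrow> nat \<Rightarrow> ('a, (('a \<Rightarrow> 'a) \<Rightarrow> ('a \<Rightarrow> 'a)) \<Rightarrow> 'a) hopf" where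
  "hopf_galois_structure L K \<sigma> N \<eta> \<delta> s =
     descent_hopf L K (alpha_group (galois_group L K) \<sigma> N \<eta> \<delta> s)"

end

theory Submission
  imports Defs "HOL-Number_Theory.Residues"
begin

text \<open>
  Write \<open>M\<^sub>s = \<alpha>\<^sub>s(N)\<close>. Conjugation by \<open>\<lambda>(\<sigma>)\<close> acts on \<open>M\<^sub>s \<cong> N\<close> as \<open>\<delta>\<^sup>s\<close>, because \<open>b\<^sub>s\<close> intertwines \<open>\<lambda>(\<sigma>)\<close>
  with \<open>\<rho>(\<eta>) \<delta>\<^sup>s\<close>; here \<open>b\<^sub>s(\<sigma>\<^sup>k)\<close> is \<open>\<eta>\<^sup>-\<^sup>1\<close> to the power \<open>1 + D + \<dots> + D\<^sup>k\<^sup>-\<^sup>1\<close> with \<open>D \<equiv> 1\<close> modulo the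
  odd prime \<open>p\<close>, so that \<open>b\<^sub>s\<close> is bijective.

  A Hopf isomorphism \<open>f : H\<^sub>r \<rightarrow> H\<^sub>s\<close> extends \<open>L\<close>-linearly to \<open>L[M\<^sub>r] \<rightarrow> L[M\<^sub>s]\<close> and is thus given by a
  matrix \<open>\<Phi>(m, x)\<close>. Compatibility with comultiplication makes the entries of each row orthogonal
  idempotents of the field \<open>L\<close>, and compatibility with the counit makes the row sums 1, so \<open>\<Phi>\<close> is the
  matrix of a map \<open>\<phi> : M\<^sub>r \<rightarrow> M\<^sub>s\<close>. This map is a \<open>G\<close>-equivariant surjective homomorphism. It induces an
  automorphism of \<open>N\<close> intertwining \<open>\<delta>\<^sup>r\<close> and \<open>\<delta>\<^sup>s\<close>. Endomorphisms of a cyclic group commute, so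
  \<open>\<delta>\<^sup>r = \<delta>\<^sup>s\<close>, and \<open>r = s\<close> since \<open>\<delta>\<close> has order \<open>p\<^sup>n\<^sup>-\<^sup>1\<close>.

  The base change is made explicit by elements \<open>l\<^sub>i, l'\<^sub>i\<close> of \<open>L\<close> with \<open>\<Sum> l'\<^sub>i g(l\<^sub>i) = 1\<close> for \<open>g = 1\<close> and \<open>0\<close>
  for the other \<open>g\<close> in \<open>G\<close>: the orbit sums of \<open>l\<^sub>i m\<close>, together with those of \<open>l'\<^sub>i t m\<close> where \<open>t\<close> has
  trace 1, form dual frames of \<open>L[M]\<^sup>G\<close>. They show that \<open>L[M]\<^sup>G \<otimes>\<^sub>K L[M]\<^sup>G\<close> embeds into \<open>L[M] \<otimes>\<^sub>L L[M]\<close> with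
  the comultiplication in its image.
\<close>

section \<open>Geometric sums modulo prime powers\<close>

abbreviation geometric_sum :: "nat \<Rightarrow> nat \<Rightarrow> nat" where
  "geometric_sum D k \<equiv> (\<Sum>i<k. D ^ i)"

lemma geometric_sum_add: "geometric_sum D (j + k) = geometric_sum D j + D ^ j * geometric_sum D k"
  by (induction k) (simp_all add: power_add algebra_simps)

lemma geometric_sum_mult: "geometric_sum D (j * k) = geometric_sum D j * geometric_sum (D ^ j) k"
proof (induction k)
  case (Suc k)
  have "geometric_sum D (j * Suc k) = geometric_sum D (j * k) + D ^ (j * k) * geometric_sum D j"
    using geometric_sum_add[of D "j * k" j] by (simp add: add.commute)
  then show ?case
    using Suc by (simp add: power_mult distrib_left mult.commute)
qed simp

lemma power_eq_geometric_sum: "(1 + x) ^ k = 1 + x * geometric_sum (1 + x) k"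
  by (induction k) (simp_all add: algebra_simps)

lemma geometric_sum_cong:
  fixes p :: nat
  assumes "[D = 1] (mod p)" shows "[geometric_sum D k = k] (mod p)"
proof -
  have "[geometric_sum D k = (\<Sum>i<k. 1 ^ i)] (mod p)"
    by (intro cong_sum cong_pow assms)
  then show ?thesis by simp
qed

lemma power_one_plus_cong: "[(1 + x) ^ k = 1 + k * x] (mod x\<^sup>2)" for x :: nat
proof (induction k)
  case (Suc k)
  have "[(1 + x) ^ Suc k = (1 + k * x) * (1 + x)] (mod x\<^sup>2)"
    using cong_scalar_right[OF Suc, of "1 + x"] by (simp add: mult.commute)
  also have "(1 + k * x) * (1 + x) = (1 + Suc k * x) + k * x\<^sup>2"
    by (simp add: algebra_simps power2_eq_square)
  also have "[\<dots> = 1 + Suc k * x] (mod x\<^sup>2)"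
    by (simp add: cong_def)
  finally show ?case .
qed simp

lemma geometric_sum_odd_cong:
  fixes p :: nat
  assumes "odd p" shows "[geometric_sum (1 + p * t) p = p] (mod p\<^sup>2)"
proof -
  obtain q where q: "p = 2 * q + 1" using assms by (elim oddE)
  have "\<Sum>{..<2 * q + 1} = (2 * q + 1) * q"
    by (induction q) (simp_all add: algebra_simps)
  then have sum: "\<Sum>{..<p} = p * q" using q by simp
  have "p\<^sup>2 dvd (p * t)\<^sup>2" by (simp add: power_mult_distrib)
  then have "[(1 + p * t) ^ i = 1 + i * (p * t)] (mod p\<^sup>2)" for i
    using power_one_plus_cong by (rule cong_dvd_modulus_nat[rotated])
  then have "[geometric_sum (1 + p * t) p = (\<Sum>i<p. 1 + i * (p * t))] (mod p\<^sup>2)"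
    by (rule cong_sum)
  also have "(\<Sum>i<p. 1 + i * (p * t)) = p + \<Sum>{..<p} * (p * t)"
    by (simp only: sum.distrib sum_distrib_right) simp
  also have "\<dots> = p + p\<^sup>2 * (q * t)"
    by (simp add: sum power2_eq_square)
  also have "[\<dots> = p] (mod p\<^sup>2)"
    by (simp add: cong_def)
  finally show ?thesis .
qed

lemma coprime_power_if_cong_one:
  fixes p :: nat
  assumes "[D = 1] (mod p)" shows "coprime (p ^ n) D"
  using assms by (metis cong_imp_coprime cong_sym coprime_1_left coprime_commute coprime_power_left_iff)

context
  fixes p D :: nat
  assumes p: "Factorial_Ring.prime p" "odd p" and D: "[D = 1] (mod p)"
begin

lemma cong_one_obtains:
  obtains t where "D = 1 + p * t"
proof -
  have "p \<noteq> 1" using p(1) by auto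
  then show ?thesis
    using that D by (metis add.commute cong_to_1'_nat mult.commute)
qed

lemma geometric_sum_prime:
  obtains c where "geometric_sum D p = p * c" "[c = 1] (mod p)"
proof -
  obtain t where t: "D = 1 + p * t" by (rule cong_one_obtains)
  have sq: "[geometric_sum D p = p] (mod p\<^sup>2)"
    unfolding t by (rule geometric_sum_odd_cong[OF p(2)])
  have "p dvd geometric_sum D p"
    using geometric_sum_cong[OF D, of p] by (simp add: cong_def mod_eq_0_iff_dvd)
  then obtain c where c: "geometric_sum D p = p * c" by blast
  then have "[p * c = p * 1] (mod p * p)" using sq by (simp add: power2_eq_square)
  then have "[c = 1] (mod p)" using p(1) by (simp add: cong_def prime_gt_0_nat)
  with c show ?thesis by (rule that)
qed

end

lemma prime_power_dvd_geometric_sum_iff: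
  fixes p :: nat
  assumes p: "Factorial_Ring.prime p" "odd p" and D: "[D = 1] (mod p)"
  shows "p ^ n dvd geometric_sum D k \<longleftrightarrow> p ^ n dvd k"
  using D
proof (induction n arbitrary: D k)
  case (Suc n)
  show ?case
  proof (cases "p dvd k")
    case True
    then obtain m where m: "k = p * m" by blast
    obtain c where c: "geometric_sum D p = p * c" "[c = 1] (mod p)"
      by (rule geometric_sum_prime[OF p Suc.prems])
    have "[D ^ p = 1] (mod p)"
      using cong_pow[OF Suc.prems, of p] by simp
    then have "p ^ n dvd geometric_sum (D ^ p) m \<longleftrightarrow> p ^ n dvd m"
      by (rule Suc.IH)
    then show ?thesis
      using p(1) coprime_power_if_cong_one[OF c(2), of n]
      by (simp add: m geometric_sum_mult c(1) mult.assoc coprime_dvd_mult_right_iff prime_gt_0_nat)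
  next
    case False
    then have "\<not> p dvd geometric_sum D k"
      using cong_dvd_iff[OF geometric_sum_cong[OF Suc.prems]] by simp
    with False show ?thesis by (metis dvd_mult_left power_Suc)
  qed
qed simp

lemma geometric_sum_cong_iff:
  fixes p :: nat
  assumes "Factorial_Ring.prime p" "odd p" and D: "[D = 1] (mod p)"
  shows "[geometric_sum D j = geometric_sum D k] (mod p ^ n) \<longleftrightarrow> [j = k] (mod p ^ n)"
proof (induction j k rule: linorder_wlog)
  case (le j k)
  then obtain m where k: "k = j + m" using le_Suc_ex by blast
  have "[geometric_sum D k = geometric_sum D j] (mod p ^ n) \<longleftrightarrow> p ^ n dvd D ^ j * geometric_sum D m"
    unfolding k geometric_sum_add by (simp add: cong_add_lcancel_0_nat cong_0_iff)
  also have "\<dots> \<longleftrightarrow> p ^ n dvd m"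
    using coprime_power_if_cong_one[OF D, of n] prime_power_dvd_geometric_sum_iff[OF assms]
    by (simp add: coprime_dvd_mult_right_iff)
  also have "\<dots> \<longleftrightarrow> [k = j] (mod p ^ n)"
    unfolding k by (simp add: cong_add_lcancel_0_nat cong_0_iff)
  finally show ?case by (simp only: cong_sym_eq)
qed (simp only: cong_sym_eq)

lemma power_prime_power_cong:
  fixes p :: nat
  assumes p: "Factorial_Ring.prime p" "odd p" and D: "[D = 1] (mod p)"
  shows "[D ^ (p ^ n) = 1] (mod p ^ n)"
proof -
  obtain t where t: "D = 1 + p * t" by (rule cong_one_obtains[OF p D])
  have "D ^ (p ^ n) = 1 + p * t * geometric_sum D (p ^ n)"
    unfolding t by (rule power_eq_geometric_sum)
  moreover have "p ^ n dvd geometric_sum D (p ^ n)"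
    by (simp add: prime_power_dvd_geometric_sum_iff[OF assms])
  ultimately show ?thesis by (simp only: cong_add_lcancel_0_nat cong_0_iff dvd_mult)
qed

section \<open>Finite sums and linear systems\<close>

context abelian_monoid begin

lemma finsum_lessThan_add:
  fixes m n :: nat
  assumes "\<And>i. i < n + m \<Longrightarrow> f i \<in> carrier G"
  shows "finsum G f {..<n + m} = finsum G f {..<n} \<oplus> (\<Oplus>i\<in>{..<m}. f (n + i))"
  using assms by (induction m) (simp_all add: lessThan_Suc Pi_def a_ac)

lemma finsum_delta:
  assumes "finite A" "i \<in> A" "x \<in> carrier G"
  shows "(\<Oplus>j\<in>A. if j = i then x else \<zero>) = x"
  using add.finprod_singleton_swap[of i A "\<lambda>_. x"] assms by simp

lemma finsum_reindex_bij:
  assumes "bij_betw h A B" "f \<in> B \<rightarrow> carrier G"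
  shows "finsum G f B = (\<Oplus>x\<in>A. f (h x))"
  using finsum_reindex[of f h A] assms by (simp add: bij_betw_def)

lemma finsum_Times:
  assumes "finite A" "finite B" "f \<in> A \<times> B \<rightarrow> carrier G"
  shows "finsum G f (A \<times> B) = (\<Oplus>x\<in>A. \<Oplus>y\<in>B. f (x, y))"
  using assms(1,3)
proof (induction A)
  case (insert a A)
  have "finsum G f (insert a A \<times> B) = finsum G f (Pair a ` B \<union> A \<times> B)"
    by (rule arg_cong[where f = "finsum G f"]) auto
  also have "\<dots> = finsum G f (Pair a ` B) \<oplus> finsum G f (A \<times> B)"
    using insert assms(2) by (intro finsum_Un_disjoint) auto
  also have "finsum G f (Pair a ` B) = (\<Oplus>y\<in>B. f (a, y))"
    using insert by (intro finsum_reindex) (auto simp: inj_on_def)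
  finally show ?case
    using insert by (simp add: Pi_def)
qed simp

lemma finsum_swap:
  assumes "finite A" "finite B" "\<And>x y. \<lbrakk>x \<in> A; y \<in> B\<rbrakk> \<Longrightarrow> f x y \<in> carrier G"
  shows "(\<Oplus>x\<in>A. \<Oplus>y\<in>B. f x y) = (\<Oplus>y\<in>B. \<Oplus>x\<in>A. f x y)"
proof -
  have "bij_betw prod.swap (B \<times> A) (A \<times> B)"
    by (rule bij_betw_byWitness[of _ prod.swap]) auto
  then have "(\<Oplus>xy\<in>A \<times> B. case_prod f xy) = (\<Oplus>yx\<in>B \<times> A. case_prod f (prod.swap yx))"
    by (rule finsum_reindex_bij) (use assms(3) in auto)
  then show ?thesis
    using assms by (simp add: finsum_Times split_def Pi_def)
qed

end

lemma (in semiring) finsum_product: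
  assumes "finite A" "finite B" "f \<in> A \<rightarrow> carrier R" "g \<in> B \<rightarrow> carrier R"
  shows "finsum R f A \<otimes> finsum R g B = (\<Oplus>xy\<in>A \<times> B. f (fst xy) \<otimes> g (snd xy))"
proof -
  have "finsum R f A \<otimes> finsum R g B = (\<Oplus>x\<in>A. f x \<otimes> finsum R g B)"
    using assms by (intro finsum_ldistr) auto
  also have "\<dots> = (\<Oplus>x\<in>A. \<Oplus>y\<in>B. f x \<otimes> g y)"
    using assms by (intro finsum_cong' refl finsum_rdistr) (auto intro!: finsum_closed)
  also have "\<dots> = (\<Oplus>xy\<in>A \<times> B. f (fst xy) \<otimes> g (snd xy))"
    using assms by (simp add: finsum_Times Pi_iff)
  finally show ?thesis .
qed

lemma (in ring) finsum_subring:
  assumes K: "subring K R" and f: "f \<in> A \<rightarrow> K"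
  shows finsum_in_subring: "finsum R f A \<in> K"
    and finsum_subring_eq: "finsum (R\<lparr>carrier := K\<rparr>) f A = finsum R f A"
proof -
  interpret K: ring "R\<lparr>carrier := K\<rparr>" by (rule subring_is_ring[OF K])
  have "finsum (R\<lparr>carrier := K\<rparr>) f A = finsum R f A \<and> finsum R f A \<in> K"
    using f
  proof (induction A rule: infinite_finite_induct)
    case (infinite A)
    then show ?case
      using K.finsum_infinite[of A f] finsum_infinite[of A f] subringE(2)[OF K] by simp
  next
    case empty
    then show ?case using K.finsum_empty[of f] subringE(2)[OF K] by simp
  next
    case (insert a A)
    then have "finsum R f (insert a A) = f a \<oplus> finsum R f A"
      using subringE(1)[OF K] by (intro finsum_insert) auto
    moreover have "finsum (R\<lparr>carrier := K\<rparr>) f (insert a A) = f a \<oplus> finsum (R\<lparr>carrier := K\<rparr>) f A"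
      using insert K.finsum_insert[of A a f] by auto
    ultimately show ?case
      using insert subringE(7)[OF K] by auto
  qed
  then show "finsum R f A \<in> K" "finsum (R\<lparr>carrier := K\<rparr>) f A = finsum R f A" by auto
qed

lemma (in ring) combine_eq_finsum:
  assumes "length Ks = length Us" "set Ks \<subseteq> carrier R" "set Us \<subseteq> carrier R"
  shows "combine Ks Us = (\<Oplus>j\<in>{..<length Us}. Ks ! j \<otimes> Us ! j)"
  using assms
proof (induction Us arbitrary: Ks rule: rev_induct)
  case (snoc u Us)
  then obtain Ks' k where Ks: "Ks = Ks' @ [k]" "length Ks' = length Us"
    by (cases Ks rule: rev_cases) auto
  have carrier: "set Ks' \<subseteq> carrier R" "set Us \<subseteq> carrier R" "k \<in> carrier R" "u \<in> carrier R"
    using snoc.prems Ks by auto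
  have "combine Ks (Us @ [u]) = combine Ks' Us \<oplus> combine [k] [u]"
    unfolding Ks(1) using carrier Ks(2) by (intro combine_append[symmetric]) auto
  also have "combine Ks' Us = (\<Oplus>j\<in>{..<length Us}. Ks' ! j \<otimes> Us ! j)"
    using snoc.IH[OF Ks(2)] carrier by simp
  also have "\<dots> = (\<Oplus>j\<in>{..<length Us}. Ks ! j \<otimes> (Us @ [u]) ! j)"
    using carrier Ks by (intro finsum_cong') (auto simp: nth_append subset_iff)
  also have "\<dots> \<oplus> combine [k] [u] = (\<Oplus>j\<in>{..<Suc (length Us)}. Ks ! j \<otimes> (Us @ [u]) ! j)"
    using carrier Ks by (simp add: lessThan_Suc Pi_def nth_append subset_iff a_comm)
  finally show ?case by simp
qed simp

text \<open>Eliminating the unknown \<open>c\<^sub>k\<close> by means of the equation with coefficients \<open>r\<close>.\<close>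

lemma (in field) finsum_eliminate:
  assumes B: "finite B" "k \<notin> B" and a: "\<And>i. i \<in> insert k B \<Longrightarrow> a i \<in> carrier R"
    and r: "\<And>i. i \<in> insert k B \<Longrightarrow> r i \<in> carrier R" "r k \<noteq> \<zero>"
    and c: "\<And>i. i \<in> B \<Longrightarrow> c i \<in> carrier R"
  shows "(\<Oplus>i\<in>insert k B. a i \<otimes> (c(k := \<ominus> (inv (r k) \<otimes> (\<Oplus>i\<in>B. r i \<otimes> c i)))) i)
    = (\<Oplus>i\<in>B. (a i \<ominus> a k \<otimes> inv (r k) \<otimes> r i) \<otimes> c i)"
proof -
  define q where "q = inv (r k)"
  have q: "q \<in> carrier R" using r field_Units by (simp add: q_def)
  define s where "s = (\<Oplus>i\<in>B. r i \<otimes> c i)"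
  have s: "s \<in> carrier R" unfolding s_def using r c by (intro finsum_closed) auto
  define t where "t = (\<Oplus>i\<in>B. a i \<otimes> c i)"
  have t: "t \<in> carrier R" unfolding t_def using a c by (intro finsum_closed) auto
  have "(\<Oplus>i\<in>insert k B. a i \<otimes> (c(k := \<ominus> (q \<otimes> s))) i)
      = a k \<otimes> \<ominus> (q \<otimes> s) \<oplus> (\<Oplus>i\<in>B. a i \<otimes> (c(k := \<ominus> (q \<otimes> s))) i)"
    using B a c q s by (subst finsum_insert) auto
  also have "(\<Oplus>i\<in>B. a i \<otimes> (c(k := \<ominus> (q \<otimes> s))) i) = t"
    unfolding t_def using B a c by (intro finsum_cong') auto
  also have "a k \<otimes> \<ominus> (q \<otimes> s) \<oplus> t = t \<oplus> \<ominus> (a k \<otimes> q) \<otimes> s"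
    using a q s t by (simp add: r_minus l_minus m_assoc a_comm)
  also have "\<dots> = (\<Oplus>i\<in>B. a i \<otimes> c i \<oplus> \<ominus> (a k \<otimes> q) \<otimes> (r i \<otimes> c i))"
    unfolding s_def t_def using B a r c q by (subst finsum_rdistr, simp_all add: Pi_def finsum_addf)
  also have "\<dots> = (\<Oplus>i\<in>B. (a i \<ominus> a k \<otimes> q \<otimes> r i) \<otimes> c i)"
    using a r c q by (intro finsum_cong') (auto simp: minus_eq l_distr l_minus m_assoc)
  finally show ?thesis unfolding q_def s_def .
qed

lemma (in field) nontrivial_solution_insert:
  fixes m :: nat
  assumes B: "finite B" "k \<notin> B" and pivot: "a m k \<noteq> \<zero>"
    and a: "\<And>j i. \<lbrakk>j < Suc m; i \<in> insert k B\<rbrakk> \<Longrightarrow> a j i \<in> carrier R"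
    and c: "c \<in> B \<rightarrow> carrier R" "\<exists>i\<in>B. c i \<noteq> \<zero>"
      "\<And>j. j < m \<Longrightarrow> (\<Oplus>i\<in>B. (a j i \<ominus> a j k \<otimes> inv (a m k) \<otimes> a m i) \<otimes> c i) = \<zero>"
  obtains c' where "c' \<in> insert k B \<rightarrow> carrier R" "\<exists>i\<in>insert k B. c' i \<noteq> \<zero>"
    "\<And>j. j < Suc m \<Longrightarrow> (\<Oplus>i\<in>insert k B. a j i \<otimes> c' i) = \<zero>"
proof
  let ?c = "c(k := \<ominus> (inv (a m k) \<otimes> (\<Oplus>i\<in>B. a m i \<otimes> c i)))"
  have inv: "inv (a m k) \<in> carrier R" "a m k \<otimes> inv (a m k) = \<one>"
    using pivot a[of m k] field_Units by auto
  show "?c \<in> insert k B \<rightarrow> carrier R"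
    using c(1) inv(1) a by (auto simp: Pi_def intro!: finsum_closed a_inv_closed)
  show "\<exists>i\<in>insert k B. ?c i \<noteq> \<zero>" using c(2) B(2) by auto
  fix j assume j: "j < Suc m"
  have "(\<Oplus>i\<in>insert k B. a j i \<otimes> ?c i) = (\<Oplus>i\<in>B. (a j i \<ominus> a j k \<otimes> inv (a m k) \<otimes> a m i) \<otimes> c i)"
    using B c(1) pivot a j by (intro finsum_eliminate) (auto simp: Pi_def)
  also have "\<dots> = \<zero>"
  proof (cases "j = m")
    case True
    then show ?thesis
      using inv(2) c(1) a[of m] by (intro add.finprod_one_eqI) (auto simp: minus_eq r_neg Pi_def)
  next
    case False
    then show ?thesis using c(3) j by simp
  qed
  finally show "(\<Oplus>i\<in>insert k B. a j i \<otimes> ?c i) = \<zero>" .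
qed

lemma (in field) exists_nontrivial_solution:
  fixes m :: nat
  assumes "finite A" "m < card A"
    and "\<And>j i. \<lbrakk>j < m; i \<in> A\<rbrakk> \<Longrightarrow> a j i \<in> carrier R"
  obtains c where "c \<in> A \<rightarrow> carrier R" "\<exists>i\<in>A. c i \<noteq> \<zero>"
    "\<And>j. j < m \<Longrightarrow> (\<Oplus>i\<in>A. a j i \<otimes> c i) = \<zero>"
  using assms
proof (induction m arbitrary: A a thesis)
  case 0
  then have "A \<noteq> {}" by auto
  then show ?case by (intro "0.prems"(1)[of "\<lambda>_. \<one>"]) auto
next
  case (Suc m)
  show ?case
  proof (cases "\<forall>i\<in>A. a m i = \<zero>")
    case True
    obtain c where c: "c \<in> A \<rightarrow> carrier R" "\<exists>i\<in>A. c i \<noteq> \<zero>"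
        "\<And>j. j < m \<Longrightarrow> (\<Oplus>i\<in>A. a j i \<otimes> c i) = \<zero>"
      by (rule Suc.IH[of A a]) (use Suc.prems(2-4) in auto)
    have "(\<Oplus>i\<in>A. a m i \<otimes> c i) = \<zero>"
      using True c(1) by (intro add.finprod_one_eqI) (auto simp: Pi_def)
    then show ?thesis using c by (intro Suc.prems(1)[of c]) (auto simp: less_Suc_eq)
  next
    case False
    then obtain k where k: "k \<in> A" "a m k \<noteq> \<zero>" by blast
    define B where "B = A - {k}"
    have B: "finite B" "k \<notin> B" "A = insert k B" "m < card B"
      using Suc.prems(2,3) k(1) by (auto simp: B_def)
    let ?a = "\<lambda>j i. a j i \<ominus> a j k \<otimes> inv (a m k) \<otimes> a m i"
    have "inv (a m k) \<in> carrier R"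
      using k Suc.prems(4)[of m k] field_Units by auto
    then obtain c where c: "c \<in> B \<rightarrow> carrier R" "\<exists>i\<in>B. c i \<noteq> \<zero>"
        "\<And>j. j < m \<Longrightarrow> (\<Oplus>i\<in>B. ?a j i \<otimes> c i) = \<zero>"
      using Suc.IH[of B ?a] B k(1) Suc.prems(4) by auto
    show ?thesis
      by (rule nontrivial_solution_insert[where a = a and m = m, OF B(1,2) k(2) _ c])
        (use Suc.prems(1,4) in \<open>auto simp: B(3)\<close>)
  qed
qed

section \<open>Automorphisms of a Galois extension\<close>

locale field_automorphisms = field L + G: group G
  for L :: "('a, 'l) ring_scheme" (structure) and G :: "('a \<Rightarrow> 'a) monoid" +
  assumes aut_hom: "g \<in> carrier G \<Longrightarrow> g \<in> ring_hom L L"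
    and aut_mult: "\<lbrakk>g \<in> carrier G; h \<in> carrier G; x \<in> carrier L\<rbrakk> \<Longrightarrow> (g \<otimes>\<^bsub>G\<^esub> h) x = g (h x)"
    and aut_one: "x \<in> carrier L \<Longrightarrow> \<one>\<^bsub>G\<^esub> x = x"
    and aut_ext: "\<lbrakk>g \<in> carrier G; h \<in> carrier G; \<And>x. x \<in> carrier L \<Longrightarrow> g x = h x\<rbrakk> \<Longrightarrow> g = h"
begin

lemma aut_closed [simp]: "\<lbrakk>g \<in> carrier G; x \<in> carrier L\<rbrakk> \<Longrightarrow> g x \<in> carrier L"
  using ring_hom_closed[OF aut_hom] by blast

lemma aut_add [simp]: "\<lbrakk>g \<in> carrier G; x \<in> carrier L; y \<in> carrier L\<rbrakk> \<Longrightarrow> g (x \<oplus> y) = g x \<oplus> g y"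
  using ring_hom_add[OF aut_hom] by blast

lemma aut_times [simp]: "\<lbrakk>g \<in> carrier G; x \<in> carrier L; y \<in> carrier L\<rbrakk> \<Longrightarrow> g (x \<otimes> y) = g x \<otimes> g y"
  using ring_hom_mult[OF aut_hom] by blast

lemma aut_1 [simp]: "g \<in> carrier G \<Longrightarrow> g \<one> = \<one>"
  using ring_hom_one[OF aut_hom] by blast

lemma aut_0 [simp]: "g \<in> carrier G \<Longrightarrow> g \<zero> = \<zero>"
  using ring_hom_zero[OF aut_hom ring_axioms ring_axioms] by blast

lemma aut_finsum:
  assumes "g \<in> carrier G" "f \<in> A \<rightarrow> carrier L"
  shows "g (\<Oplus>i\<in>A. f i) = (\<Oplus>i\<in>A. g (f i))"
proof -
  interpret g: ring_hom_cring L L g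
    by (intro ring_hom_cring.intro ring_hom_cring_axioms.intro cring_axioms aut_hom assms(1))
  show ?thesis using g.hom_finsum[OF assms(2)] by (simp add: comp_def)
qed

lemma aut_inv [simp]:
  assumes "g \<in> carrier G" "x \<in> carrier L"
  shows "g ((inv\<^bsub>G\<^esub> g) x) = x" "(inv\<^bsub>G\<^esub> g) (g x) = x"
  using assms aut_mult[of g "inv\<^bsub>G\<^esub> g" x] aut_mult[of "inv\<^bsub>G\<^esub> g" g x] by (simp_all add: aut_one)

definition evaluation_span :: "(('a \<Rightarrow> 'a) \<Rightarrow> 'a) set" where
  "evaluation_span = {e. \<exists>(n::nat) l l'. l \<in> {..<n} \<rightarrow> carrier L \<and> l' \<in> {..<n} \<rightarrow> carrier L
     \<and> (\<forall>g\<in>carrier G. e g = (\<Oplus>i\<in>{..<n}. l' i \<otimes> g (l i)))}"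

lemma evaluation_spanI:
  fixes n :: nat
  assumes "l \<in> {..<n} \<rightarrow> carrier L" "l' \<in> {..<n} \<rightarrow> carrier L"
    and "\<And>g. g \<in> carrier G \<Longrightarrow> e g = (\<Oplus>i\<in>{..<n}. l' i \<otimes> g (l i))"
  shows "e \<in> evaluation_span"
  using assms unfolding evaluation_span_def by blast

lemma evaluation_spanE:
  assumes "e \<in> evaluation_span"
  obtains n :: nat and l l' where "l \<in> {..<n} \<rightarrow> carrier L" "l' \<in> {..<n} \<rightarrow> carrier L"
    "\<And>g. g \<in> carrier G \<Longrightarrow> e g = (\<Oplus>i\<in>{..<n}. l' i \<otimes> g (l i))"
  using assms unfolding evaluation_span_def by blast

lemma evaluation_span_cong:
  "\<lbrakk>e \<in> evaluation_span; \<And>g. g \<in> carrier G \<Longrightarrow> e g = e' g\<rbrakk> \<Longrightarrow> e' \<in> evaluation_span"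
  unfolding evaluation_span_def by auto

lemma evaluation_span_closed: "\<lbrakk>e \<in> evaluation_span; g \<in> carrier G\<rbrakk> \<Longrightarrow> e g \<in> carrier L"
  by (elim evaluation_spanE) (auto simp: Pi_def intro!: finsum_closed)

lemma evaluation_span_one: "(\<lambda>_. \<one>) \<in> evaluation_span"
  by (rule evaluation_spanI[of "\<lambda>_. \<one>" "Suc 0" "\<lambda>_. \<one>"]) (auto simp: lessThan_Suc)

lemma evaluation_span_add:
  assumes "d \<in> evaluation_span" "e \<in> evaluation_span"
  shows "(\<lambda>g. d g \<oplus> e g) \<in> evaluation_span"
proof -
  obtain m :: nat and k k' where d: "k \<in> {..<m} \<rightarrow> carrier L" "k' \<in> {..<m} \<rightarrow> carrier L"
    "\<And>g. g \<in> carrier G \<Longrightarrow> d g = (\<Oplus>i\<in>{..<m}. k' i \<otimes> g (k i))"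
    using assms(1) by (rule evaluation_spanE) blast
  obtain n :: nat and l l' where e: "l \<in> {..<n} \<rightarrow> carrier L" "l' \<in> {..<n} \<rightarrow> carrier L"
    "\<And>g. g \<in> carrier G \<Longrightarrow> e g = (\<Oplus>i\<in>{..<n}. l' i \<otimes> g (l i))"
    using assms(2) by (rule evaluation_spanE) blast
  let ?l = "\<lambda>i. if i < m then k i else l (i - m)"
    and ?l' = "\<lambda>i. if i < m then k' i else l' (i - m)"
  show ?thesis
  proof (rule evaluation_spanI)
    show l: "?l \<in> {..<m + n} \<rightarrow> carrier L" and l': "?l' \<in> {..<m + n} \<rightarrow> carrier L"
      using d(1,2) e(1,2) by (auto simp: Pi_def)
    fix g assume g: "g \<in> carrier G"
    have "(\<Oplus>i\<in>{..<m + n}. ?l' i \<otimes> g (?l i))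
        = (\<Oplus>i\<in>{..<m}. ?l' i \<otimes> g (?l i)) \<oplus> (\<Oplus>i\<in>{..<n}. ?l' (m + i) \<otimes> g (?l (m + i)))"
      using l l' g by (intro finsum_lessThan_add m_closed) (auto simp only: Pi_iff lessThan_iff aut_closed)
    also have "(\<Oplus>i\<in>{..<m}. ?l' i \<otimes> g (?l i)) = d g"
      unfolding d(3)[OF g] using d(1,2) g by (intro finsum_cong') (auto simp: Pi_def)
    also have "(\<Oplus>i\<in>{..<n}. ?l' (m + i) \<otimes> g (?l (m + i))) = e g"
      unfolding e(3)[OF g] using e(1,2) g by (intro finsum_cong') (auto simp: Pi_def)
    finally show "d g \<oplus> e g = (\<Oplus>i\<in>{..<m + n}. ?l' i \<otimes> g (?l i))" by simp
  qed
qed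

lemma evaluation_span_times:
  assumes e: "e \<in> evaluation_span" and x: "x \<in> carrier L" and a: "a \<in> carrier L"
  shows "(\<lambda>g. e g \<otimes> (a \<otimes> g x)) \<in> evaluation_span"
proof -
  obtain n :: nat and l l' where l: "l \<in> {..<n} \<rightarrow> carrier L" "l' \<in> {..<n} \<rightarrow> carrier L"
    and e: "\<And>g. g \<in> carrier G \<Longrightarrow> e g = (\<Oplus>i\<in>{..<n}. l' i \<otimes> g (l i))"
    using e by (rule evaluation_spanE) blast
  show ?thesis
  proof (rule evaluation_spanI)
    fix g assume g: "g \<in> carrier G"
    have "e g \<otimes> (a \<otimes> g x) = (\<Oplus>i\<in>{..<n}. l' i \<otimes> g (l i) \<otimes> (a \<otimes> g x))"
      unfolding e[OF g] using l x a g by (intro finsum_ldistr) (auto simp: Pi_def)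
    also have "\<dots> = (\<Oplus>i\<in>{..<n}. (l' i \<otimes> a) \<otimes> g (l i \<otimes> x))"
      using l x a g by (intro finsum_cong') (auto simp: Pi_def m_ac)
    finally show "e g \<otimes> (a \<otimes> g x) = (\<Oplus>i\<in>{..<n}. (l' i \<otimes> a) \<otimes> g (l i \<otimes> x))" .
  qed (use l x a in auto)
qed

lemma evaluation_span_separate:
  assumes e: "e \<in> evaluation_span" and g: "g \<in> carrier G" and h: "h \<in> carrier G" and "g \<noteq> h"
  obtains r where "\<And>k. k \<in> carrier G \<Longrightarrow> r k \<in> carrier L" "r h = \<one>" "r g = \<zero>"
    "(\<lambda>k. e k \<otimes> r k) \<in> evaluation_span"
proof -
  from \<open>g \<noteq> h\<close> obtain x where x: "x \<in> carrier L" "h x \<noteq> g x" using aut_ext[OF g h] by metis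
  define q where "q = inv (h x \<ominus> g x)"
  have "h x \<ominus> g x \<noteq> \<zero>"
    using r_right_minus_eq x g h by simp
  then have q: "q \<in> carrier L" "q \<otimes> (h x \<ominus> g x) = \<one>"
    using x g h field_Units by (auto simp: q_def)
  let ?r = "\<lambda>k. q \<otimes> (k x \<ominus> g x)"
  have "(\<lambda>k. e k \<otimes> (q \<otimes> k x) \<oplus> e k \<otimes> (\<ominus> (q \<otimes> g x) \<otimes> k \<one>)) \<in> evaluation_span"
    using e x q g by (intro evaluation_span_add evaluation_span_times) auto
  moreover have "e k \<otimes> (q \<otimes> k x) \<oplus> e k \<otimes> (\<ominus> (q \<otimes> g x) \<otimes> k \<one>) = e k \<otimes> ?r k" if "k \<in> carrier G" for k
    using that evaluation_span_closed[OF e that] x q g by (simp add: minus_eq r_distr r_minus l_minus)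
  ultimately have "(\<lambda>k. e k \<otimes> ?r k) \<in> evaluation_span"
    by (rule evaluation_span_cong)
  moreover have "?r g = \<zero>" using x g q by (simp add: minus_eq r_neg)
  ultimately show ?thesis using that[of ?r] q x g by simp
qed

text \<open>
  The product of the functions \<open>k \<mapsto> (k x - g x) / (h x - g x)\<close>, with \<open>x\<close> depending on \<open>g\<close>, separates
  \<open>h\<close> from finitely many automorphisms \<open>g\<close>.
\<close>

lemma exists_separating_evaluation:
  assumes "finite F" "F \<subseteq> carrier G" "h \<in> carrier G" "h \<notin> F"
  shows "\<exists>e\<in>evaluation_span. e h = \<one> \<and> (\<forall>g\<in>F. e g = \<zero>)"
  using assms
proof (induction F)
  case empty
  show ?case using evaluation_span_one by (intro bexI[of _ "\<lambda>_. \<one>"]) auto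
next
  case (insert g F)
  then obtain e where e: "e \<in> evaluation_span" "e h = \<one>" "\<And>k. k \<in> F \<Longrightarrow> e k = \<zero>" by auto
  have g: "g \<in> carrier G" and h: "h \<in> carrier G" and "g \<noteq> h" using insert.prems by auto
  obtain r where r: "\<And>k. k \<in> carrier G \<Longrightarrow> r k \<in> carrier L" "r h = \<one>" "r g = \<zero>"
      "(\<lambda>k. e k \<otimes> r k) \<in> evaluation_span"
    by (rule evaluation_span_separate[OF e(1) g h \<open>g \<noteq> h\<close>]) blast
  show ?case
  proof (intro bexI[OF _ r(4)] conjI ballI)
    show "e h \<otimes> r h = \<one>" using e(2) r(2) by simp
    show "e k \<otimes> r k = \<zero>" if "k \<in> insert g F" for k
      using that e(3) r(1,3) evaluation_span_closed[OF e(1) g] insert.prems(1) by auto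
  qed
qed

lemma automorphisms_independent:
  assumes F: "finite F" "F \<subseteq> carrier G" and c: "c \<in> F \<rightarrow> carrier L"
    and zero: "\<And>x. x \<in> carrier L \<Longrightarrow> (\<Oplus>g\<in>F. g x \<otimes> c g) = \<zero>" and h: "h \<in> F"
  shows "c h = \<zero>"
proof -
  obtain e where "e \<in> evaluation_span" and e: "e h = \<one>" "\<And>g. g \<in> F - {h} \<Longrightarrow> e g = \<zero>"
    using exists_separating_evaluation[of "F - {h}" h] F h by blast
  then have eval_closed: "e g \<in> carrier L" if "g \<in> F" for g
    using evaluation_span_closed F that by blast
  obtain n :: nat and l l' where l: "l \<in> {..<n} \<rightarrow> carrier L" "l' \<in> {..<n} \<rightarrow> carrier L"
    and eval: "\<And>g. g \<in> carrier G \<Longrightarrow> e g = (\<Oplus>i\<in>{..<n}. l' i \<otimes> g (l i))"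
    using \<open>e \<in> evaluation_span\<close> by (rule evaluation_spanE) blast
  have ev: "g x \<in> carrier L" if "g \<in> F" "x \<in> carrier L" for g x
    using that F by auto
  have "c h = (\<Oplus>g\<in>F. if g = h then c h else \<zero>)"
    using F h c by (intro finsum_delta[symmetric]) auto
  also have "\<dots> = (\<Oplus>g\<in>F. e g \<otimes> c g)"
    using e F eval_closed c h by (intro finsum_cong') (auto simp: Pi_def)
  also have "\<dots> = (\<Oplus>g\<in>F. \<Oplus>i\<in>{..<n}. l' i \<otimes> (g (l i) \<otimes> c g))"
  proof (rule finsum_cong'[OF refl])
    fix g assume g: "g \<in> F"
    have "e g \<otimes> c g = (\<Oplus>i\<in>{..<n}. l' i \<otimes> g (l i) \<otimes> c g)"
      using eval[of g] g F(2) l c ev by (auto simp: finsum_ldistr Pi_def)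
    also have "\<dots> = (\<Oplus>i\<in>{..<n}. l' i \<otimes> (g (l i) \<otimes> c g))"
      using g l c ev by (intro finsum_cong') (auto simp: m_assoc Pi_def)
    finally show "e g \<otimes> c g = (\<Oplus>i\<in>{..<n}. l' i \<otimes> (g (l i) \<otimes> c g))" .
  qed (use l c ev in \<open>auto simp: Pi_def intro!: finsum_closed\<close>)
  also have "\<dots> = (\<Oplus>i\<in>{..<n}. \<Oplus>g\<in>F. l' i \<otimes> (g (l i) \<otimes> c g))"
    using l ev c F by (intro finsum_swap) (auto simp: Pi_def)
  also have "\<dots> = (\<Oplus>i\<in>{..<n}. l' i \<otimes> (\<Oplus>g\<in>F. g (l i) \<otimes> c g))"
    using l ev c F
    by (intro finsum_cong' refl finsum_rdistr[symmetric]) (auto simp: Pi_def intro!: finsum_closed)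
  also have "\<dots> = \<zero>"
    using l zero by (intro add.finprod_one_eqI) (auto simp: Pi_def)
  finally show ?thesis .
qed

lemma exists_dual_family:
  assumes fin: "finite (carrier G)"
  obtains n :: nat and l l' where "l \<in> {..<n} \<rightarrow> carrier L" "l' \<in> {..<n} \<rightarrow> carrier L"
    "\<And>g h. \<lbrakk>g \<in> carrier G; h \<in> carrier G\<rbrakk> \<Longrightarrow>
       (\<Oplus>i\<in>{..<n}. g (l' i) \<otimes> h (l i)) = (if g = h then \<one> else \<zero>)"
proof -
  obtain e where "e \<in> evaluation_span"
    and e: "e \<one>\<^bsub>G\<^esub> = \<one>" "\<And>g. g \<in> carrier G - {\<one>\<^bsub>G\<^esub>} \<Longrightarrow> e g = \<zero>"
    using exists_separating_evaluation[of "carrier G - {\<one>\<^bsub>G\<^esub>}" "\<one>\<^bsub>G\<^esub>"] fin by blast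
  then obtain n :: nat and l l' where l: "l \<in> {..<n} \<rightarrow> carrier L" "l' \<in> {..<n} \<rightarrow> carrier L"
    and eval: "\<And>g. g \<in> carrier G \<Longrightarrow> e g = (\<Oplus>i\<in>{..<n}. l' i \<otimes> g (l i))"
    by (elim evaluation_spanE) blast
  have "(\<Oplus>i\<in>{..<n}. g (l' i) \<otimes> h (l i)) = (if g = h then \<one> else \<zero>)"
    if gh: "g \<in> carrier G" "h \<in> carrier G" for g h
  proof -
    let ?k = "inv\<^bsub>G\<^esub> g \<otimes>\<^bsub>G\<^esub> h"
    have k: "?k \<in> carrier G" "g \<otimes>\<^bsub>G\<^esub> ?k = h" "?k = \<one>\<^bsub>G\<^esub> \<longleftrightarrow> g = h"
      using gh by (auto simp: G.m_assoc[symmetric] G.inv_solve_left')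
    have "(\<Oplus>i\<in>{..<n}. g (l' i) \<otimes> h (l i)) = (\<Oplus>i\<in>{..<n}. g (l' i \<otimes> ?k (l i)))"
      using gh k l by (intro finsum_cong') (auto simp: aut_mult[symmetric] Pi_def)
    also have "\<dots> = g (e ?k)"
      unfolding eval[OF k(1)] using gh k l by (intro aut_finsum[symmetric]) (auto simp: Pi_def)
    also have "\<dots> = (if g = h then \<one> else \<zero>)"
      using e k gh by auto
    finally show ?thesis .
  qed
  then show ?thesis using that l by blast
qed

end

locale galois_descent = field_automorphisms L G
  for L :: "('a, 'l) ring_scheme" (structure) and G :: "('a \<Rightarrow> 'a) monoid" and K :: "'a set" +
  assumes K_subfield: "subfield K L"
    and K_fixed: "\<lbrakk>g \<in> carrier G; x \<in> K\<rbrakk> \<Longrightarrow> g x = x"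
    and fixed_K: "\<lbrakk>x \<in> carrier L; \<And>g. g \<in> carrier G \<Longrightarrow> g x = x\<rbrakk> \<Longrightarrow> x \<in> K"
begin

lemma K_subring: "subring K L"
  using subfieldE(1)[OF K_subfield] .

lemma K_subset: "K \<subseteq> carrier L"
  using subringE(1)[OF K_subring] .

lemma Span_eq_finsum:
  assumes "set Us \<subseteq> carrier L" "x \<in> Span K Us"
  obtains k where "k \<in> {..<length Us} \<rightarrow> K" "x = (\<Oplus>j\<in>{..<length Us}. k j \<otimes> Us ! j)"
proof -
  obtain Ks where Ks: "length Ks = length Us" "set Ks \<subseteq> K" "x = combine Ks Us"
    using Span_eq_combine_set_length_version[OF K_subfield assms(1)] assms(2) by blast
  then show ?thesis
    using that[of "\<lambda>j. Ks ! j"] combine_eq_finsum[OF Ks(1)] assms(1) K_subset by (auto simp: subset_iff)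
qed

lemma automorphism_relation_Span:
  assumes F: "finite F" "F \<subseteq> carrier G" and c: "c \<in> F \<rightarrow> carrier L" and Vs: "set Vs \<subseteq> carrier L"
    and relation: "\<And>j. j < length Vs \<Longrightarrow> (\<Oplus>g\<in>F. g (Vs ! j) \<otimes> c g) = \<zero>"
    and x: "x \<in> Span K Vs"
  shows "(\<Oplus>g\<in>F. g x \<otimes> c g) = \<zero>"
proof -
  let ?d = "length Vs"
  obtain k where k: "k \<in> {..<?d} \<rightarrow> K" and x: "x = (\<Oplus>j\<in>{..<?d}. k j \<otimes> Vs ! j)"
    by (rule Span_eq_finsum[OF Vs x])
  have v: "Vs ! j \<in> carrier L" and kL: "k j \<in> carrier L" if "j < ?d" for j
    using Vs k K_subset that by auto
  have ev: "g y \<in> carrier L" if "g \<in> F" "y \<in> carrier L" for g y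
    using that F by auto
  have "g x \<otimes> c g = (\<Oplus>j\<in>{..<?d}. k j \<otimes> (g (Vs ! j) \<otimes> c g))" if g: "g \<in> F" for g
  proof -
    have "g x = (\<Oplus>j\<in>{..<?d}. g (k j \<otimes> Vs ! j))"
      unfolding x using g F(2) kL v by (intro aut_finsum) auto
    also have "\<dots> = (\<Oplus>j\<in>{..<?d}. k j \<otimes> g (Vs ! j))"
      using g F(2) k kL v by (intro finsum_cong') (auto simp: K_fixed Pi_def subset_iff)
    finally have "g x \<otimes> c g = (\<Oplus>j\<in>{..<?d}. k j \<otimes> g (Vs ! j) \<otimes> c g)"
      using g kL v ev Pi_mem[OF c] by (simp add: finsum_ldistr Pi_def)
    also have "\<dots> = (\<Oplus>j\<in>{..<?d}. k j \<otimes> (g (Vs ! j) \<otimes> c g))"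
      using g kL v ev Pi_mem[OF c] by (intro finsum_cong') (auto simp: m_assoc)
    finally show ?thesis .
  qed
  then have "(\<Oplus>g\<in>F. g x \<otimes> c g) = (\<Oplus>g\<in>F. \<Oplus>j\<in>{..<?d}. k j \<otimes> (g (Vs ! j) \<otimes> c g))"
    using kL v ev Pi_mem[OF c] by (intro finsum_cong') (auto intro!: finsum_closed)
  also have "\<dots> = (\<Oplus>j\<in>{..<?d}. \<Oplus>g\<in>F. k j \<otimes> (g (Vs ! j) \<otimes> c g))"
    using kL v ev Pi_mem[OF c] F(1) by (intro finsum_swap) auto
  also have "\<dots> = (\<Oplus>j\<in>{..<?d}. k j \<otimes> (\<Oplus>g\<in>F. g (Vs ! j) \<otimes> c g))"
    using kL v ev Pi_mem[OF c] F(1)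
    by (intro finsum_cong' refl finsum_rdistr[symmetric]) (auto intro!: finsum_closed)
  also have "\<dots> = \<zero>"
    using relation kL by (intro add.finprod_one_eqI) auto
  finally show ?thesis .
qed

lemma card_automorphisms_le:
  assumes dim: "dimension d K (carrier L)" and F: "finite F" "F \<subseteq> carrier G"
  shows "card F \<le> d"
proof (rule ccontr)
  assume "\<not> card F \<le> d"
  then have gt: "card F > d" by simp
  obtain Vs where Vs: "set Vs \<subseteq> carrier L" "length Vs = d" "Span K Vs = carrier L"
    using exists_base[OF K_subfield dim] by blast
  have v: "Vs ! j \<in> carrier L" if "j < d" for j
    using Vs that by auto
  have ev: "g (Vs ! j) \<in> carrier L" if "j < d" "g \<in> F" for g j
    using that by (simp add: v subsetD[OF F(2)])
  obtain c where c: "c \<in> F \<rightarrow> carrier L" "\<exists>g\<in>F. c g \<noteq> \<zero>"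
     and relation: "\<And>j. j < d \<Longrightarrow> (\<Oplus>g\<in>F. g (Vs ! j) \<otimes> c g) = \<zero>"
    by (rule exists_nontrivial_solution[OF F(1) gt, of "\<lambda>j g. g (Vs ! j)"]) (use ev in auto)
  have "(\<Oplus>g\<in>F. g x \<otimes> c g) = \<zero>" if "x \<in> carrier L" for x
    by (rule automorphism_relation_Span[OF F c(1) Vs(1)]) (use relation Vs that in auto)
  then show False
    using automorphisms_independent[OF F, of c] c by blast
qed

lemma finite_automorphisms:
  assumes "dimension d K (carrier L)"
  shows "finite (carrier G)"
proof (rule ccontr)
  assume "infinite (carrier G)"
  then obtain F where "F \<subseteq> carrier G" "finite F" "card F = Suc d"
    using infinite_arbitrarily_large by blast
  then show False using card_automorphisms_le[OF assms, of F] by simp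
qed

definition trace :: "'a \<Rightarrow> 'a" where
  "trace x = (\<Oplus>g\<in>carrier G. g x)"

lemma bij_left_mult: "h \<in> carrier G \<Longrightarrow> bij_betw (\<lambda>g. h \<otimes>\<^bsub>G\<^esub> g) (carrier G) (carrier G)"
  by (rule bij_betw_byWitness[of _ "\<lambda>g. inv\<^bsub>G\<^esub> h \<otimes>\<^bsub>G\<^esub> g"])
    (auto simp: G.m_assoc[symmetric] image_subset_iff)

lemma trace_closed [simp]: "x \<in> carrier L \<Longrightarrow> trace x \<in> carrier L"
  unfolding trace_def by (intro finsum_closed) auto

lemma trace_in_K:
  assumes x: "x \<in> carrier L"
  shows "trace x \<in> K"
proof (rule fixed_K)
  fix h assume h: "h \<in> carrier G"
  have "h (trace x) = (\<Oplus>g\<in>carrier G. h (g x))"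
    unfolding trace_def using h x by (intro aut_finsum) auto
  also have "\<dots> = (\<Oplus>g\<in>carrier G. (h \<otimes>\<^bsub>G\<^esub> g) x)"
    using h x by (intro finsum_cong') (auto simp: aut_mult)
  also have "\<dots> = trace x"
    unfolding trace_def using x by (intro finsum_reindex_bij[OF bij_left_mult[OF h], symmetric]) auto
  finally show "h (trace x) = trace x" .
qed (use x in simp)

lemma trace_nondegenerate:
  assumes fin: "finite (carrier G)" and x: "x \<in> carrier L"
    and zero: "\<And>y. y \<in> carrier L \<Longrightarrow> trace (y \<otimes> x) = \<zero>"
  shows "x = \<zero>"
proof -
  have "\<one>\<^bsub>G\<^esub> x = \<zero>"
  proof (rule automorphisms_independent[OF fin subset_refl, of "\<lambda>g. g x"])
    fix y assume y: "y \<in> carrier L"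
    have "(\<Oplus>g\<in>carrier G. g y \<otimes> g x) = trace (y \<otimes> x)"
      unfolding trace_def using x y by (intro finsum_cong') auto
    then show "(\<Oplus>g\<in>carrier G. g y \<otimes> g x) = \<zero>" using zero[OF y] by simp
  qed (use x in auto)
  then show ?thesis using aut_one x by simp
qed

lemma exists_trace_one:
  assumes fin: "finite (carrier G)"
  obtains t where "t \<in> carrier L" "trace t = \<one>"
proof -
  obtain y where y: "y \<in> carrier L" "trace y \<noteq> \<zero>"
    using trace_nondegenerate[OF fin, of \<one>] by auto
  define q where "q = inv (trace y)"
  have q: "q \<in> K" "q \<in> carrier L" "q \<otimes> trace y = \<one>"
    using y subfield_m_inv[OF K_subfield, of "trace y"] trace_in_K[OF y(1)] K_subset
    by (auto simp: q_def)
  have "trace (q \<otimes> y) = (\<Oplus>g\<in>carrier G. q \<otimes> g y)"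
    unfolding trace_def using q y by (intro finsum_cong') (auto simp: K_fixed)
  also have "\<dots> = q \<otimes> trace y"
    unfolding trace_def using q y fin by (intro finsum_rdistr[symmetric]) auto
  finally show ?thesis using that[of "q \<otimes> y"] q y by simp
qed

text \<open>
  A linear relation between the columns \<open>(g v\<^sub>j)\<^sub>g\<close> over \<open>L\<close> is turned by the trace into relations
  between the \<open>v\<^sub>j\<close> over \<open>K\<close>.
\<close>

lemma trace_relation:
  assumes fin: "finite (carrier G)" "finite J"
    and v: "v \<in> J \<rightarrow> carrier L" and c: "c \<in> J \<rightarrow> carrier L" and y: "y \<in> carrier L"
    and relation: "\<And>g. g \<in> carrier G \<Longrightarrow> (\<Oplus>j\<in>J. g (v j) \<otimes> c j) = \<zero>"
  shows "(\<Oplus>j\<in>J. trace (y \<otimes> c j) \<otimes> v j) = \<zero>"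
proof -
  have "(\<Oplus>j\<in>J. trace (y \<otimes> c j) \<otimes> v j) = (\<Oplus>j\<in>J. \<Oplus>g\<in>carrier G. g (y \<otimes> c j) \<otimes> v j)"
    unfolding trace_def using c y v fin
    by (intro finsum_cong' refl finsum_ldistr) (auto simp: Pi_def intro!: finsum_closed)
  also have "\<dots> = (\<Oplus>g\<in>carrier G. \<Oplus>j\<in>J. g (y \<otimes> c j) \<otimes> v j)"
    using c y v fin by (intro finsum_swap) (auto simp: Pi_def)
  also have "\<dots> = \<zero>"
  proof (rule add.finprod_one_eqI)
    fix g assume g: "g \<in> carrier G"
    let ?h = "inv\<^bsub>G\<^esub> g"
    have "(\<Oplus>j\<in>J. g (y \<otimes> c j) \<otimes> v j) = (\<Oplus>j\<in>J. g (y \<otimes> (?h (v j) \<otimes> c j)))"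
      using c y v g by (intro finsum_cong') (auto simp: m_ac Pi_def)
    also have "\<dots> = g (\<Oplus>j\<in>J. y \<otimes> (?h (v j) \<otimes> c j))"
      using c y v g by (intro aut_finsum[symmetric]) (auto simp: Pi_def)
    also have "(\<Oplus>j\<in>J. y \<otimes> (?h (v j) \<otimes> c j)) = y \<otimes> (\<Oplus>j\<in>J. ?h (v j) \<otimes> c j)"
      using c y v g fin by (intro finsum_rdistr[symmetric]) (auto simp: Pi_def)
    finally show "(\<Oplus>j\<in>J. g (y \<otimes> c j) \<otimes> v j) = \<zero>" using y g relation[of ?h] by simp
  qed
  finally show ?thesis .
qed

lemma independent_imp_trivial_relation:
  assumes fin: "finite (carrier G)" and Vs: "set Vs \<subseteq> carrier L" "independent K Vs"
    and c: "c \<in> {..<length Vs} \<rightarrow> carrier L"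
    and relation: "\<And>g. g \<in> carrier G \<Longrightarrow> (\<Oplus>j\<in>{..<length Vs}. g (Vs ! j) \<otimes> c j) = \<zero>"
    and j: "j < length Vs"
  shows "c j = \<zero>"
proof (rule trace_nondegenerate[OF fin])
  fix y assume y: "y \<in> carrier L"
  let ?Ks = "map (\<lambda>j. trace (y \<otimes> c j)) [0..<length Vs]"
  have v: "(!) Vs \<in> {..<length Vs} \<rightarrow> carrier L" using Vs(1) by auto
  have "combine ?Ks Vs = (\<Oplus>j\<in>{..<length Vs}. ?Ks ! j \<otimes> Vs ! j)"
    using Pi_mem[OF c] y Vs(1) by (subst combine_eq_finsum) auto
  also have "\<dots> = (\<Oplus>j\<in>{..<length Vs}. trace (y \<otimes> c j) \<otimes> Vs ! j)"
    using Pi_mem[OF c] y v by (intro finsum_cong') auto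
  also have "\<dots> = \<zero>"
    by (rule trace_relation[OF fin finite_lessThan v c y relation])
  finally have "set (take (length Vs) ?Ks) \<subseteq> {\<zero>}"
    using Pi_mem[OF c] y Vs
    by (intro independent_imp_trivial_combine[OF K_subfield Vs(2)]) (auto intro!: trace_in_K)
  then show "trace (y \<otimes> c j) = \<zero>" using j by (auto simp: image_subset_iff)
qed (use c j in auto)

lemma dimension_le_card_automorphisms:
  assumes dim: "dimension d K (carrier L)"
  shows "d \<le> card (carrier G)"
proof (rule ccontr)
  assume "\<not> d \<le> card (carrier G)"
  then have gt: "card {..<d} > card (carrier G)" by simp
  have fin: "finite (carrier G)" by (rule finite_automorphisms[OF dim])
  obtain e where e: "bij_betw e {..<card (carrier G)} (carrier G)"
    using ex_bij_betw_nat_finite[OF fin] by (auto simp: atLeast0LessThan)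
  obtain Vs where Vs: "set Vs \<subseteq> carrier L" "independent K Vs" "length Vs = d"
    using exists_base[OF K_subfield dim] by blast
  have v: "Vs ! j \<in> carrier L" if "j < d" for j
    using Vs that by auto
  have ev: "e i (Vs ! j) \<in> carrier L" if "i < card (carrier G)" "j \<in> {..<d}" for i j
    using bij_betwE[OF e] that by (simp add: v)
  obtain c where c: "c \<in> {..<d} \<rightarrow> carrier L" "\<exists>j\<in>{..<d}. c j \<noteq> \<zero>"
     "\<And>i. i < card (carrier G) \<Longrightarrow> (\<Oplus>j\<in>{..<d}. e i (Vs ! j) \<otimes> c j) = \<zero>"
    by (rule exists_nontrivial_solution[OF finite_lessThan gt, of "\<lambda>i j. e i (Vs ! j)"]) (use ev in auto)
  have "(\<Oplus>j\<in>{..<d}. g (Vs ! j) \<otimes> c j) = \<zero>" if "g \<in> carrier G" for g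
  proof -
    have "g \<in> e ` {..<card (carrier G)}"
      unfolding bij_betw_imp_surj_on[OF e] by (rule that)
    then obtain i where "i < card (carrier G)" "e i = g" by auto
    then show ?thesis using c(3)[of i] by simp
  qed
  then have "c j = \<zero>" if "j < d" for j
    using independent_imp_trivial_relation[OF fin Vs(1,2), of c j] c(1) Vs(3) that by simp
  then show False using c(2) by auto
qed

theorem card_automorphisms:
  assumes "dimension d K (carrier L)"
  shows "card (carrier G) = d"
  using dimension_le_card_automorphisms[OF assms]
    card_automorphisms_le[OF assms finite_automorphisms[OF assms]] by simp

end

section \<open>Formal linear combinations\<close>

lemma free_module_sel:
  "\<zero>\<^bsub>free_module R B\<^esub> = (\<lambda>_. \<zero>\<^bsub>R\<^esub>)"
  "u \<oplus>\<^bsub>free_module R B\<^esub> v = (\<lambda>x. u x \<oplus>\<^bsub>R\<^esub> v x)"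
  "c \<odot>\<^bsub>free_module R B\<^esub> u = (\<lambda>x. c \<otimes>\<^bsub>R\<^esub> u x)"
  by (simp_all add: free_module_def)

lemma free_moduleD:
  assumes "u \<in> carrier (free_module R B)"
  shows free_module_finite_support: "finite {x. u x \<noteq> \<zero>\<^bsub>R\<^esub>}"
    and free_module_outside: "x \<notin> B \<Longrightarrow> u x = \<zero>\<^bsub>R\<^esub>"
  using assms by (auto simp: free_module_def)

lemma free_module_support: "u \<in> carrier (free_module R B) \<Longrightarrow> {x. u x \<noteq> \<zero>\<^bsub>R\<^esub>} \<subseteq> B"
  using free_module_outside by fastforce

lemma (in cring) module_of_functionsI:
  fixes V :: "('a, 'x \<Rightarrow> 'a, 'e) module_scheme"
  assumes K: "subring K R"
    and apply_closed: "\<And>v x. v \<in> carrier V \<Longrightarrow> v x \<in> carrier R"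
    and ops: "\<zero>\<^bsub>V\<^esub> = (\<lambda>_. \<zero>)" "\<And>v w. v \<oplus>\<^bsub>V\<^esub> w = (\<lambda>x. v x \<oplus> w x)"
      "\<And>c v. c \<odot>\<^bsub>V\<^esub> v = (\<lambda>x. c \<otimes> v x)"
    and closed: "(\<lambda>_. \<zero>) \<in> carrier V"
      "\<And>v w. \<lbrakk>v \<in> carrier V; w \<in> carrier V\<rbrakk> \<Longrightarrow> (\<lambda>x. v x \<oplus> w x) \<in> carrier V"
      "\<And>c v. \<lbrakk>c \<in> K; v \<in> carrier V\<rbrakk> \<Longrightarrow> (\<lambda>x. c \<otimes> v x) \<in> carrier V"
  shows "module (R\<lparr>carrier := K\<rparr>) V"
proof (rule moduleI)
  have KR: "c \<in> carrier R" if "c \<in> K" for c using subringE(1)[OF K] that by blast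
  show "cring (R\<lparr>carrier := K\<rparr>)"
    using subcring_iff[OF subringE(1)[OF K]] subcringI'[OF K] by simp
  show "abelian_group V"
  proof (rule abelian_groupI, unfold ops)
    fix v assume v: "v \<in> carrier V"
    let ?w = "\<lambda>x. \<ominus> \<one> \<otimes> v x"
    have "?w \<in> carrier V"
      using closed(3)[OF _ v] subringE(3,5)[OF K] by blast
    moreover have "(\<lambda>x. ?w x \<oplus> v x) = (\<lambda>_. \<zero>)"
      using apply_closed[OF v] by (simp add: l_minus l_neg)
    ultimately show "\<exists>w\<in>carrier V. (\<lambda>x. w x \<oplus> v x) = (\<lambda>_. \<zero>)"
      by (intro bexI[of _ ?w])
  qed (use closed apply_closed in \<open>simp_all add: a_ac\<close>)
qed (use K closed apply_closed subringE(1)[OF K] in \<open>auto simp: ops l_distr r_distr m_assoc subset_iff\<close>)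

definition linear_extension :: "('a, 'r) ring_scheme \<Rightarrow> ('x \<Rightarrow> 'a) \<Rightarrow> ('x \<Rightarrow> 'a) \<Rightarrow> 'a" where
  "linear_extension R e u = (\<Oplus>\<^bsub>R\<^esub>x\<in>{x. u x \<noteq> \<zero>\<^bsub>R\<^esub>}. u x \<otimes>\<^bsub>R\<^esub> e x)"

context cring begin

lemma free_module_closed:
  "u \<in> carrier (free_module R B) \<Longrightarrow> u x \<in> carrier R"
  by (cases "x \<in> B") (auto simp: free_module_def)

lemma free_moduleI:
  assumes "finite S" "S \<subseteq> B" "\<And>x. x \<in> S \<Longrightarrow> u x \<in> carrier R" "\<And>x. x \<notin> S \<Longrightarrow> u x = \<zero>"
  shows "u \<in> carrier (free_module R B)"
proof -
  have "{x. u x \<noteq> \<zero>} \<subseteq> S" using assms(4) by blast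
  then have "finite {x. u x \<noteq> \<zero>}" using assms(1) by (rule finite_subset)
  moreover have "u x \<in> carrier R" for x using assms(3,4) by (cases "x \<in> S") auto
  ultimately show ?thesis using assms(2,4) by (auto simp: free_module_def)
qed

lemma free_module_finiteI:
  "\<lbrakk>finite B; \<And>x. x \<in> B \<Longrightarrow> u x \<in> carrier R; \<And>x. x \<notin> B \<Longrightarrow> u x = \<zero>\<rbrakk> \<Longrightarrow> u \<in> carrier (free_module R B)"
  by (rule free_moduleI[OF _ subset_refl])

lemma free_module_is_module: "module R (free_module R B)"
proof -
  have "module (R\<lparr>carrier := carrier R\<rparr>) (free_module R B)"
  proof (rule module_of_functionsI[OF carrier_is_subring])
    fix u v assume u: "u \<in> carrier (free_module R B)" and v: "v \<in> carrier (free_module R B)"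
    show "(\<lambda>x. u x \<oplus> v x) \<in> carrier (free_module R B)"
      by (rule free_moduleI[of "{x. u x \<noteq> \<zero>} \<union> {x. v x \<noteq> \<zero>}"])
        (use u v in \<open>auto dest: free_module_finite_support free_module_outside intro: free_module_closed\<close>)
  next
    fix c u assume c: "c \<in> carrier R" and u: "u \<in> carrier (free_module R B)"
    show "(\<lambda>x. c \<otimes> u x) \<in> carrier (free_module R B)"
      by (rule free_moduleI[of "{x. u x \<noteq> \<zero>}"])
        (use c u in \<open>auto dest: free_module_finite_support free_module_outside intro: free_module_closed\<close>)
  qed (auto simp: free_module_sel intro: free_module_closed free_moduleI[of "{}"])
  then show ?thesis by simp
qed

lemma free_module_subring:
  assumes "subring K R" "u \<in> carrier (free_module (R\<lparr>carrier := K\<rparr>) B)"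
  shows "u x \<in> K" "u \<in> carrier (free_module R B)"
  using assms(2) subringE(1,2)[OF assms(1)] by (cases "x \<in> B", auto simp: free_module_def)

lemma single_apply_closed [simp]: "single R x y \<in> carrier R"
  by (simp add: single_def)

lemma single_closed: "x \<in> B \<Longrightarrow> single R x \<in> carrier (free_module R B)"
  by (rule free_moduleI[of "{x}"]) (auto simp: single_def)

lemma free_module_induct [consumes 1, case_names zero step]:
  assumes u: "u \<in> carrier (free_module R B)"
    and zero: "P \<zero>\<^bsub>free_module R B\<^esub>"
    and step: "\<And>u c x. \<lbrakk>u \<in> carrier (free_module R B); P u; c \<in> carrier R; x \<in> B\<rbrakk>
       \<Longrightarrow> P (u \<oplus>\<^bsub>free_module R B\<^esub> c \<odot>\<^bsub>free_module R B\<^esub> single R x)"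
  shows "P u"
  using free_module_finite_support[OF u] u
proof (induction "{x. u x \<noteq> \<zero>}" arbitrary: u rule: finite_induct)
  case empty
  then have "u = \<zero>\<^bsub>free_module R B\<^esub>" by (auto simp: fun_eq_iff free_module_sel)
  then show ?case using zero by simp
next
  case (insert x S)
  let ?v = "u(x := \<zero>)"
  have "u x \<noteq> \<zero>" using insert.hyps(4) by blast
  then have x: "x \<in> B" using free_module_outside[OF insert.prems] by blast
  have S: "S = {y. ?v y \<noteq> \<zero>}"
    using insert.hyps(2,4) by auto
  have v: "?v \<in> carrier (free_module R B)"
    by (rule free_moduleI[OF insert.hyps(1)])
      (use S free_module_support[OF insert.prems] insert.hyps(4) free_module_closed[OF insert.prems] in auto)
  have "u = ?v \<oplus>\<^bsub>free_module R B\<^esub> u x \<odot>\<^bsub>free_module R B\<^esub> single R x"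
    using free_module_closed[OF insert.prems] by (auto simp: fun_eq_iff single_def free_module_sel)
  then show ?case
    using step[OF v insert.hyps(3)[OF S v] free_module_closed[OF insert.prems, of x] x] by simp
qed

lemma linear_extension_eq_finsum:
  assumes "u \<in> carrier (free_module R B)" "finite S" "{x. u x \<noteq> \<zero>} \<subseteq> S" "e \<in> S \<rightarrow> carrier R"
  shows "linear_extension R e u = (\<Oplus>x\<in>S. u x \<otimes> e x)"
  unfolding linear_extension_def
  by (rule add.finprod_mono_neutral_cong_left)
    (use assms free_module_closed[OF assms(1)] in \<open>auto simp: Pi_def\<close>)

lemma linear_extension_finite:
  assumes "u \<in> carrier (free_module R B)" "finite B" "e \<in> B \<rightarrow> carrier R"
  shows "linear_extension R e u = (\<Oplus>x\<in>B. u x \<otimes> e x)"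
  using linear_extension_eq_finsum[OF assms(1,2)] free_module_support[OF assms(1)] assms(3) by blast

context
  fixes B :: "'x set" and e :: "'x \<Rightarrow> 'a"
  assumes e: "e \<in> B \<rightarrow> carrier R"
begin

lemma linear_extension_closed:
  assumes "u \<in> carrier (free_module R B)"
  shows "linear_extension R e u \<in> carrier R"
  unfolding linear_extension_def
  using free_module_support[OF assms] free_module_closed[OF assms] e by (intro finsum_closed) auto

lemma linear_extension_zero: "linear_extension R e (\<lambda>_. \<zero>) = \<zero>"
  by (simp add: linear_extension_def)

lemma linear_extension_add:
  assumes u: "u \<in> carrier (free_module R B)" and v: "v \<in> carrier (free_module R B)"
  shows "linear_extension R e (u \<oplus>\<^bsub>free_module R B\<^esub> v) = linear_extension R e u \<oplus> linear_extension R e v"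
proof -
  let ?S = "{x. u x \<noteq> \<zero>} \<union> {x. v x \<noteq> \<zero>}"
  have S: "finite ?S" "?S \<subseteq> B"
    using u v by (auto dest: free_module_finite_support free_module_outside)
  then have eS: "e \<in> ?S \<rightarrow> carrier R" using e by blast
  have uv: "u \<oplus>\<^bsub>free_module R B\<^esub> v \<in> carrier (free_module R B)"
    using module.axioms(2)[OF free_module_is_module] u v by (rule abelian_groupE(1))
  have closed: "u x \<in> carrier R" "v x \<in> carrier R" for x
    by (rule free_module_closed[OF u], rule free_module_closed[OF v])
  have "linear_extension R e (u \<oplus>\<^bsub>free_module R B\<^esub> v) = (\<Oplus>x\<in>?S. (u x \<oplus> v x) \<otimes> e x)"
    unfolding free_module_sel
    by (rule linear_extension_eq_finsum[OF uv[unfolded free_module_sel] S(1) _ eS]) auto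
  also have "\<dots> = (\<Oplus>x\<in>?S. u x \<otimes> e x \<oplus> v x \<otimes> e x)"
    using closed eS by (intro finsum_cong') (auto simp: l_distr Pi_iff)
  also have "\<dots> = (\<Oplus>x\<in>?S. u x \<otimes> e x) \<oplus> (\<Oplus>x\<in>?S. v x \<otimes> e x)"
    using closed eS by (intro finsum_addf) (auto simp: Pi_iff)
  also have "\<dots> = linear_extension R e u \<oplus> linear_extension R e v"
    using linear_extension_eq_finsum[OF _ S(1) _ eS] u v by simp
  finally show ?thesis .
qed

lemma linear_extension_smult:
  assumes c: "c \<in> carrier R" and u: "u \<in> carrier (free_module R B)"
  shows "linear_extension R e (c \<odot>\<^bsub>free_module R B\<^esub> u) = c \<otimes> linear_extension R e u"
proof -
  let ?S = "{x. u x \<noteq> \<zero>}"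
  have S: "finite ?S" and eS: "e \<in> ?S \<rightarrow> carrier R"
    using free_module_finite_support[OF u] free_module_support[OF u] e by blast+
  have cu: "c \<odot>\<^bsub>free_module R B\<^esub> u \<in> carrier (free_module R B)"
    using c u by (rule module.smult_closed[OF free_module_is_module])
  have "linear_extension R e (c \<odot>\<^bsub>free_module R B\<^esub> u) = (\<Oplus>x\<in>?S. c \<otimes> u x \<otimes> e x)"
    unfolding free_module_sel
    by (rule linear_extension_eq_finsum[OF cu[unfolded free_module_sel] S _ eS]) (use c in auto)
  also have "\<dots> = (\<Oplus>x\<in>?S. c \<otimes> (u x \<otimes> e x))"
    using free_module_closed[OF u] c eS by (intro finsum_cong') (auto simp: m_assoc Pi_iff)
  also have "\<dots> = c \<otimes> linear_extension R e u"
    unfolding linear_extension_def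
    using S c free_module_closed[OF u] eS by (intro finsum_rdistr[symmetric]) auto
  finally show ?thesis .
qed

lemma linear_extension_single:
  assumes "x \<in> B"
  shows "linear_extension R e (single R x) = e x"
proof -
  have "linear_extension R e (single R x) = (\<Oplus>y\<in>{x}. single R x y \<otimes> e y)"
    by (rule linear_extension_eq_finsum[OF single_closed[OF assms]])
      (use e assms in \<open>auto simp: single_def\<close>)
  then show ?thesis using e assms by (simp add: single_def Pi_iff)
qed

lemma finsum_linear_extension:
  assumes I: "finite I" and E: "\<And>i. i \<in> I \<Longrightarrow> E i \<in> B \<rightarrow> carrier R" and c: "c \<in> I \<rightarrow> carrier R"
    and e_eq: "\<And>x. x \<in> B \<Longrightarrow> e x = (\<Oplus>i\<in>I. E i x \<otimes> c i)"
    and u: "u \<in> carrier (free_module R B)"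
  shows "(\<Oplus>i\<in>I. linear_extension R (E i) u \<otimes> c i) = linear_extension R e u"
proof -
  let ?S = "{x. u x \<noteq> \<zero>}"
  have S: "finite ?S" "?S \<subseteq> B"
    using free_module_finite_support[OF u] free_module_support[OF u] by blast+
  have closed: "u x \<in> carrier R" "c i \<in> carrier R" "E i x \<in> carrier R" if "i \<in> I" "x \<in> ?S" for i x
    using free_module_closed[OF u] c E S(2) that by blast+
  have "(\<Oplus>i\<in>I. linear_extension R (E i) u \<otimes> c i) = (\<Oplus>i\<in>I. \<Oplus>x\<in>?S. u x \<otimes> E i x \<otimes> c i)"
    unfolding linear_extension_def using S(1) closed c
    by (intro finsum_cong' refl finsum_ldistr) (auto intro!: finsum_closed)
  also have "\<dots> = (\<Oplus>x\<in>?S. \<Oplus>i\<in>I. u x \<otimes> E i x \<otimes> c i)"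
    using I S(1) closed by (intro finsum_swap) auto
  also have "\<dots> = (\<Oplus>x\<in>?S. u x \<otimes> e x)"
  proof (rule finsum_cong'[OF refl])
    fix x assume x: "x \<in> ?S"
    have "(\<Oplus>i\<in>I. u x \<otimes> E i x \<otimes> c i) = (\<Oplus>i\<in>I. u x \<otimes> (E i x \<otimes> c i))"
      using closed x by (intro finsum_cong') (auto simp: m_assoc)
    also have "\<dots> = u x \<otimes> (\<Oplus>i\<in>I. E i x \<otimes> c i)"
      using I closed x free_module_closed[OF u] by (intro finsum_rdistr[symmetric]) auto
    finally show "(\<Oplus>i\<in>I. u x \<otimes> E i x \<otimes> c i) = u x \<otimes> e x"
      using e_eq x S(2) by auto
  qed (use e S(2) free_module_closed[OF u] in auto)
  finally show ?thesis unfolding linear_extension_def .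
qed

end

lemma linear_extension_cong:
  assumes "u \<in> carrier (free_module R B)" "e' \<in> B \<rightarrow> carrier R" "\<And>x. x \<in> B \<Longrightarrow> e x = e' x"
  shows "linear_extension R e u = linear_extension R e' u"
  unfolding linear_extension_def
  by (rule finsum_cong'[OF refl])
    (use assms free_module_support[OF assms(1)] free_module_closed[OF assms(1)]
      in \<open>auto simp: Pi_iff subset_iff\<close>)

lemma linear_extension_mult_right:
  assumes "u \<in> carrier (free_module R B)" "e \<in> B \<rightarrow> carrier R" "c \<in> carrier R"
  shows "linear_extension R (\<lambda>x. e x \<otimes> c) u = linear_extension R e u \<otimes> c"
  using finsum_linear_extension[of "\<lambda>x. e x \<otimes> c" B "{()}" "\<lambda>_. e" "\<lambda>_. c" u]
    linear_extension_closed[OF assms(2,1)] assms by (auto simp: Pi_iff)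

lemma linear_extension_single_left:
  assumes "u \<in> carrier (free_module R B)"
  shows "linear_extension R (single R x) u = u x"
proof -
  have "linear_extension R (single R x) u = (\<Oplus>y\<in>insert x {y. u y \<noteq> \<zero>}. u y \<otimes> single R x y)"
    using assms free_module_finite_support[OF assms]
    by (intro linear_extension_eq_finsum) (auto simp: single_def)
  also have "\<dots> = (\<Oplus>y\<in>insert x {y. u y \<noteq> \<zero>}. if y = x then u x else \<zero>)"
    using free_module_closed[OF assms] by (intro finsum_cong') (auto simp: single_def)
  also have "\<dots> = u x"
    using free_module_finite_support[OF assms] free_module_closed[OF assms] by (intro finsum_delta) auto
  finally show ?thesis .
qed

lemma free_map_apply:
  assumes "u \<in> carrier (free_module R B)"
  shows "free_map R \<phi> u y = linear_extension R (\<lambda>x. single R y (\<phi> x)) u"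
  unfolding free_map_def linear_extension_def
  by (rule add.finprod_mono_neutral_cong_left)
    (use free_module_finite_support[OF assms] free_module_closed[OF assms] in \<open>auto simp: single_def\<close>)

lemma free_map_support:
  assumes "u \<in> carrier (free_module R B)"
  shows "{y. free_map R \<phi> u y \<noteq> \<zero>} \<subseteq> \<phi> ` {x. u x \<noteq> \<zero>}"
proof
  fix y assume "y \<in> {y. free_map R \<phi> u y \<noteq> \<zero>}"
  then have "{x. u x \<noteq> \<zero> \<and> \<phi> x = y} \<noteq> {}"
    unfolding free_map_def by (metis (mono_tags, lifting) finsum_empty mem_Collect_eq)
  then show "y \<in> \<phi> ` {x. u x \<noteq> \<zero>}" by auto
qed

lemma free_map_closed:
  assumes u: "u \<in> carrier (free_module R B)" and \<phi>: "\<phi> \<in> B \<rightarrow> B'"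
  shows "free_map R \<phi> u \<in> carrier (free_module R B')"
proof (rule free_moduleI)
  show "finite (\<phi> ` {x. u x \<noteq> \<zero>})" using free_module_finite_support[OF u] by simp
  show "\<phi> ` {x. u x \<noteq> \<zero>} \<subseteq> B'" using free_module_support[OF u] \<phi> by blast
  show "free_map R \<phi> u y \<in> carrier R" for y
    unfolding free_map_def using free_module_closed[OF u] by (intro finsum_closed) auto
  show "free_map R \<phi> u y = \<zero>" if "y \<notin> \<phi> ` {x. u x \<noteq> \<zero>}" for y
    using free_map_support[OF u, of \<phi>] that by blast
qed

lemma free_map_id: "u \<in> carrier (free_module R B) \<Longrightarrow> free_map R (\<lambda>x. x) u = u"
  by (rule ext) (simp only: free_map_apply linear_extension_single_left)

lemma linear_extension_free_map:
  assumes u: "u \<in> carrier (free_module R B)" and \<phi>: "\<phi> \<in> B \<rightarrow> B'" and e: "e \<in> B' \<rightarrow> carrier R"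
  shows "linear_extension R e (free_map R \<phi> u) = linear_extension R (\<lambda>x. e (\<phi> x)) u"
proof -
  let ?T = "\<phi> ` {x. u x \<noteq> \<zero>}"
  have T: "finite ?T" "?T \<subseteq> B'"
    using free_module_finite_support[OF u] free_module_support[OF u] \<phi> by auto
  then have eT: "e \<in> ?T \<rightarrow> carrier R" using e by blast
  have "linear_extension R e (free_map R \<phi> u) = (\<Oplus>y\<in>?T. free_map R \<phi> u y \<otimes> e y)"
    by (rule linear_extension_eq_finsum[OF free_map_closed[OF u \<phi>] T(1) free_map_support[OF u] eT])
  also have "\<dots> = (\<Oplus>y\<in>?T. linear_extension R (\<lambda>x. single R y (\<phi> x)) u \<otimes> e y)"
    unfolding free_map_apply[OF u] ..
  also have "\<dots> = linear_extension R (\<lambda>x. \<Oplus>y\<in>?T. single R y (\<phi> x) \<otimes> e y) u"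
    using T(1) eT by (intro finsum_linear_extension[OF _ _ _ _ _ u])
      (auto simp: single_def Pi_iff intro!: finsum_closed)
  also have "\<dots> = linear_extension R (\<lambda>x. e (\<phi> x)) u"
    unfolding linear_extension_def
  proof (rule finsum_cong'[OF refl])
    fix x assume x: "x \<in> {x. u x \<noteq> \<zero>}"
    then have "e (\<phi> x) \<in> carrier R" using eT by blast
    have "(\<Oplus>y\<in>?T. single R y (\<phi> x) \<otimes> e y) = (\<Oplus>y\<in>?T. if y = \<phi> x then e (\<phi> x) else \<zero>)"
      using eT \<open>e (\<phi> x) \<in> carrier R\<close> by (intro finsum_cong') (auto simp: single_def Pi_iff)
    also have "\<dots> = e (\<phi> x)"
      using T(1) x \<open>e (\<phi> x) \<in> carrier R\<close> by (intro finsum_delta) auto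
    finally show "u x \<otimes> (\<Oplus>y\<in>?T. single R y (\<phi> x) \<otimes> e y) = u x \<otimes> e (\<phi> x)" by simp
  qed (use eT free_module_closed[OF u] in auto)
  finally show ?thesis .
qed

lemma free_map_subring:
  assumes K: "subring K R" and u: "u \<in> carrier (free_module (R\<lparr>carrier := K\<rparr>) B)"
  shows "free_map (R\<lparr>carrier := K\<rparr>) \<phi> u = free_map R \<phi> u"
  unfolding free_map_def using free_module_subring(1)[OF K u] by (simp add: finsum_subring_eq[OF K])

lemma free_module_product_closed:
  assumes u: "u \<in> carrier (free_module R B)" and v: "v \<in> carrier (free_module R B')"
  shows "(\<lambda>(x, y). u x \<otimes> v y) \<in> carrier (free_module R (B \<times> B'))"
proof (rule free_moduleI)
  show "finite ({x. u x \<noteq> \<zero>} \<times> {y. v y \<noteq> \<zero>})" "{x. u x \<noteq> \<zero>} \<times> {y. v y \<noteq> \<zero>} \<subseteq> B \<times> B'"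
    using u v by (auto dest: free_module_finite_support free_module_outside)
qed (use free_module_closed[OF u] free_module_closed[OF v] in auto)

lemma linear_extension_product:
  assumes u: "u \<in> carrier (free_module R B)" and v: "v \<in> carrier (free_module R B')"
    and e: "\<And>x y. \<lbrakk>x \<in> B; y \<in> B'\<rbrakk> \<Longrightarrow> e (x, y) \<in> carrier R"
  shows "linear_extension R e (\<lambda>(x, y). u x \<otimes> v y)
    = linear_extension R (\<lambda>x. linear_extension R (\<lambda>y. e (x, y)) v) u"
proof -
  let ?S = "{x. u x \<noteq> \<zero>}" and ?T = "{y. v y \<noteq> \<zero>}"
  have S: "finite ?S" "?S \<subseteq> B" and T: "finite ?T" "?T \<subseteq> B'"
    using u v by (auto dest: free_module_finite_support free_module_outside)
  have closed: "u x \<in> carrier R" "v y \<in> carrier R" for x y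
    by (rule free_module_closed[OF u], rule free_module_closed[OF v])
  have eST: "e (x, y) \<in> carrier R" if "x \<in> ?S" "y \<in> ?T" for x y using e S(2) T(2) that by blast
  have supp: "{xy. (\<lambda>(x, y). u x \<otimes> v y) xy \<noteq> \<zero>} \<subseteq> ?S \<times> ?T" using closed by auto
  have "linear_extension R e (\<lambda>(x, y). u x \<otimes> v y) = (\<Oplus>xy\<in>?S \<times> ?T. (\<lambda>(x, y). u x \<otimes> v y) xy \<otimes> e xy)"
    by (rule linear_extension_eq_finsum[OF free_module_product_closed[OF u v] _ supp]) (use S T eST in auto)
  also have "\<dots> = (\<Oplus>x\<in>?S. \<Oplus>y\<in>?T. u x \<otimes> v y \<otimes> e (x, y))"
    using S T closed eST by (subst finsum_Times) auto
  also have "\<dots> = (\<Oplus>x\<in>?S. u x \<otimes> (\<Oplus>y\<in>?T. v y \<otimes> e (x, y)))"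
  proof (rule finsum_cong'[OF refl])
    fix x assume x: "x \<in> ?S"
    have "(\<Oplus>y\<in>?T. u x \<otimes> v y \<otimes> e (x, y)) = (\<Oplus>y\<in>?T. u x \<otimes> (v y \<otimes> e (x, y)))"
      using closed eST x by (intro finsum_cong') (auto simp: m_assoc)
    also have "\<dots> = u x \<otimes> (\<Oplus>y\<in>?T. v y \<otimes> e (x, y))"
      using T(1) closed eST x by (intro finsum_rdistr[symmetric]) auto
    finally show "(\<Oplus>y\<in>?T. u x \<otimes> v y \<otimes> e (x, y)) = u x \<otimes> (\<Oplus>y\<in>?T. v y \<otimes> e (x, y))" .
  qed (use closed eST in \<open>auto intro!: finsum_closed m_closed\<close>)
  finally show ?thesis unfolding linear_extension_def .
qed

end

section \<open>Tensor products\<close>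

context module
begin

context
  fixes J assumes J: "submodule J R M"
begin

lemma submodule_abelian_subgroup: "abelian_subgroup J M"
  by (intro abelian_subgroupI3 additive_subgroupI submodule.axioms(1)[OF J]) unfold_locales

lemma coset_eq_iff:
  assumes "u \<in> carrier M" "v \<in> carrier M"
  shows "J +>\<^bsub>M\<^esub> u = J +>\<^bsub>M\<^esub> v \<longleftrightarrow> u \<ominus>\<^bsub>M\<^esub> v \<in> J"
proof -
  interpret J: abelian_subgroup J M by (rule submodule_abelian_subgroup)
  have "J +>\<^bsub>M\<^esub> u = J +>\<^bsub>M\<^esub> v \<longleftrightarrow> u \<in> J +>\<^bsub>M\<^esub> v"
    using assms J.a_repr_independence'[of u v] J.a_rcos_self[of u] by auto
  then show ?thesis
    using assms J.a_rcos_module[of v u] by (simp add: M.minus_eq)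
qed

lemma mem_coset_iff:
  assumes "v \<in> carrier M"
  shows "u \<in> J +>\<^bsub>M\<^esub> v \<longleftrightarrow> u \<in> carrier M \<and> J +>\<^bsub>M\<^esub> u = J +>\<^bsub>M\<^esub> v"
proof -
  interpret J: abelian_subgroup J M by (rule submodule_abelian_subgroup)
  show ?thesis
    using assms J.a_repr_independence'[of u v] J.a_rcos_self[of u] J.a_elemrcos_carrier[of v u] by auto
qed

lemma coset_add:
  assumes "J +>\<^bsub>M\<^esub> u = J +>\<^bsub>M\<^esub> u'" "J +>\<^bsub>M\<^esub> v = J +>\<^bsub>M\<^esub> v'"
    and "u \<in> carrier M" "u' \<in> carrier M" "v \<in> carrier M" "v' \<in> carrier M"
  shows "J +>\<^bsub>M\<^esub> (u \<oplus>\<^bsub>M\<^esub> v) = J +>\<^bsub>M\<^esub> (u' \<oplus>\<^bsub>M\<^esub> v')"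
proof -
  interpret J: abelian_subgroup J M by (rule submodule_abelian_subgroup)
  show ?thesis using assms J.a_rcos_sum[of u v] J.a_rcos_sum[of u' v'] by simp
qed

lemma coset_smult:
  assumes "J +>\<^bsub>M\<^esub> u = J +>\<^bsub>M\<^esub> v" "c \<in> carrier R" "u \<in> carrier M" "v \<in> carrier M"
  shows "J +>\<^bsub>M\<^esub> (c \<odot>\<^bsub>M\<^esub> u) = J +>\<^bsub>M\<^esub> (c \<odot>\<^bsub>M\<^esub> v)"
proof -
  have "c \<odot>\<^bsub>M\<^esub> (u \<ominus>\<^bsub>M\<^esub> v) \<in> J"
    using assms submoduleE(4)[OF J] by (simp add: coset_eq_iff)
  moreover have "c \<odot>\<^bsub>M\<^esub> (u \<ominus>\<^bsub>M\<^esub> v) = c \<odot>\<^bsub>M\<^esub> u \<ominus>\<^bsub>M\<^esub> c \<odot>\<^bsub>M\<^esub> v"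
    using assms by (simp add: M.minus_eq smult_r_distr smult_r_minus)
  ultimately show ?thesis using assms by (simp add: coset_eq_iff)
qed

lemma coset_finsum:
  assumes "finite A" "f \<in> A \<rightarrow> carrier M" "g \<in> A \<rightarrow> carrier M"
    and "\<And>i. i \<in> A \<Longrightarrow> J +>\<^bsub>M\<^esub> f i = J +>\<^bsub>M\<^esub> g i"
  shows "J +>\<^bsub>M\<^esub> finsum M f A = J +>\<^bsub>M\<^esub> finsum M g A"
  using assms
proof (induction A)
  case (insert a A)
  have fg: "f \<in> A \<rightarrow> carrier M" "f a \<in> carrier M" "g \<in> A \<rightarrow> carrier M" "g a \<in> carrier M"
    using insert.prems(1,2) by auto
  have "J +>\<^bsub>M\<^esub> (f a \<oplus>\<^bsub>M\<^esub> finsum M f A) = J +>\<^bsub>M\<^esub> (g a \<oplus>\<^bsub>M\<^esub> finsum M g A)"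
    using insert fg by (intro coset_add M.finsum_closed) simp_all
  then show ?case using insert.hyps fg by simp
qed simp

end

end

text \<open>
  The coefficients \<open>K\<close> form a subring of \<open>L\<close>, so that bilinear forms on \<open>V \<times> W\<close> may take values in
  the larger ring.
\<close>

locale tensor_product = cring L + V: module "L\<lparr>carrier := K\<rparr>" V + W: module "L\<lparr>carrier := K\<rparr>" W
  for L :: "('a, 'l) ring_scheme" (structure) and K :: "'a set"
    and V :: "('a, 'v, 'e) module_scheme" and W :: "('a, 'w, 'f) module_scheme" +
  assumes K_subring: "subring K L"
begin

lemma single_subring: "single (L\<lparr>carrier := K\<rparr>) = single L"
  by (simp add: single_def fun_eq_iff)

abbreviation "R \<equiv> L\<lparr>carrier := K\<rparr>"
abbreviation "F \<equiv> free_module R (carrier V \<times> carrier W)"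
abbreviation "J \<equiv> tensor_kernel R V W"

sublocale F: module R F
  by (rule V.free_module_is_module)

lemma K_closed: "x \<in> K \<Longrightarrow> x \<in> carrier L"
  using subringE(1)[OF K_subring] by blast

lemma F_free_module: "u \<in> carrier F \<Longrightarrow> u \<in> carrier (free_module L (carrier V \<times> carrier W))"
  using free_module_subring(2)[OF K_subring] .

lemma single_F: "\<lbrakk>v \<in> carrier V; w \<in> carrier W\<rbrakk> \<Longrightarrow> single R (v, w) \<in> carrier F"
  by (rule V.single_closed) simp

lemma smult_F: "\<lbrakk>c \<in> K; u \<in> carrier F\<rbrakk> \<Longrightarrow> c \<odot>\<^bsub>F\<^esub> u \<in> carrier F"
  using F.smult_closed by simp

lemma smult_V: "\<lbrakk>c \<in> K; v \<in> carrier V\<rbrakk> \<Longrightarrow> c \<odot>\<^bsub>V\<^esub> v \<in> carrier V"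
  using V.smult_closed by simp

lemma smult_W: "\<lbrakk>c \<in> K; w \<in> carrier W\<rbrakk> \<Longrightarrow> c \<odot>\<^bsub>W\<^esub> w \<in> carrier W"
  using W.smult_closed by simp

lemma bilinear_relations_subset: "bilinear_relations R V W \<subseteq> carrier F"
  unfolding bilinear_relations_def Let_def
  by (auto intro!: F.M.minus_closed F.M.a_closed smult_F single_F smult_V smult_W)

lemma tensor_kernel_submodule: "submodule J R F"
proof (rule F.submoduleI)
  let ?S = "{S. submodule S R F \<and> bilinear_relations R V W \<subseteq> S}"
  have "carrier F \<in> ?S"
    using F.carrier_is_submodule bilinear_relations_subset by blast
  then show "J \<subseteq> carrier F" unfolding tensor_kernel_def by blast
  show "\<zero>\<^bsub>F\<^esub> \<in> J"
    unfolding tensor_kernel_def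
    using subgroup.one_closed[OF submodule.axioms(1)] by fastforce
  show "\<ominus>\<^bsub>F\<^esub> a \<in> J" if "a \<in> J" for a
    using that F.submoduleE(3) unfolding tensor_kernel_def by blast
  show "a \<oplus>\<^bsub>F\<^esub> b \<in> J" if "a \<in> J" "b \<in> J" for a b
    using that F.submoduleE(5) unfolding tensor_kernel_def by blast
  show "c \<odot>\<^bsub>F\<^esub> a \<in> J" if "c \<in> carrier R" "a \<in> J" for a c
    using that F.submoduleE(4) unfolding tensor_kernel_def by blast
qed

lemmas tensor_class_eq_iff_minus =
  F.coset_eq_iff[OF tensor_kernel_submodule, folded tensor_class_def]
lemmas mem_tensor_class_iff_eq =
  F.mem_coset_iff[OF tensor_kernel_submodule, folded tensor_class_def]
lemmas tensor_class_add = F.coset_add[OF tensor_kernel_submodule, folded tensor_class_def]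
lemmas tensor_class_smult = F.coset_smult[OF tensor_kernel_submodule, folded tensor_class_def]
lemmas tensor_class_finsum = F.coset_finsum[OF tensor_kernel_submodule, folded tensor_class_def]

lemma tensor_class_eqI:
  assumes "u \<ominus>\<^bsub>F\<^esub> v \<in> bilinear_relations R V W" "u \<in> carrier F" "v \<in> carrier F"
  shows "tensor_class R V W u = tensor_class R V W v"
  using assms by (auto simp: tensor_class_eq_iff_minus tensor_kernel_def)

lemma tensor_class_single_add_left:
  assumes "v \<in> carrier V" "v' \<in> carrier V" "w \<in> carrier W"
  shows "tensor_class R V W (single R (v \<oplus>\<^bsub>V\<^esub> v', w))
    = tensor_class R V W (single R (v, w) \<oplus>\<^bsub>F\<^esub> single R (v', w))"
proof (rule tensor_class_eqI)
  show "single R (v \<oplus>\<^bsub>V\<^esub> v', w) \<ominus>\<^bsub>F\<^esub> (single R (v, w) \<oplus>\<^bsub>F\<^esub> single R (v', w)) \<in> bilinear_relations R V W"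
    unfolding bilinear_relations_def Let_def using assms by blast
qed (use assms in \<open>auto intro!: F.M.a_closed single_F\<close>)

lemma tensor_class_single_add_right:
  assumes "v \<in> carrier V" "w \<in> carrier W" "w' \<in> carrier W"
  shows "tensor_class R V W (single R (v, w \<oplus>\<^bsub>W\<^esub> w'))
    = tensor_class R V W (single R (v, w) \<oplus>\<^bsub>F\<^esub> single R (v, w'))"
proof (rule tensor_class_eqI)
  show "single R (v, w \<oplus>\<^bsub>W\<^esub> w') \<ominus>\<^bsub>F\<^esub> (single R (v, w) \<oplus>\<^bsub>F\<^esub> single R (v, w')) \<in> bilinear_relations R V W"
    unfolding bilinear_relations_def Let_def using assms by blast
qed (use assms in \<open>auto intro!: F.M.a_closed single_F\<close>)

lemma tensor_class_single_smult_left: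
  assumes "c \<in> K" "v \<in> carrier V" "w \<in> carrier W"
  shows "tensor_class R V W (single R (c \<odot>\<^bsub>V\<^esub> v, w)) = tensor_class R V W (c \<odot>\<^bsub>F\<^esub> single R (v, w))"
proof (rule tensor_class_eqI)
  have "c \<in> carrier R" using assms(1) by simp
  then show "single R (c \<odot>\<^bsub>V\<^esub> v, w) \<ominus>\<^bsub>F\<^esub> c \<odot>\<^bsub>F\<^esub> single R (v, w) \<in> bilinear_relations R V W"
    unfolding bilinear_relations_def Let_def using assms(2,3) by blast
qed (use assms in \<open>auto intro!: smult_F single_F smult_V\<close>)

lemma tensor_class_single_smult_right:
  assumes "c \<in> K" "v \<in> carrier V" "w \<in> carrier W"
  shows "tensor_class R V W (single R (v, c \<odot>\<^bsub>W\<^esub> w)) = tensor_class R V W (c \<odot>\<^bsub>F\<^esub> single R (v, w))"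
proof (rule tensor_class_eqI)
  have "c \<in> carrier R" using assms(1) by simp
  then show "single R (v, c \<odot>\<^bsub>W\<^esub> w) \<ominus>\<^bsub>F\<^esub> c \<odot>\<^bsub>F\<^esub> single R (v, w) \<in> bilinear_relations R V W"
    unfolding bilinear_relations_def Let_def using assms(2,3) by blast
qed (use assms in \<open>auto intro!: smult_F single_F smult_W\<close>)

lemma tensor_class_linear_combination:
  assumes P: "module R P" and S: "S \<in> carrier P \<rightarrow> carrier F"
    and add: "\<And>v w. \<lbrakk>v \<in> carrier P; w \<in> carrier P\<rbrakk>
      \<Longrightarrow> tensor_class R V W (S (v \<oplus>\<^bsub>P\<^esub> w)) = tensor_class R V W (S v \<oplus>\<^bsub>F\<^esub> S w)"
    and smult: "\<And>c v. \<lbrakk>c \<in> K; v \<in> carrier P\<rbrakk>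
      \<Longrightarrow> tensor_class R V W (S (c \<odot>\<^bsub>P\<^esub> v)) = tensor_class R V W (c \<odot>\<^bsub>F\<^esub> S v)"
    and A: "finite A" "c \<in> A \<rightarrow> K" "f \<in> A \<rightarrow> carrier P"
  shows "tensor_class R V W (S (\<Oplus>\<^bsub>P\<^esub>i\<in>A. c i \<odot>\<^bsub>P\<^esub> f i))
    = tensor_class R V W (\<Oplus>\<^bsub>F\<^esub>i\<in>A. c i \<odot>\<^bsub>F\<^esub> S (f i))"
  using A
proof (induction A)
  case empty
  interpret P: module R P by (rule P)
  have "\<zero> \<in> K" using subringE(2)[OF K_subring] .
  moreover have "\<zero> \<odot>\<^bsub>P\<^esub> \<zero>\<^bsub>P\<^esub> = \<zero>\<^bsub>P\<^esub>" "\<zero> \<odot>\<^bsub>F\<^esub> S \<zero>\<^bsub>P\<^esub> = \<zero>\<^bsub>F\<^esub>"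
    using P.smult_l_null[of "\<zero>\<^bsub>P\<^esub>"] F.smult_l_null[of "S \<zero>\<^bsub>P\<^esub>"] S by auto
  ultimately have "tensor_class R V W (S \<zero>\<^bsub>P\<^esub>) = tensor_class R V W \<zero>\<^bsub>F\<^esub>"
    using smult[of \<zero> "\<zero>\<^bsub>P\<^esub>"] by simp
  then show ?case by simp
next
  case (insert a A)
  interpret P: module R P by (rule P)
  have smult_P: "c \<odot>\<^bsub>P\<^esub> v \<in> carrier P" if "c \<in> K" "v \<in> carrier P" for c v
    using P.smult_closed that by simp
  have ca: "c a \<in> K" "f a \<in> carrier P" and cA: "c \<in> A \<rightarrow> K" "f \<in> A \<rightarrow> carrier P"
    using insert.prems by auto
  have summands: "(\<lambda>i. c i \<odot>\<^bsub>P\<^esub> f i) \<in> A \<rightarrow> carrier P" "(\<lambda>i. c i \<odot>\<^bsub>F\<^esub> S (f i)) \<in> A \<rightarrow> carrier F"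
    using cA S by (auto intro!: smult_P smult_F)
  let ?r = "\<Oplus>\<^bsub>P\<^esub>i\<in>A. c i \<odot>\<^bsub>P\<^esub> f i" and ?q = "\<Oplus>\<^bsub>F\<^esub>i\<in>A. c i \<odot>\<^bsub>F\<^esub> S (f i)"
  have r: "?r \<in> carrier P" by (rule P.finsum_closed[OF summands(1)])
  have q: "?q \<in> carrier F" by (rule F.finsum_closed[OF summands(2)])
  have "tensor_class R V W (S (c a \<odot>\<^bsub>P\<^esub> f a \<oplus>\<^bsub>P\<^esub> ?r)) = tensor_class R V W (S (c a \<odot>\<^bsub>P\<^esub> f a) \<oplus>\<^bsub>F\<^esub> S ?r)"
    using ca r by (intro add smult_P)
  also have "\<dots> = tensor_class R V W (c a \<odot>\<^bsub>F\<^esub> S (f a) \<oplus>\<^bsub>F\<^esub> ?q)"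
    using ca r q S smult insert.IH[OF cA] smult_P
    by (intro tensor_class_add) (auto intro!: smult_F)
  finally show ?case
    using insert.hyps summands smult_P[OF ca] smult_F[OF ca(1), of "S (f a)"] S ca(2)
    by (simp add: Pi_iff)
qed

lemma linear_extension_in_K:
  assumes u: "u \<in> carrier F" and e: "e \<in> carrier V \<times> carrier W \<rightarrow> K"
  shows "linear_extension L e u \<in> K"
  unfolding linear_extension_def
proof (rule finsum_in_subring[OF K_subring], rule Pi_I)
  fix x assume "x \<in> {x. u x \<noteq> \<zero>}"
  then have "e x \<in> K"
    using free_module_support[OF F_free_module[OF u]] e by blast
  then show "u x \<otimes> e x \<in> K"
    using free_module_subring(1)[OF K_subring u] subringE(6)[OF K_subring] by blast
qed

context
  fixes e assumes e: "e \<in> carrier V \<times> carrier W \<rightarrow> carrier L"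
begin

lemma linear_extension_F_zero: "linear_extension L e \<zero>\<^bsub>F\<^esub> = \<zero>"
  using linear_extension_zero[OF e] by (simp add: free_module_sel)

lemma linear_extension_F_add: "\<lbrakk>u \<in> carrier F; v \<in> carrier F\<rbrakk>
    \<Longrightarrow> linear_extension L e (u \<oplus>\<^bsub>F\<^esub> v) = linear_extension L e u \<oplus> linear_extension L e v"
  using linear_extension_add[OF e F_free_module F_free_module, of u v] by (simp add: free_module_sel)

lemma linear_extension_F_smult: "\<lbrakk>c \<in> K; u \<in> carrier F\<rbrakk>
    \<Longrightarrow> linear_extension L e (c \<odot>\<^bsub>F\<^esub> u) = c \<otimes> linear_extension L e u"
  using linear_extension_smult[OF e K_closed F_free_module, of c u] by (simp add: free_module_sel)

lemma linear_extension_F_single: "\<lbrakk>v \<in> carrier V; w \<in> carrier W\<rbrakk>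
    \<Longrightarrow> linear_extension L e (single R (v, w)) = e (v, w)"
  using linear_extension_single[OF e, of "(v, w)"] by (simp add: single_subring)

lemma linear_extension_F_closed: "u \<in> carrier F \<Longrightarrow> linear_extension L e u \<in> carrier L"
  using linear_extension_closed[OF e] F_free_module by blast

lemma linear_extension_F_finsum:
  assumes "finite A" "f \<in> A \<rightarrow> carrier F"
  shows "linear_extension L e (finsum F f A) = (\<Oplus>i\<in>A. linear_extension L e (f i))"
  using assms
proof (induction A)
  case (insert a A)
  then have "linear_extension L e (finsum F f (insert a A))
      = linear_extension L e (f a) \<oplus> linear_extension L e (finsum F f A)"
    by (simp add: linear_extension_F_add)
  then show ?case
    using insert linear_extension_F_closed by (simp add: Pi_iff)
qed (simp add: linear_extension_F_zero)

lemma linear_extension_F_minus_eq_zero_iff: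
  assumes u: "u \<in> carrier F" and v: "v \<in> carrier F"
  shows "linear_extension L e (u \<ominus>\<^bsub>F\<^esub> v) = \<zero> \<longleftrightarrow> linear_extension L e u = linear_extension L e v"
proof -
  have w: "u \<ominus>\<^bsub>F\<^esub> v \<in> carrier F" using u v by (rule F.minus_closed)
  have "(u \<ominus>\<^bsub>F\<^esub> v) \<oplus>\<^bsub>F\<^esub> v = u"
    using u v by (simp add: F.minus_eq F.a_assoc F.l_neg)
  then have "linear_extension L e u = linear_extension L e (u \<ominus>\<^bsub>F\<^esub> v) \<oplus> linear_extension L e v"
    using linear_extension_F_add[OF w v] by simp
  then show ?thesis
    using linear_extension_F_closed[OF w] linear_extension_F_closed[OF v] by (auto simp: add.r_cancel_one)
qed

end

definition bilinear_form :: "('v \<times> 'w \<Rightarrow> 'a) \<Rightarrow> bool" where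
  "bilinear_form e \<longleftrightarrow> e \<in> carrier V \<times> carrier W \<rightarrow> carrier L
    \<and> (\<forall>v\<in>carrier V. \<forall>v'\<in>carrier V. \<forall>w\<in>carrier W. e (v \<oplus>\<^bsub>V\<^esub> v', w) = e (v, w) \<oplus> e (v', w))
    \<and> (\<forall>v\<in>carrier V. \<forall>w\<in>carrier W. \<forall>w'\<in>carrier W. e (v, w \<oplus>\<^bsub>W\<^esub> w') = e (v, w) \<oplus> e (v, w'))
    \<and> (\<forall>c\<in>K. \<forall>v\<in>carrier V. \<forall>w\<in>carrier W.
         e (c \<odot>\<^bsub>V\<^esub> v, w) = c \<otimes> e (v, w) \<and> e (v, c \<odot>\<^bsub>W\<^esub> w) = c \<otimes> e (v, w))"

lemma linear_extension_bilinear_relations: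
  assumes e: "bilinear_form e" and \<rho>: "\<rho> \<in> bilinear_relations R V W"
  shows "linear_extension L e \<rho> = \<zero>"
proof -
  have eL: "e \<in> carrier V \<times> carrier W \<rightarrow> carrier L" using e by (simp add: bilinear_form_def)
  note simps = linear_extension_F_minus_eq_zero_iff[OF eL] linear_extension_F_add[OF eL]
    linear_extension_F_smult[OF eL] linear_extension_F_single[OF eL]
    single_F F.a_closed smult_F smult_V smult_W
  from \<rho> show ?thesis
    unfolding bilinear_relations_def Let_def
    using e by (elim UnE CollectE exE conjE) (simp_all add: simps bilinear_form_def)
qed

lemma linear_extension_tensor_kernel:
  assumes e: "bilinear_form e" and u: "u \<in> J"
  shows "linear_extension L e u = \<zero>"
proof -
  let ?Z = "{u \<in> carrier F. linear_extension L e u = \<zero>}"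
  have eL: "e \<in> carrier V \<times> carrier W \<rightarrow> carrier L" using e by (simp add: bilinear_form_def)
  have "submodule ?Z R F"
  proof (rule F.submoduleI)
    show "\<zero>\<^bsub>F\<^esub> \<in> ?Z" using linear_extension_F_zero[OF eL] by simp
    show "a \<oplus>\<^bsub>F\<^esub> b \<in> ?Z" if "a \<in> ?Z" "b \<in> ?Z" for a b
      using that by (simp add: linear_extension_F_add[OF eL])
    show smult: "c \<odot>\<^bsub>F\<^esub> a \<in> ?Z" if "c \<in> carrier R" "a \<in> ?Z" for a c
      using that by (simp add: linear_extension_F_smult[OF eL] smult_F K_closed)
    show "\<ominus>\<^bsub>F\<^esub> a \<in> ?Z" if a: "a \<in> ?Z" for a
    proof -
      have "\<ominus>\<^bsub>F\<^esub> a = \<zero>\<^bsub>F\<^esub> \<ominus>\<^bsub>F\<^esub> a" using a by (simp add: F.minus_eq)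
      moreover have "linear_extension L e (\<zero>\<^bsub>F\<^esub> \<ominus>\<^bsub>F\<^esub> a) = \<zero>"
        using a by (simp add: linear_extension_F_minus_eq_zero_iff[OF eL] linear_extension_F_zero[OF eL])
      ultimately show ?thesis using a by simp
    qed
  qed blast
  moreover have "bilinear_relations R V W \<subseteq> ?Z"
    using bilinear_relations_subset linear_extension_bilinear_relations[OF e] by blast
  ultimately show ?thesis using u unfolding tensor_kernel_def by blast
qed

lemma linear_extension_tensor_class:
  assumes e: "bilinear_form e" and "u \<in> carrier F" "v \<in> carrier F"
    and "tensor_class R V W u = tensor_class R V W v"
  shows "linear_extension L e u = linear_extension L e v"
proof -
  have eL: "e \<in> carrier V \<times> carrier W \<rightarrow> carrier L" using e by (simp add: bilinear_form_def)
  have "u \<ominus>\<^bsub>F\<^esub> v \<in> J" using assms by (simp add: tensor_class_eq_iff_minus)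
  then have "linear_extension L e (u \<ominus>\<^bsub>F\<^esub> v) = \<zero>" by (rule linear_extension_tensor_kernel[OF e])
  then show ?thesis by (simp only: linear_extension_F_minus_eq_zero_iff[OF eL assms(2,3)])
qed

end

context tensor_product begin

context
  fixes I :: "'i set" and h :: "'i \<Rightarrow> 'v" and \<omega> :: "'i \<Rightarrow> 'v \<Rightarrow> 'a"
    and I' :: "'j set" and h' :: "'j \<Rightarrow> 'w" and \<omega>' :: "'j \<Rightarrow> 'w \<Rightarrow> 'a"
  assumes I: "finite I" "h \<in> I \<rightarrow> carrier V" "\<omega> \<in> I \<rightarrow> carrier V \<rightarrow> K"
      "\<And>v. v \<in> carrier V \<Longrightarrow> (\<Oplus>\<^bsub>V\<^esub>i\<in>I. \<omega> i v \<odot>\<^bsub>V\<^esub> h i) = v"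
    and I': "finite I'" "h' \<in> I' \<rightarrow> carrier W" "\<omega>' \<in> I' \<rightarrow> carrier W \<rightarrow> K"
      "\<And>w. w \<in> carrier W \<Longrightarrow> (\<Oplus>\<^bsub>W\<^esub>j\<in>I'. \<omega>' j w \<odot>\<^bsub>W\<^esub> h' j) = w"
begin

definition frame_sum :: "('i \<times> 'j \<Rightarrow> 'a) \<Rightarrow> 'v \<times> 'w \<Rightarrow> 'a" where
  "frame_sum c = (\<Oplus>\<^bsub>F\<^esub>ij\<in>I \<times> I'. c ij \<odot>\<^bsub>F\<^esub> single R (h (fst ij), h' (snd ij)))"

lemma single_frame: "ij \<in> I \<times> I' \<Longrightarrow> single R (h (fst ij), h' (snd ij)) \<in> carrier F"
  using I(2) I'(2) by (auto intro!: single_F)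

lemma frame_summand_closed:
  "c \<in> I \<times> I' \<rightarrow> K \<Longrightarrow> (\<lambda>ij. c ij \<odot>\<^bsub>F\<^esub> single R (h (fst ij), h' (snd ij))) \<in> I \<times> I' \<rightarrow> carrier F"
  by (intro Pi_I smult_F single_frame) blast+

lemma frame_sum_closed: "c \<in> I \<times> I' \<rightarrow> K \<Longrightarrow> frame_sum c \<in> carrier F"
  unfolding frame_sum_def by (intro F.finsum_closed frame_summand_closed)

lemma frame_sum_cong:
  "\<lbrakk>d \<in> I \<times> I' \<rightarrow> K; \<And>ij. ij \<in> I \<times> I' \<Longrightarrow> c ij = d ij\<rbrakk> \<Longrightarrow> frame_sum c = frame_sum d"
  unfolding frame_sum_def by (rule F.finsum_cong'[OF refl frame_summand_closed]) simp_all

lemma frame_sum_zero: "frame_sum (\<lambda>_. \<zero>) = \<zero>\<^bsub>F\<^esub>"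
  unfolding frame_sum_def using F.smult_l_null[OF single_frame] by (intro F.add.finprod_one_eqI) simp

lemma frame_sum_add:
  assumes c: "c \<in> I \<times> I' \<rightarrow> K" and d: "d \<in> I \<times> I' \<rightarrow> K"
  shows "frame_sum (\<lambda>ij. c ij \<oplus> d ij) = frame_sum c \<oplus>\<^bsub>F\<^esub> frame_sum d"
proof -
  let ?s = "\<lambda>ij. single R (h (fst ij), h' (snd ij))"
  have "frame_sum (\<lambda>ij. c ij \<oplus> d ij) = (\<Oplus>\<^bsub>F\<^esub>ij\<in>I \<times> I'. c ij \<odot>\<^bsub>F\<^esub> ?s ij \<oplus>\<^bsub>F\<^esub> d ij \<odot>\<^bsub>F\<^esub> ?s ij)"
    unfolding frame_sum_def
  proof (rule F.finsum_cong'[OF refl])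
    fix ij assume ij: "ij \<in> I \<times> I'"
    have "c ij \<in> carrier R" "d ij \<in> carrier R" using c d ij by auto
    from F.smult_l_distr[OF this single_frame[OF ij]]
    show "(c ij \<oplus> d ij) \<odot>\<^bsub>F\<^esub> ?s ij = c ij \<odot>\<^bsub>F\<^esub> ?s ij \<oplus>\<^bsub>F\<^esub> d ij \<odot>\<^bsub>F\<^esub> ?s ij" by simp
  qed (use frame_summand_closed[OF c] frame_summand_closed[OF d] in blast)
  then show ?thesis
    unfolding frame_sum_def using F.finsum_addf[OF frame_summand_closed[OF c] frame_summand_closed[OF d]]
    by simp
qed

lemma frame_sum_smult:
  assumes k: "k \<in> K" and c: "c \<in> I \<times> I' \<rightarrow> K"
  shows "frame_sum (\<lambda>ij. k \<otimes> c ij) = k \<odot>\<^bsub>F\<^esub> frame_sum c"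
proof -
  let ?s = "\<lambda>ij. single R (h (fst ij), h' (snd ij))"
  have kR: "k \<in> carrier R" using k by simp
  have "frame_sum (\<lambda>ij. k \<otimes> c ij) = (\<Oplus>\<^bsub>F\<^esub>ij\<in>I \<times> I'. k \<odot>\<^bsub>F\<^esub> (c ij \<odot>\<^bsub>F\<^esub> ?s ij))"
    unfolding frame_sum_def
  proof (rule F.finsum_cong'[OF refl])
    show "(\<lambda>ij. k \<odot>\<^bsub>F\<^esub> (c ij \<odot>\<^bsub>F\<^esub> ?s ij)) \<in> I \<times> I' \<rightarrow> carrier F"
      using frame_summand_closed[OF c] by (intro Pi_I smult_F[OF k]) blast
    fix ij assume ij: "ij \<in> I \<times> I'"
    then have "c ij \<in> carrier R" using c by auto
    from F.smult_assoc1[OF kR this single_frame[OF ij]]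
    show "(k \<otimes> c ij) \<odot>\<^bsub>F\<^esub> ?s ij = k \<odot>\<^bsub>F\<^esub> (c ij \<odot>\<^bsub>F\<^esub> ?s ij)" by simp
  qed
  also have "\<dots> = k \<odot>\<^bsub>F\<^esub> frame_sum c"
    unfolding frame_sum_def using I(1) I'(1)
    by (intro F.finsum_smult_ldistr[OF _ kR frame_summand_closed[OF c], symmetric]) simp
  finally show ?thesis .
qed

lemma tensor_class_single_expand_left:
  assumes v: "v \<in> carrier V" and w: "w \<in> carrier W"
  shows "tensor_class R V W (single R (v, w))
    = tensor_class R V W (\<Oplus>\<^bsub>F\<^esub>i\<in>I. \<omega> i v \<odot>\<^bsub>F\<^esub> single R (h i, w))"
proof -
  have \<omega>v: "(\<lambda>i. \<omega> i v) \<in> I \<rightarrow> K" using I(3) v by blast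
  have "tensor_class R V W (single R (\<Oplus>\<^bsub>V\<^esub>i\<in>I. \<omega> i v \<odot>\<^bsub>V\<^esub> h i, w))
      = tensor_class R V W (\<Oplus>\<^bsub>F\<^esub>i\<in>I. \<omega> i v \<odot>\<^bsub>F\<^esub> single R (h i, w))"
    by (rule tensor_class_linear_combination[OF V.module_axioms, of "\<lambda>v. single R (v, w)"])
      (simp_all add: w single_F I(1,2) \<omega>v tensor_class_single_add_left tensor_class_single_smult_left)
  then show ?thesis unfolding I(4)[OF v] .
qed

lemma tensor_class_single_expand_right:
  assumes v: "v \<in> carrier V" and w: "w \<in> carrier W"
  shows "tensor_class R V W (single R (v, w))
    = tensor_class R V W (\<Oplus>\<^bsub>F\<^esub>j\<in>I'. \<omega>' j w \<odot>\<^bsub>F\<^esub> single R (v, h' j))"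
proof -
  have \<omega>w: "(\<lambda>j. \<omega>' j w) \<in> I' \<rightarrow> K" using I'(3) w by blast
  have "tensor_class R V W (single R (v, \<Oplus>\<^bsub>W\<^esub>j\<in>I'. \<omega>' j w \<odot>\<^bsub>W\<^esub> h' j))
      = tensor_class R V W (\<Oplus>\<^bsub>F\<^esub>j\<in>I'. \<omega>' j w \<odot>\<^bsub>F\<^esub> single R (v, h' j))"
    by (rule tensor_class_linear_combination[OF W.module_axioms, of "\<lambda>w. single R (v, w)"])
      (simp_all add: v single_F I'(1,2) \<omega>w tensor_class_single_add_right tensor_class_single_smult_right)
  then show ?thesis unfolding I'(4)[OF w] .
qed

lemma tensor_class_single_eq_frame_sum:
  assumes v: "v \<in> carrier V" and w: "w \<in> carrier W"
  shows "tensor_class R V W (single R (v, w))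
    = tensor_class R V W (frame_sum (\<lambda>ij. \<omega> (fst ij) v \<otimes> \<omega>' (snd ij) w))"
proof -
  let ?s = "\<lambda>i j. single R (h i, h' j)"
  let ?q = "\<lambda>i. \<Oplus>\<^bsub>F\<^esub>j\<in>I'. \<omega>' j w \<odot>\<^bsub>F\<^esub> ?s i j"
  have \<omega>: "\<omega> i v \<in> K" "\<omega>' j w \<in> K" "\<omega> i v \<otimes> \<omega>' j w \<in> K" if "i \<in> I" "j \<in> I'" for i j
    using I(3) I'(3) v w that subringE(6)[OF K_subring] by blast+
  have \<omega>R: "\<omega> i v \<in> carrier R" if "i \<in> I" for i using I(3) v that by auto
  have s: "single R (h i, w) \<in> carrier F" "?s i j \<in> carrier F" if "i \<in> I" "j \<in> I'" for i j
    using I(2) I'(2) w that by (auto intro!: single_F)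
  have hi: "single R (h i, w) \<in> carrier F" if "i \<in> I" for i
    using I(2) w that by (auto intro!: single_F)
  have q: "?q i \<in> carrier F" if "i \<in> I" for i
    using that \<omega> s by (intro F.finsum_closed Pi_I smult_F)
  have double: "\<omega> i v \<odot>\<^bsub>F\<^esub> ?q i = (\<Oplus>\<^bsub>F\<^esub>j\<in>I'. (\<omega> i v \<otimes> \<omega>' j w) \<odot>\<^bsub>F\<^esub> ?s i j)" if i: "i \<in> I" for i
  proof -
    have "\<omega> i v \<odot>\<^bsub>F\<^esub> ?q i = (\<Oplus>\<^bsub>F\<^esub>j\<in>I'. \<omega> i v \<odot>\<^bsub>F\<^esub> (\<omega>' j w \<odot>\<^bsub>F\<^esub> ?s i j))"
      using i \<omega> s by (intro F.finsum_smult_ldistr[OF I'(1) \<omega>R]) (auto intro!: smult_F)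
    also have "\<dots> = (\<Oplus>\<^bsub>F\<^esub>j\<in>I'. (\<omega> i v \<otimes> \<omega>' j w) \<odot>\<^bsub>F\<^esub> ?s i j)"
      using i \<omega> s F.smult_assoc1[OF \<omega>R, symmetric] by (intro F.finsum_cong') (auto intro!: smult_F)
    finally show ?thesis .
  qed
  have "tensor_class R V W (single R (v, w))
      = tensor_class R V W (\<Oplus>\<^bsub>F\<^esub>i\<in>I. \<omega> i v \<odot>\<^bsub>F\<^esub> single R (h i, w))"
    by (rule tensor_class_single_expand_left[OF v w])
  also have "\<dots> = tensor_class R V W (\<Oplus>\<^bsub>F\<^esub>i\<in>I. \<omega> i v \<odot>\<^bsub>F\<^esub> ?q i)"
    using \<omega>R hi q w I(2)
    by (intro tensor_class_finsum[OF I(1)] tensor_class_smult tensor_class_single_expand_right)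
      (auto intro!: F.smult_closed)
  also have "(\<Oplus>\<^bsub>F\<^esub>i\<in>I. \<omega> i v \<odot>\<^bsub>F\<^esub> ?q i) = (\<Oplus>\<^bsub>F\<^esub>i\<in>I. \<Oplus>\<^bsub>F\<^esub>j\<in>I'. (\<omega> i v \<otimes> \<omega>' j w) \<odot>\<^bsub>F\<^esub> ?s i j)"
    using double \<omega> s by (intro F.finsum_cong') (auto intro!: F.finsum_closed smult_F)
  also have "\<dots> = frame_sum (\<lambda>ij. \<omega> (fst ij) v \<otimes> \<omega>' (snd ij) w)"
    unfolding frame_sum_def using \<omega> s
    by (subst F.finsum_Times[OF I(1) I'(1)]) (auto intro!: smult_F)
  finally show ?thesis .
qed

definition frame_coeff :: "('v \<times> 'w \<Rightarrow> 'a) \<Rightarrow> 'i \<times> 'j \<Rightarrow> 'a" where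
  "frame_coeff u ij = linear_extension L (\<lambda>(v, w). \<omega> (fst ij) v \<otimes> \<omega>' (snd ij) w) u"

lemma frame_form_closed:
  "ij \<in> I \<times> I' \<Longrightarrow> (\<lambda>(v, w). \<omega> (fst ij) v \<otimes> \<omega>' (snd ij) w) \<in> carrier V \<times> carrier W \<rightarrow> K"
  using I(3) I'(3) subringE(6)[OF K_subring] by (auto simp: Pi_iff)

lemma frame_form_closed_L:
  "ij \<in> I \<times> I' \<Longrightarrow> (\<lambda>(v, w). \<omega> (fst ij) v \<otimes> \<omega>' (snd ij) w) \<in> carrier V \<times> carrier W \<rightarrow> carrier L"
  using frame_form_closed K_closed by blast

lemma frame_coeff_closed: "u \<in> carrier F \<Longrightarrow> frame_coeff u \<in> I \<times> I' \<rightarrow> K"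
  unfolding frame_coeff_def using linear_extension_in_K[OF _ frame_form_closed] by blast

lemma frame_sum_coeff_zero: "frame_sum (frame_coeff \<zero>\<^bsub>F\<^esub>) = \<zero>\<^bsub>F\<^esub>"
proof -
  have "frame_sum (frame_coeff \<zero>\<^bsub>F\<^esub>) = frame_sum (\<lambda>_. \<zero>)"
    using linear_extension_F_zero[OF frame_form_closed_L] subringE(2)[OF K_subring]
    by (intro frame_sum_cong) (auto simp: frame_coeff_def)
  then show ?thesis by (simp only: frame_sum_zero)
qed

lemma frame_sum_coeff_add_single:
  assumes u: "u \<in> carrier F" and k: "k \<in> K" and v: "v \<in> carrier V" and w: "w \<in> carrier W"
  shows "frame_sum (frame_coeff (u \<oplus>\<^bsub>F\<^esub> k \<odot>\<^bsub>F\<^esub> single R (v, w)))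
    = frame_sum (frame_coeff u) \<oplus>\<^bsub>F\<^esub> k \<odot>\<^bsub>F\<^esub> frame_sum (\<lambda>ij. \<omega> (fst ij) v \<otimes> \<omega>' (snd ij) w)"
proof -
  let ?d = "\<lambda>ij. \<omega> (fst ij) v \<otimes> \<omega>' (snd ij) w"
  note c = frame_coeff_closed[OF u]
  have d: "?d \<in> I \<times> I' \<rightarrow> K"
    using I(3) I'(3) v w subringE(6)[OF K_subring] by (auto simp: Pi_iff)
  then have kd: "(\<lambda>ij. k \<otimes> ?d ij) \<in> I \<times> I' \<rightarrow> K" using k subringE(6)[OF K_subring] by auto
  have "frame_coeff (u \<oplus>\<^bsub>F\<^esub> k \<odot>\<^bsub>F\<^esub> single R (v, w)) ij = frame_coeff u ij \<oplus> k \<otimes> ?d ij"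
    if ij: "ij \<in> I \<times> I'" for ij
  proof -
    note e = frame_form_closed_L[OF ij]
    show ?thesis
      unfolding frame_coeff_def
      using linear_extension_F_add[OF e u smult_F[OF k single_F[OF v w]]] linear_extension_F_single[OF e v w]
        linear_extension_F_smult[OF e k single_F[OF v w]] by simp
  qed
  then have "frame_sum (frame_coeff (u \<oplus>\<^bsub>F\<^esub> k \<odot>\<^bsub>F\<^esub> single R (v, w)))
      = frame_sum (\<lambda>ij. frame_coeff u ij \<oplus> k \<otimes> ?d ij)"
    using c kd subringE(7)[OF K_subring] by (intro frame_sum_cong Pi_I) blast+
  also have "\<dots> = frame_sum (frame_coeff u) \<oplus>\<^bsub>F\<^esub> k \<odot>\<^bsub>F\<^esub> frame_sum ?d"
    by (simp only: frame_sum_add[OF c kd] frame_sum_smult[OF k d])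
  finally show ?thesis .
qed

lemma tensor_class_eq_frame_sum:
  assumes "u \<in> carrier F"
  shows "tensor_class R V W u = tensor_class R V W (frame_sum (frame_coeff u))"
  using assms
proof (induction u rule: V.free_module_induct)
  case zero
  show ?case by (simp only: frame_sum_coeff_zero)
next
  case (step u k x)
  then obtain v w where x: "x = (v, w)" and v: "v \<in> carrier V" and w: "w \<in> carrier W" by auto
  have k: "k \<in> K" using step.hyps(2) by simp
  let ?d = "\<lambda>ij. \<omega> (fst ij) v \<otimes> \<omega>' (snd ij) w"
  have d: "frame_sum ?d \<in> carrier F"
    using I(3) I'(3) v w subringE(6)[OF K_subring] by (intro frame_sum_closed) (auto simp: Pi_iff)
  have "tensor_class R V W (k \<odot>\<^bsub>F\<^esub> single R (v, w)) = tensor_class R V W (k \<odot>\<^bsub>F\<^esub> frame_sum ?d)"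
    by (rule tensor_class_smult[OF tensor_class_single_eq_frame_sum[OF v w] step.hyps(2) single_F[OF v w] d])
  then have "tensor_class R V W (u \<oplus>\<^bsub>F\<^esub> k \<odot>\<^bsub>F\<^esub> single R (v, w))
      = tensor_class R V W (frame_sum (frame_coeff u) \<oplus>\<^bsub>F\<^esub> k \<odot>\<^bsub>F\<^esub> frame_sum ?d)"
    using step.IH step.hyps(1) frame_sum_closed[OF frame_coeff_closed[OF step.hyps(1)]]
      smult_F[OF k single_F[OF v w]] smult_F[OF k d]
    by (intro tensor_class_add)
  then show ?case unfolding x by (simp only: frame_sum_coeff_add_single[OF step.hyps(1) k v w])
qed

theorem tensor_class_eqI_frame:
  assumes u: "u \<in> carrier F" and u': "u' \<in> carrier F"
    and eq: "\<And>i j. \<lbrakk>i \<in> I; j \<in> I'\<rbrakk> \<Longrightarrow> linear_extension L (\<lambda>(v, w). \<omega> i v \<otimes> \<omega>' j w) u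
      = linear_extension L (\<lambda>(v, w). \<omega> i v \<otimes> \<omega>' j w) u'"
  shows "tensor_class R V W u = tensor_class R V W u'"
proof -
  have "frame_sum (frame_coeff u) = frame_sum (frame_coeff u')"
    using eq by (intro frame_sum_cong frame_coeff_closed[OF u']) (auto simp: frame_coeff_def)
  then show ?thesis
    using tensor_class_eq_frame_sum[OF u] tensor_class_eq_frame_sum[OF u'] by simp
qed

end

end

section \<open>Modules of functions with a frame\<close>

text \<open>The image of a formal tensor under the canonical map \<open>L\<^sup>M \<otimes> L\<^sup>M \<rightarrow> L\<^sup>M\<^sup>\<times>\<^sup>M\<close>.\<close>

definition tensor_coeff ::
  "('a, 'r) ring_scheme \<Rightarrow> (('m \<Rightarrow> 'a) \<times> ('m \<Rightarrow> 'a) \<Rightarrow> 'a) \<Rightarrow> 'm \<Rightarrow> 'm \<Rightarrow> 'a" where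
  "tensor_coeff R u x y = linear_extension R (\<lambda>(a, b). a x \<otimes>\<^bsub>R\<^esub> b y) u"

lemma (in cring) linear_extension_tensor_pairing:
  assumes M: "finite M" and B: "B \<subseteq> carrier (free_module R M)"
    and u: "u \<in> carrier (free_module R (B \<times> B))"
    and p: "p \<in> M \<rightarrow> carrier R" and q: "q \<in> M \<rightarrow> carrier R"
  shows "linear_extension R (\<lambda>(a, b). linear_extension R p a \<otimes> linear_extension R q b) u
    = (\<Oplus>xy\<in>M \<times> M. tensor_coeff R u (fst xy) (snd xy) \<otimes> (p (fst xy) \<otimes> q (snd xy)))"
  unfolding tensor_coeff_def
proof (rule finsum_linear_extension[symmetric, OF _ _ _ _ _ u])
  have closed: "a m \<in> carrier R" if "a \<in> B" for a m
    using free_module_closed[of a M m] that B by blast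
  then show "(\<lambda>(a, b). a (fst xy) \<otimes> b (snd xy)) \<in> B \<times> B \<rightarrow> carrier R" for xy
    by auto
  show "(\<lambda>(a, b). linear_extension R p a \<otimes> linear_extension R q b) \<in> B \<times> B \<rightarrow> carrier R"
    using linear_extension_closed[OF p] linear_extension_closed[OF q] B by auto
  show "(\<lambda>xy. p (fst xy) \<otimes> q (snd xy)) \<in> M \<times> M \<rightarrow> carrier R"
    using p q by (auto simp: Pi_iff)
  fix ab assume "ab \<in> B \<times> B"
  then obtain a b where ab: "ab = (a, b)" "a \<in> B" "b \<in> B" by blast
  then have a: "a \<in> carrier (free_module R M)" and b: "b \<in> carrier (free_module R M)"
    using B by auto
  have pq: "p x \<in> carrier R" "q x \<in> carrier R" if "x \<in> M" for x
    using p q that by auto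
  have "linear_extension R p a \<otimes> linear_extension R q b
      = (\<Oplus>xy\<in>M \<times> M. (a (fst xy) \<otimes> p (fst xy)) \<otimes> (b (snd xy) \<otimes> q (snd xy)))"
    unfolding linear_extension_finite[OF a M p] linear_extension_finite[OF b M q]
    using M pq closed ab by (intro finsum_product) auto
  also have "\<dots> = (\<Oplus>xy\<in>M \<times> M. (a (fst xy) \<otimes> b (snd xy)) \<otimes> (p (fst xy) \<otimes> q (snd xy)))"
    using pq closed ab by (intro finsum_cong') (auto simp: m_ac)
  finally show "(\<lambda>(a, b). linear_extension R p a \<otimes> linear_extension R q b) ab
      = (\<Oplus>xy\<in>M \<times> M. (\<lambda>(a, b). a (fst xy) \<otimes> b (snd xy)) ab \<otimes> (p (fst xy) \<otimes> q (snd xy)))"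
    unfolding ab(1) by simp
qed (use M in simp)

text \<open>
  The frame \<open>v = \<Sum> w\<^sub>i(v) h\<^sub>i\<close>, with \<open>w\<^sub>i(v) = \<Sum> v(m) w\<^sub>i(m)\<close> in \<open>K\<close>, plays the role of a \<open>K\<close>-basis of \<open>V\<close>
  with its dual basis. Both \<open>L[M]\<^sup>G\<close> over \<open>K\<close> and \<open>L[M]\<close> over \<open>L\<close> carry one.
\<close>

locale framed_module = cring L
  for L :: "('a, 'l) ring_scheme" (structure) and K :: "'a set" and M :: "'m set"
    and V :: "('a, 'm \<Rightarrow> 'a, 'e) module_scheme" and I :: "'i set" and w h :: "'i \<Rightarrow> 'm \<Rightarrow> 'a" +
  assumes K_subring: "subring K L"
    and finite_M: "finite M" and finite_I: "finite I"
    and V_subset: "carrier V \<subseteq> carrier (free_module L M)"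
    and V_ops: "\<zero>\<^bsub>V\<^esub> = (\<lambda>_. \<zero>)" "v \<oplus>\<^bsub>V\<^esub> v' = (\<lambda>m. v m \<oplus> v' m)" "c \<odot>\<^bsub>V\<^esub> v = (\<lambda>m. c \<otimes> v m)"
    and V_zero_closed: "(\<lambda>_. \<zero>) \<in> carrier V"
    and V_add_closed: "\<lbrakk>v \<in> carrier V; v' \<in> carrier V\<rbrakk> \<Longrightarrow> (\<lambda>m. v m \<oplus> v' m) \<in> carrier V"
    and V_smult_closed: "\<lbrakk>c \<in> K; v \<in> carrier V\<rbrakk> \<Longrightarrow> (\<lambda>m. c \<otimes> v m) \<in> carrier V"
    and w_closed: "i \<in> I \<Longrightarrow> w i \<in> M \<rightarrow> carrier L"
    and h_closed: "i \<in> I \<Longrightarrow> h i \<in> carrier V"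
    and pairing_in_K: "\<lbrakk>i \<in> I; v \<in> carrier V\<rbrakk> \<Longrightarrow> linear_extension L (w i) v \<in> K"
    and frame: "\<lbrakk>x \<in> M; y \<in> M\<rbrakk> \<Longrightarrow> (\<Oplus>i\<in>I. w i x \<otimes> h i y) = (if x = y then \<one> else \<zero>)"
begin

lemma V_closed: "v \<in> carrier V \<Longrightarrow> v m \<in> carrier L"
  using free_module_closed[of v M m] V_subset by blast

lemma V_module: "module (L\<lparr>carrier := K\<rparr>) V"
  by (rule module_of_functionsI[OF K_subring])
    (simp_all add: V_closed V_ops V_zero_closed V_add_closed V_smult_closed)

sublocale tensor_product L K V V
  by (intro tensor_product.intro tensor_product_axioms.intro V_module K_subring cring_axioms)

lemma V_finsum_apply:
  assumes "f \<in> A \<rightarrow> carrier V"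
  shows "(\<Oplus>\<^bsub>V\<^esub>i\<in>A. f i) m = (\<Oplus>i\<in>A. f i m)"
  using assms
proof (induction A rule: infinite_finite_induct)
  case (insert a A)
  then show ?case using V_closed by (simp add: V_ops Pi_iff)
qed (simp_all add: V_ops)

lemma frame_expansion:
  assumes v: "v \<in> carrier V"
  shows "(\<Oplus>\<^bsub>V\<^esub>i\<in>I. linear_extension L (w i) v \<odot>\<^bsub>V\<^esub> h i) = v"
proof
  fix y
  have vM: "v \<in> carrier (free_module L M)" using v V_subset by blast
  have wv: "linear_extension L (w i) v \<in> K" if "i \<in> I" for i by (rule pairing_in_K[OF that v])
  have "(\<lambda>i. linear_extension L (w i) v \<odot>\<^bsub>V\<^esub> h i) \<in> I \<rightarrow> carrier V"
    using wv h_closed by (intro Pi_I smult_V)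
  from V_finsum_apply[OF this]
  have "(\<Oplus>\<^bsub>V\<^esub>i\<in>I. linear_extension L (w i) v \<odot>\<^bsub>V\<^esub> h i) y = (\<Oplus>i\<in>I. linear_extension L (w i) v \<otimes> h i y)"
    by (simp add: V_ops)
  also have "\<dots> = linear_extension L (\<lambda>x. if x = y \<and> y \<in> M then \<one> else \<zero>) v"
  proof (rule finsum_linear_extension[OF _ finite_I w_closed _ _ vM])
    show "(if x = y \<and> y \<in> M then \<one> else \<zero>) = (\<Oplus>i\<in>I. w i x \<otimes> h i y)" if x: "x \<in> M" for x
    proof (cases "y \<in> M")
      case True
      then show ?thesis using frame[OF x] by simp
    next
      case False
      then have "h i y = \<zero>" if "i \<in> I" for i
        using free_module_outside[of "h i" L M y] h_closed[OF that] V_subset by blast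
      then have "(\<Oplus>i\<in>I. w i x \<otimes> h i y) = \<zero>"
        using Pi_mem[OF w_closed x] by (intro add.finprod_one_eqI) simp
      with False show ?thesis by simp
    qed
  qed (use h_closed V_closed in auto)
  also have "\<dots> = linear_extension L (single L y) v"
    by (rule linear_extension_cong[OF vM]) (auto simp: single_def)
  also have "\<dots> = v y"
    by (rule linear_extension_single_left[OF vM])
  finally show "(\<Oplus>\<^bsub>V\<^esub>i\<in>I. linear_extension L (w i) v \<odot>\<^bsub>V\<^esub> h i) y = v y" .
qed

lemma frame_reproduces:
  assumes r: "r \<in> M \<rightarrow> carrier L" and x: "x \<in> M"
  shows "(\<Oplus>i\<in>I. w i x \<otimes> linear_extension L r (h i)) = r x"
proof -
  have closed: "w i x \<in> carrier L" "h i m \<in> carrier L" "r m \<in> carrier L" if "i \<in> I" "m \<in> M" for i m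
    using w_closed[OF that(1)] x V_closed[OF h_closed[OF that(1)]] r that by auto
  have "(\<Oplus>i\<in>I. w i x \<otimes> linear_extension L r (h i)) = (\<Oplus>i\<in>I. \<Oplus>m\<in>M. w i x \<otimes> h i m \<otimes> r m)"
  proof (rule finsum_cong'[OF refl])
    fix i assume i: "i \<in> I"
    have "h i \<in> carrier (free_module L M)" using h_closed[OF i] V_subset by blast
    then have "w i x \<otimes> linear_extension L r (h i) = (\<Oplus>m\<in>M. w i x \<otimes> (h i m \<otimes> r m))"
      using finite_M r closed i x by (simp add: linear_extension_finite finsum_rdistr Pi_iff)
    also have "\<dots> = (\<Oplus>m\<in>M. w i x \<otimes> h i m \<otimes> r m)"
      using closed i by (intro finsum_cong') (auto simp: m_assoc)
    finally show "w i x \<otimes> linear_extension L r (h i) = (\<Oplus>m\<in>M. w i x \<otimes> h i m \<otimes> r m)" .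
  qed (use closed in \<open>auto intro!: finsum_closed\<close>)
  also have "\<dots> = (\<Oplus>m\<in>M. \<Oplus>i\<in>I. w i x \<otimes> h i m \<otimes> r m)"
    using closed finite_M finite_I by (intro finsum_swap) auto
  also have "\<dots> = (\<Oplus>m\<in>M. if m = x then r x else \<zero>)"
  proof (rule finsum_cong'[OF refl])
    fix m assume m: "m \<in> M"
    have "(\<Oplus>i\<in>I. w i x \<otimes> h i m \<otimes> r m) = (\<Oplus>i\<in>I. w i x \<otimes> h i m) \<otimes> r m"
      using closed finite_I m r by (intro finsum_ldistr[symmetric]) auto
    then show "(\<Oplus>i\<in>I. w i x \<otimes> h i m \<otimes> r m) = (if m = x then r x else \<zero>)"
      using frame[OF x m] r m x by (auto simp: Pi_iff)
  qed (use r x in auto)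
  also have "\<dots> = r x" using r x finite_M by (intro finsum_delta) auto
  finally show ?thesis .
qed

lemma frame_separates:
  assumes p: "p \<in> M \<rightarrow> carrier L" and q: "q \<in> M \<rightarrow> carrier L"
    and eq: "\<And>v. v \<in> carrier V \<Longrightarrow> linear_extension L p v = linear_extension L q v"
    and x: "x \<in> M"
  shows "p x = q x"
proof -
  have "h i \<in> carrier (free_module L M)" if "i \<in> I" for i using h_closed[OF that] V_subset by blast
  then have "(\<Oplus>i\<in>I. w i x \<otimes> linear_extension L p (h i)) = (\<Oplus>i\<in>I. w i x \<otimes> linear_extension L q (h i))"
    using eq[OF h_closed] Pi_mem[OF w_closed x] linear_extension_closed[OF q]
    by (intro finsum_cong') auto
  then show ?thesis by (simp only: frame_reproduces[OF p x] frame_reproduces[OF q x])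
qed

lemma linear_functional_repr:
  assumes closed: "\<And>v. v \<in> carrier V \<Longrightarrow> \<psi> v \<in> carrier L"
    and add: "\<And>v v'. \<lbrakk>v \<in> carrier V; v' \<in> carrier V\<rbrakk> \<Longrightarrow> \<psi> (v \<oplus>\<^bsub>V\<^esub> v') = \<psi> v \<oplus> \<psi> v'"
    and smult: "\<And>c v. \<lbrakk>c \<in> K; v \<in> carrier V\<rbrakk> \<Longrightarrow> \<psi> (c \<odot>\<^bsub>V\<^esub> v) = c \<otimes> \<psi> v"
    and v: "v \<in> carrier V"
  shows "\<psi> v = linear_extension L (\<lambda>m. \<Oplus>i\<in>I. w i m \<otimes> \<psi> (h i)) v"
proof -
  have zero: "\<psi> \<zero>\<^bsub>V\<^esub> = \<zero>"
    using add[OF V.zero_closed V.zero_closed] closed[OF V.zero_closed] by (simp add: add.r_cancel_one')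
  have finsum: "\<psi> (\<Oplus>\<^bsub>V\<^esub>i\<in>A. f i) = (\<Oplus>i\<in>A. \<psi> (f i))"
    if "finite A" "f \<in> A \<rightarrow> carrier V" for A and f :: "'i \<Rightarrow> 'm \<Rightarrow> 'a"
    using that by (induction A) (simp_all add: zero add closed Pi_iff)
  have wv: "linear_extension L (w i) v \<in> K" if "i \<in> I" for i by (rule pairing_in_K[OF that v])
  have "\<psi> v = \<psi> (\<Oplus>\<^bsub>V\<^esub>i\<in>I. linear_extension L (w i) v \<odot>\<^bsub>V\<^esub> h i)"
    by (simp only: frame_expansion[OF v])
  also have "\<dots> = (\<Oplus>i\<in>I. \<psi> (linear_extension L (w i) v \<odot>\<^bsub>V\<^esub> h i))"
    using wv h_closed by (intro finsum[OF finite_I] Pi_I smult_V)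
  also have "\<dots> = (\<Oplus>i\<in>I. linear_extension L (w i) v \<otimes> \<psi> (h i))"
    using wv h_closed K_closed closed smult by (intro finsum_cong') auto
  also have "\<dots> = linear_extension L (\<lambda>m. \<Oplus>i\<in>I. w i m \<otimes> \<psi> (h i)) v"
  proof (rule finsum_linear_extension[OF _ finite_I w_closed])
    show "(\<lambda>m. \<Oplus>i\<in>I. w i m \<otimes> \<psi> (h i)) \<in> M \<rightarrow> carrier L"
      using w_closed h_closed closed by (intro Pi_I finsum_closed m_closed) auto
  qed (use h_closed closed v V_subset in auto)
  finally show ?thesis .
qed

lemma bilinear_form_eval: "bilinear_form (\<lambda>(a, b). a x \<otimes> b y)"
  using V_closed K_closed
  by (auto simp: bilinear_form_def V_ops l_distr r_distr m_assoc m_lcomm)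

theorem tensor_class_eq_iff:
  assumes u: "u \<in> carrier F" and v: "v \<in> carrier F"
  shows "tensor_class R V V u = tensor_class R V V v
    \<longleftrightarrow> (\<forall>x\<in>M. \<forall>y\<in>M. tensor_coeff L u x y = tensor_coeff L v x y)"
proof
  assume "tensor_class R V V u = tensor_class R V V v"
  then show "\<forall>x\<in>M. \<forall>y\<in>M. tensor_coeff L u x y = tensor_coeff L v x y"
    unfolding tensor_coeff_def using linear_extension_tensor_class[OF bilinear_form_eval u v] by blast
next
  assume eq: "\<forall>x\<in>M. \<forall>y\<in>M. tensor_coeff L u x y = tensor_coeff L v x y"
  let ?\<omega> = "\<lambda>i v. linear_extension L (w i) v"
  have \<omega>: "?\<omega> \<in> I \<rightarrow> carrier V \<rightarrow> K" using pairing_in_K by blast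
  have h: "h \<in> I \<rightarrow> carrier V" using h_closed by blast
  show "tensor_class R V V u = tensor_class R V V v"
  proof (rule tensor_class_eqI_frame[OF finite_I h \<omega> frame_expansion finite_I h \<omega> frame_expansion u v])
    fix i j assume i: "i \<in> I" and j: "j \<in> I"
    note pairing = linear_extension_tensor_pairing[OF finite_M V_subset F_free_module
        w_closed[OF i] w_closed[OF j]]
    have "tensor_coeff L v x y \<in> carrier L" for x y
      unfolding tensor_coeff_def using bilinear_form_eval
      by (intro linear_extension_F_closed v) (simp add: bilinear_form_def)
    then show "linear_extension L (\<lambda>(a, b). ?\<omega> i a \<otimes> ?\<omega> j b) u
        = linear_extension L (\<lambda>(a, b). ?\<omega> i a \<otimes> ?\<omega> j b) v"
      unfolding pairing[OF u] pairing[OF v] using eq Pi_mem[OF w_closed[OF i]] Pi_mem[OF w_closed[OF j]]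
      by (intro finsum_cong') auto
  qed
qed

lemma frame_diagonal:
  assumes m: "m \<in> M" and x: "x \<in> M" and y: "y \<in> M"
  shows "(\<Oplus>ij\<in>I \<times> I. w (fst ij) m \<otimes> w (snd ij) m \<otimes> (h (fst ij) x \<otimes> h (snd ij) y))
    = (if m = x \<and> m = y then \<one> else \<zero>)"
proof -
  have wm: "w i m \<in> carrier L" and hm: "h i z \<in> carrier L" if "i \<in> I" for i z
    using w_closed[OF that] m V_closed[OF h_closed[OF that]] by auto
  have "(\<Oplus>ij\<in>I \<times> I. w (fst ij) m \<otimes> w (snd ij) m \<otimes> (h (fst ij) x \<otimes> h (snd ij) y))
      = (\<Oplus>ij\<in>I \<times> I. (w (fst ij) m \<otimes> h (fst ij) x) \<otimes> (w (snd ij) m \<otimes> h (snd ij) y))"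
    using wm hm by (intro finsum_cong') (auto simp: m_ac)
  also have "\<dots> = (\<Oplus>i\<in>I. w i m \<otimes> h i x) \<otimes> (\<Oplus>j\<in>I. w j m \<otimes> h j y)"
    using wm hm by (intro finsum_product[OF finite_I finite_I, symmetric]) auto
  also have "\<dots> = (if m = x \<and> m = y then \<one> else \<zero>)"
    using frame[OF m x] frame[OF m y] by simp
  finally show ?thesis .
qed

lemma exists_diagonal_tensor:
  assumes v: "v \<in> carrier (free_module L M)"
    and K: "\<And>i j. \<lbrakk>i \<in> I; j \<in> I\<rbrakk> \<Longrightarrow> linear_extension L (\<lambda>m. w i m \<otimes> w j m) v \<in> K"
  obtains u where "u \<in> carrier F"
    "\<And>x y. \<lbrakk>x \<in> M; y \<in> M\<rbrakk> \<Longrightarrow> tensor_coeff L u x y = (if x = y then v x else \<zero>)"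
proof
  let ?C = "\<lambda>ij. linear_extension L (\<lambda>m. w (fst ij) m \<otimes> w (snd ij) m) v"
  let ?s = "\<lambda>ij. ?C ij \<odot>\<^bsub>F\<^esub> single R (h (fst ij), h (snd ij))"
  have C: "?C ij \<in> K" if "ij \<in> I \<times> I" for ij using that K by auto
  have single: "single R (h (fst ij), h (snd ij)) \<in> carrier F" if "ij \<in> I \<times> I" for ij
    using that h_closed by (auto intro!: single_F)
  have s: "?s \<in> I \<times> I \<rightarrow> carrier F" using C single by (intro Pi_I smult_F)
  then show "finsum F ?s (I \<times> I) \<in> carrier F" by (rule F.finsum_closed)
  fix x y assume x: "x \<in> M" and y: "y \<in> M"
  have eval: "(\<lambda>(a, b). a x \<otimes> b y) \<in> carrier V \<times> carrier V \<rightarrow> carrier L"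
    using bilinear_form_eval by (simp add: bilinear_form_def)
  have hm: "h i m \<in> carrier L" if "i \<in> I" for i m using V_closed[OF h_closed[OF that]] .
  have "tensor_coeff L (finsum F ?s (I \<times> I)) x y = (\<Oplus>ij\<in>I \<times> I. linear_extension L (\<lambda>(a, b). a x \<otimes> b y) (?s ij))"
    unfolding tensor_coeff_def using finite_I by (intro linear_extension_F_finsum[OF eval _ s]) simp
  also have "\<dots> = (\<Oplus>ij\<in>I \<times> I. ?C ij \<otimes> (h (fst ij) x \<otimes> h (snd ij) y))"
    using C single h_closed hm K_closed linear_extension_F_single[OF eval]
    by (intro finsum_cong') (auto simp: linear_extension_F_smult[OF eval])
  also have "\<dots> = linear_extension L (\<lambda>m. if m = x \<and> m = y then \<one> else \<zero>) v"
    by (rule finsum_linear_extension[OF _ _ _ _ frame_diagonal[OF _ x y, symmetric] v])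
      (use finite_I hm Pi_mem[OF w_closed] in auto)
  also have "\<dots> = linear_extension L (\<lambda>m. single L x m \<otimes> (if x = y then \<one> else \<zero>)) v"
    by (rule linear_extension_cong[OF v]) (auto simp: single_def)
  also have "\<dots> = linear_extension L (single L x) v \<otimes> (if x = y then \<one> else \<zero>)"
    by (rule linear_extension_mult_right[OF v]) (simp_all add: single_def)
  also have "linear_extension L (single L x) v = v x"
    by (rule linear_extension_single_left[OF v])
  finally show "tensor_coeff L (finsum F ?s (I \<times> I)) x y = (if x = y then v x else \<zero>)"
    using free_module_closed[OF v] by simp
qed

context
  fixes K' :: "'a set" and M' :: "'k set" and A :: "('a, 'k \<Rightarrow> 'a, 'f) module_scheme"
    and I' :: "'j set" and w' h' and f :: "('m \<Rightarrow> 'a) \<Rightarrow> 'k \<Rightarrow> 'a"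
  assumes A: "framed_module L K' M' A I' w' h'" and K': "K \<subseteq> K'"
    and f_closed: "f \<in> carrier V \<rightarrow> carrier A"
    and f_add: "\<And>v v'. \<lbrakk>v \<in> carrier V; v' \<in> carrier V\<rbrakk> \<Longrightarrow> f (v \<oplus>\<^bsub>V\<^esub> v') = f v \<oplus>\<^bsub>A\<^esub> f v'"
    and f_smult: "\<And>c v. \<lbrakk>c \<in> K; v \<in> carrier V\<rbrakk> \<Longrightarrow> f (c \<odot>\<^bsub>V\<^esub> v) = c \<odot>\<^bsub>A\<^esub> f v"
begin

interpretation A: framed_module L K' M' A I' w' h' by (rule A)

lemma bilinear_form_map: "bilinear_form (\<lambda>(a, b). f a x \<otimes> f b y)"
  using A.V_closed[OF Pi_mem[OF f_closed]] K_closed f_add f_smult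
  by (auto simp: bilinear_form_def A.V_ops l_distr r_distr m_assoc m_lcomm)

lemma free_map_tensor:
  assumes u: "u \<in> carrier F"
  shows free_map_tensor_closed: "free_map A.R (map_prod f f) u \<in> carrier A.F"
    and tensor_coeff_free_map: "tensor_coeff L (free_map A.R (map_prod f f) u) x y
      = linear_extension L (\<lambda>(a, b). f a x \<otimes> f b y) u"
proof -
  have f: "map_prod f f \<in> carrier V \<times> carrier V \<rightarrow> carrier A \<times> carrier A"
    using f_closed by (auto simp: Pi_iff)
  have u': "u \<in> carrier (free_module A.R (carrier V \<times> carrier V))"
    using u K' by (auto simp: free_module_def)
  show "free_map A.R (map_prod f f) u \<in> carrier A.F"
    by (rule A.V.free_map_closed[OF u' f])
  have "tensor_coeff L (free_map A.R (map_prod f f) u) x y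
      = linear_extension L (\<lambda>ab. (\<lambda>(a, b). a x \<otimes> b y) (map_prod f f ab)) u"
    unfolding tensor_coeff_def free_map_subring[OF A.K_subring u']
    by (rule linear_extension_free_map[OF F_free_module[OF u] f]) (use A.V_closed in auto)
  then show "tensor_coeff L (free_map A.R (map_prod f f) u) x y
      = linear_extension L (\<lambda>(a, b). f a x \<otimes> f b y) u"
    by (simp add: split_def)
qed

lemma tensor_map_tensor_class:
  assumes u: "u \<in> carrier F"
  shows "tensor_map A.R A A f f (tensor_class R V V u)
    = tensor_class A.R A A (free_map A.R (map_prod f f) u)"
proof -
  have "tensor_class A.R A A (free_map A.R (map_prod f f) u')
      = tensor_class A.R A A (free_map A.R (map_prod f f) u)"
    if "u' \<in> tensor_class R V V u" for u'
  proof -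
    have u': "u' \<in> carrier F" "tensor_class R V V u' = tensor_class R V V u"
      using that mem_tensor_class_iff_eq[OF u] by auto
    show ?thesis
      unfolding A.tensor_class_eq_iff[OF free_map_tensor_closed[OF u'(1)] free_map_tensor_closed[OF u]]
        tensor_coeff_free_map[OF u] tensor_coeff_free_map[OF u'(1)]
      using linear_extension_tensor_class[OF bilinear_form_map u'(1) u u'(2)] by blast
  qed
  moreover have "u \<in> tensor_class R V V u" using mem_tensor_class_iff_eq[OF u] u by blast
  ultimately show ?thesis unfolding tensor_map_def by blast
qed

end

text \<open>
  The definite description in \<open>comult (descent_hopf L K M)\<close> denotes an actual tensor; already
  \<open>H\<^sub>r \<cong> H\<^sub>r\<close> depends on this.
\<close>

lemma the_tensor_with_image:
  assumes A: "framed_module L (carrier L) M A I' w' h'" and VA: "carrier V \<subseteq> carrier A"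
    and u: "u \<in> carrier F" and u': "u' \<in> carrier (free_module L (carrier A \<times> carrier A))"
    and eq: "\<And>x y. \<lbrakk>x \<in> M; y \<in> M\<rbrakk> \<Longrightarrow> tensor_coeff L u x y = tensor_coeff L u' x y"
  shows "(THE t. t \<in> tensor_carrier R V V \<and> tensor_map L A A (\<lambda>a. a) (\<lambda>a. a) t = tensor_class L A A u')
    = tensor_class R V V u"
proof -
  interpret A: framed_module L "carrier L" M A I' w' h' by (rule A)
  have AR: "A.R = L" by simp
  have "tensor_map L A A (\<lambda>a. a) (\<lambda>a. a) (tensor_class R V V t) = tensor_class L A A u'
      \<longleftrightarrow> tensor_class R V V t = tensor_class R V V u" if t: "t \<in> carrier F" for t
  proof -
    have "tensor_map L A A (\<lambda>a. a) (\<lambda>a. a) (tensor_class R V V t)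
          = tensor_class L A A (free_map L (map_prod (\<lambda>a. a) (\<lambda>a. a)) t)"
      and "tensor_coeff L (free_map L (map_prod (\<lambda>a. a) (\<lambda>a. a)) t) x y = tensor_coeff L t x y"
      and "free_map L (map_prod (\<lambda>a. a) (\<lambda>a. a)) t \<in> carrier (free_module L (carrier A \<times> carrier A))" for x y
      using tensor_map_tensor_class[OF A _ _ _ _ t, of "\<lambda>a. a"]
        tensor_coeff_free_map[OF A _ _ _ _ t, of "\<lambda>a. a" x y]
        free_map_tensor_closed[OF A _ _ _ _ t, of "\<lambda>a. a"] VA K_closed
      by (auto simp: AR V_ops A.V_ops tensor_coeff_def)
    then show ?thesis
      using A.tensor_class_eq_iff[unfolded AR, OF _ u'] tensor_class_eq_iff[OF t u] eq by simp
  qed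
  then show ?thesis
    using u by (intro the_equality) (auto simp: tensor_carrier_def)
qed

end

section \<open>Galois descent of functions on a finite set\<close>

locale galois_set = galois_descent L G K
  for L :: "('a, 'l) ring_scheme" (structure) and G :: "('a \<Rightarrow> 'a) monoid" and K :: "'a set" +
  fixes M :: "'m set" and act :: "('a \<Rightarrow> 'a) \<Rightarrow> 'm \<Rightarrow> 'm"
  assumes finite_G: "finite (carrier G)" and finite_M: "finite M"
    and act_closed: "\<lbrakk>g \<in> carrier G; m \<in> M\<rbrakk> \<Longrightarrow> act g m \<in> M"
    and act_one: "m \<in> M \<Longrightarrow> act \<one>\<^bsub>G\<^esub> m = m"
    and act_mult: "\<lbrakk>g \<in> carrier G; h \<in> carrier G; m \<in> M\<rbrakk> \<Longrightarrow> act (g \<otimes>\<^bsub>G\<^esub> h) m = act g (act h m)"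
begin

lemma act_inv [simp]:
  assumes "g \<in> carrier G" "m \<in> M"
  shows "act (inv\<^bsub>G\<^esub> g) (act g m) = m" "act g (act (inv\<^bsub>G\<^esub> g) m) = m"
  using assms act_mult[of "inv\<^bsub>G\<^esub> g" g m] act_mult[of g "inv\<^bsub>G\<^esub> g" m] act_one[of m] by simp_all

lemma bij_act: "g \<in> carrier G \<Longrightarrow> bij_betw (act g) M M"
  by (rule bij_betw_byWitness[of _ "act (inv\<^bsub>G\<^esub> g)"]) (auto simp: act_closed)

lemma act_eq_iff: "\<lbrakk>g \<in> carrier G; m \<in> M; x \<in> M\<rbrakk> \<Longrightarrow> act g m = act g x \<longleftrightarrow> m = x"
  using bij_act[of g] by (auto simp: bij_betw_def inj_on_def)

definition invariants :: "('m \<Rightarrow> 'a) set" where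
  "invariants = {a \<in> carrier (free_module L M). \<forall>g\<in>carrier G. \<forall>m\<in>M. a (act g m) = g (a m)}"

lemma invariants_free_module: "a \<in> invariants \<Longrightarrow> a \<in> carrier (free_module L M)"
  by (simp add: invariants_def)

lemma invariants_closed: "a \<in> invariants \<Longrightarrow> a m \<in> carrier L"
  using free_module_closed[OF invariants_free_module] .

lemma invariants_outside: "\<lbrakk>a \<in> invariants; m \<notin> M\<rbrakk> \<Longrightarrow> a m = \<zero>"
  using free_module_outside[OF invariants_free_module] .

lemma invariants_act: "\<lbrakk>a \<in> invariants; g \<in> carrier G; m \<in> M\<rbrakk> \<Longrightarrow> a (act g m) = g (a m)"
  by (simp add: invariants_def)

lemma invariantsI:
  assumes "\<And>m. m \<in> M \<Longrightarrow> a m \<in> carrier L" "\<And>m. m \<notin> M \<Longrightarrow> a m = \<zero>"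
    "\<And>g m. \<lbrakk>g \<in> carrier G; m \<in> M\<rbrakk> \<Longrightarrow> a (act g m) = g (a m)"
  shows "a \<in> invariants"
  using assms free_module_finiteI[OF finite_M] by (simp add: invariants_def)

lemma invariants_times:
  assumes "a \<in> invariants" "b \<in> invariants"
  shows "(\<lambda>m. a m \<otimes> b m) \<in> invariants"
  by (rule invariantsI)
    (simp_all add: invariants_closed[OF assms(1)] invariants_closed[OF assms(2)]
      invariants_outside[OF assms(1)] invariants_act[OF assms(1)] invariants_act[OF assms(2)])

lemma aut_linear_extension:
  assumes a: "a \<in> invariants" and g: "g \<in> carrier G" and e: "e \<in> M \<rightarrow> carrier L"
  shows "g (linear_extension L e a) = linear_extension L (\<lambda>m. g (e (act (inv\<^bsub>G\<^esub> g) m))) a"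
proof -
  note aL = invariants_closed[OF a] and aM = invariants_free_module[OF a]
  have em: "e m \<in> carrier L" "e (act (inv\<^bsub>G\<^esub> g) m) \<in> carrier L" if "m \<in> M" for m
    using e act_closed that g by auto
  have "g (linear_extension L e a) = (\<Oplus>m\<in>M. g (a m \<otimes> e m))"
    unfolding linear_extension_finite[OF aM finite_M e] using g aL em by (intro aut_finsum) auto
  also have "\<dots> = (\<Oplus>m\<in>M. a (act g m) \<otimes> g (e (act (inv\<^bsub>G\<^esub> g) (act g m))))"
    using g aL em invariants_act[OF a g] by (intro finsum_cong') auto
  also have "\<dots> = (\<Oplus>m\<in>M. a m \<otimes> g (e (act (inv\<^bsub>G\<^esub> g) m)))"
    using g aL em by (intro finsum_reindex_bij[OF bij_act[OF g], symmetric]) auto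
  also have "\<dots> = linear_extension L (\<lambda>m. g (e (act (inv\<^bsub>G\<^esub> g) m))) a"
    using g em by (intro linear_extension_finite[OF aM finite_M, symmetric]) auto
  finally show ?thesis .
qed

lemma linear_extension_invariants_in_K:
  assumes a: "a \<in> invariants" and b: "b \<in> invariants"
  shows "linear_extension L b a \<in> K"
proof (rule fixed_K)
  have bM: "b \<in> M \<rightarrow> carrier L" using invariants_closed[OF b] by blast
  then show "linear_extension L b a \<in> carrier L"
    by (rule linear_extension_closed[OF _ invariants_free_module[OF a]])
  fix g assume g: "g \<in> carrier G"
  have "g (linear_extension L b a) = linear_extension L (\<lambda>m. g (b (act (inv\<^bsub>G\<^esub> g) m))) a"
    by (rule aut_linear_extension[OF a g bM])
  also have "\<dots> = linear_extension L b a"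
  proof (rule linear_extension_cong[OF invariants_free_module[OF a] bM])
    fix m assume m: "m \<in> M"
    then have "act (inv\<^bsub>G\<^esub> g) m \<in> M" using g act_closed by simp
    from invariants_act[OF b g this] show "g (b (act (inv\<^bsub>G\<^esub> g) m)) = b m" using g m by simp
  qed
  finally show "g (linear_extension L b a) = linear_extension L b a" .
qed

definition orbit_sum :: "'a \<Rightarrow> 'm \<Rightarrow> 'm \<Rightarrow> 'a" where
  "orbit_sum l m x = (\<Oplus>g\<in>carrier G. single L x (act g m) \<otimes> g l)"

lemma orbit_sum_closed: "l \<in> carrier L \<Longrightarrow> orbit_sum l m x \<in> carrier L"
  unfolding orbit_sum_def by (intro finsum_closed) auto

lemma orbit_sum_invariant:
  assumes l: "l \<in> carrier L" and m: "m \<in> M"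
  shows "orbit_sum l m \<in> invariants"
proof (rule invariantsI)
  show "orbit_sum l m x \<in> carrier L" for x by (rule orbit_sum_closed[OF l])
  show "orbit_sum l m x = \<zero>" if "x \<notin> M" for x
    unfolding orbit_sum_def using l m that act_closed by (intro add.finprod_one_eqI) (auto simp: single_def)
  fix k x assume k: "k \<in> carrier G" and x: "x \<in> M"
  have "orbit_sum l m (act k x) = (\<Oplus>g\<in>carrier G. single L (act k x) (act (k \<otimes>\<^bsub>G\<^esub> g) m) \<otimes> (k \<otimes>\<^bsub>G\<^esub> g) l)"
    unfolding orbit_sum_def using l by (intro finsum_reindex_bij[OF bij_left_mult[OF k]]) auto
  also have "\<dots> = (\<Oplus>g\<in>carrier G. k (single L x (act g m) \<otimes> g l))"
    using k l m x act_closed by (intro finsum_cong') (auto simp: act_mult aut_mult single_def act_eq_iff)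
  also have "\<dots> = k (orbit_sum l m x)"
    unfolding orbit_sum_def using k l by (intro aut_finsum[symmetric]) auto
  finally show "orbit_sum l m (act k x) = k (orbit_sum l m x)" .
qed

context
  fixes n :: nat and l l' and t
  assumes l: "l \<in> {..<n} \<rightarrow> carrier L" "l' \<in> {..<n} \<rightarrow> carrier L"
    and dual: "\<And>g h. \<lbrakk>g \<in> carrier G; h \<in> carrier G\<rbrakk> \<Longrightarrow>
       (\<Oplus>i\<in>{..<n}. g (l' i) \<otimes> h (l i)) = (if g = h then \<one> else \<zero>)"
    and t: "t \<in> carrier L" "trace t = \<one>"
begin

lemma sum_orbit_sum_products:
  "(\<Oplus>j\<in>{..<n}. orbit_sum (l' j \<otimes> t) m x \<otimes> orbit_sum (l j) m y)
    = (\<Oplus>g\<in>carrier G. single L x (act g m) \<otimes> single L y (act g m) \<otimes> g t)"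
proof -
  let ?G2 = "carrier G \<times> carrier G"
  let ?X = "\<lambda>g. single L x (act g m)" and ?Y = "\<lambda>g. single L y (act g m)"
  have lj: "l j \<in> carrier L" "l' j \<in> carrier L" if "j < n" for j
    using l that by auto
  have "(\<Oplus>j\<in>{..<n}. orbit_sum (l' j \<otimes> t) m x \<otimes> orbit_sum (l j) m y)
      = (\<Oplus>j\<in>{..<n}. \<Oplus>gk\<in>?G2. (?X (fst gk) \<otimes> (fst gk) (l' j \<otimes> t)) \<otimes> (?Y (snd gk) \<otimes> (snd gk) (l j)))"
    unfolding orbit_sum_def using lj t finite_G
    by (intro finsum_cong' refl finsum_product) (auto intro!: finsum_closed)
  also have "\<dots> = (\<Oplus>gk\<in>?G2. \<Oplus>j\<in>{..<n}. (?X (fst gk) \<otimes> (fst gk) (l' j \<otimes> t)) \<otimes> (?Y (snd gk) \<otimes> (snd gk) (l j)))"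
    using lj t finite_G by (intro finsum_swap) auto
  also have "\<dots> = (\<Oplus>gk\<in>?G2. if snd gk = fst gk then ?X (fst gk) \<otimes> ?Y (fst gk) \<otimes> (fst gk) t else \<zero>)"
  proof (rule finsum_cong'[OF refl])
    fix gk assume "gk \<in> ?G2"
    then obtain g k where gk: "gk = (g, k)" and g: "g \<in> carrier G" and k: "k \<in> carrier G" by auto
    have "(\<Oplus>j\<in>{..<n}. (?X g \<otimes> g (l' j \<otimes> t)) \<otimes> (?Y k \<otimes> k (l j)))
        = (\<Oplus>j\<in>{..<n}. (?X g \<otimes> ?Y k \<otimes> g t) \<otimes> (g (l' j) \<otimes> k (l j)))"
      using lj t g k by (intro finsum_cong') (auto simp: m_ac)
    also have "\<dots> = (?X g \<otimes> ?Y k \<otimes> g t) \<otimes> (\<Oplus>j\<in>{..<n}. g (l' j) \<otimes> k (l j))"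
      using lj t g k by (intro finsum_rdistr[symmetric]) auto
    finally show "(\<Oplus>j\<in>{..<n}. (?X (fst gk) \<otimes> (fst gk) (l' j \<otimes> t)) \<otimes> (?Y (snd gk) \<otimes> (snd gk) (l j)))
        = (if snd gk = fst gk then ?X (fst gk) \<otimes> ?Y (fst gk) \<otimes> (fst gk) t else \<zero>)"
      using dual[OF g k] g k t unfolding gk by auto
  qed (use t in auto)
  also have "\<dots> = (\<Oplus>g\<in>carrier G. ?X g \<otimes> ?Y g \<otimes> g t)"
    using t finite_G by (subst finsum_Times) (auto simp: finsum_delta intro!: finsum_cong' cong: if_cong)
  finally show ?thesis .
qed

lemma orbit_sum_frame:
  assumes x: "x \<in> M" and y: "y \<in> M"
  shows "(\<Oplus>mj\<in>M \<times> {..<n}. orbit_sum (l' (snd mj) \<otimes> t) (fst mj) x \<otimes> orbit_sum (l (snd mj)) (fst mj) y)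
    = (if x = y then \<one> else \<zero>)"
proof -
  let ?\<delta> = "\<lambda>m. single L x m \<otimes> single L y m"
  have "(\<Oplus>mj\<in>M \<times> {..<n}. orbit_sum (l' (snd mj) \<otimes> t) (fst mj) x \<otimes> orbit_sum (l (snd mj)) (fst mj) y)
      = (\<Oplus>m\<in>M. \<Oplus>j\<in>{..<n}. orbit_sum (l' j \<otimes> t) m x \<otimes> orbit_sum (l j) m y)"
    using l t finite_M by (subst finsum_Times) (auto simp: Pi_iff intro!: orbit_sum_closed)
  also have "\<dots> = (\<Oplus>m\<in>M. \<Oplus>g\<in>carrier G. ?\<delta> (act g m) \<otimes> g t)"
    unfolding sum_orbit_sum_products ..
  also have "\<dots> = (\<Oplus>g\<in>carrier G. \<Oplus>m\<in>M. ?\<delta> (act g m) \<otimes> g t)"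
    using t finite_G finite_M by (intro finsum_swap) auto
  also have "\<dots> = (\<Oplus>g\<in>carrier G. (if x = y then \<one> else \<zero>) \<otimes> g t)"
  proof (rule finsum_cong'[OF refl])
    fix g assume g: "g \<in> carrier G"
    have "(\<Oplus>m\<in>M. ?\<delta> (act g m) \<otimes> g t) = (\<Oplus>m\<in>M. ?\<delta> m \<otimes> g t)"
      using g t by (intro finsum_reindex_bij[OF bij_act[OF g], symmetric]) auto
    also have "\<dots> = (\<Oplus>m\<in>M. if m = x then (if x = y then \<one> else \<zero>) \<otimes> g t else \<zero>)"
      using g t by (intro finsum_cong') (auto simp: single_def)
    also have "\<dots> = (if x = y then \<one> else \<zero>) \<otimes> g t"
      using g t x finite_M by (intro finsum_delta) auto
    finally show "(\<Oplus>m\<in>M. ?\<delta> (act g m) \<otimes> g t) = (if x = y then \<one> else \<zero>) \<otimes> g t" .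
  qed (use t in auto)
  also have "\<dots> = (if x = y then \<one> else \<zero>) \<otimes> trace t"
    unfolding trace_def using t finite_G by (intro finsum_rdistr[symmetric]) auto
  finally show ?thesis using t by simp
qed

end

lemma exists_framed_module:
  fixes V :: "('a, 'm \<Rightarrow> 'a, 'e) module_scheme"
  assumes V: "carrier V = invariants" "\<zero>\<^bsub>V\<^esub> = (\<lambda>_. \<zero>)" "\<And>v v'. v \<oplus>\<^bsub>V\<^esub> v' = (\<lambda>m. v m \<oplus> v' m)"
      "\<And>c v. c \<odot>\<^bsub>V\<^esub> v = (\<lambda>m. c \<otimes> v m)"
  obtains I :: "('m \<times> nat) set" and w h where "framed_module L K M V I w h" "w \<in> I \<rightarrow> invariants"
proof -
  obtain n :: nat and l l' where l: "l \<in> {..<n} \<rightarrow> carrier L" "l' \<in> {..<n} \<rightarrow> carrier L"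
    and dual: "\<And>g h. \<lbrakk>g \<in> carrier G; h \<in> carrier G\<rbrakk> \<Longrightarrow>
       (\<Oplus>i\<in>{..<n}. g (l' i) \<otimes> h (l i)) = (if g = h then \<one> else \<zero>)"
    by (rule exists_dual_family[OF finite_G]) blast
  obtain t where t: "t \<in> carrier L" "trace t = \<one>"
    by (rule exists_trace_one[OF finite_G])
  let ?I = "M \<times> {..<n}"
    and ?w = "\<lambda>mj. orbit_sum (l' (snd mj) \<otimes> t) (fst mj)" and ?h = "\<lambda>mj. orbit_sum (l (snd mj)) (fst mj)"
  have w: "?w \<in> ?I \<rightarrow> invariants" and h: "?h \<in> ?I \<rightarrow> invariants"
    using l t by (auto simp: Pi_iff intro!: orbit_sum_invariant)
  have "framed_module L K M V ?I ?w ?h"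
  proof (intro framed_module.intro framed_module_axioms.intro cring_axioms K_subring finite_M V(2-4))
    show "carrier V \<subseteq> carrier (free_module L M)" using V(1) invariants_free_module by blast
    show "(\<lambda>_. \<zero>) \<in> carrier V" unfolding V(1) by (rule invariantsI) simp_all
    show "(\<lambda>m. v m \<oplus> v' m) \<in> carrier V" if "v \<in> carrier V" "v' \<in> carrier V" for v v'
      using that unfolding V(1)
      by (intro invariantsI) (simp_all add: invariants_closed invariants_outside invariants_act)
    show "(\<lambda>m. c \<otimes> v m) \<in> carrier V" if "c \<in> K" "v \<in> carrier V" for c v
      using that K_subset unfolding V(1)
      by (intro invariantsI) (auto simp: invariants_closed invariants_outside invariants_act K_fixed)
    show "?w i \<in> M \<rightarrow> carrier L" "?h i \<in> carrier V" if "i \<in> ?I" for i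
      using Pi_mem[OF w that] Pi_mem[OF h that] V(1) invariants_closed by auto
    show "linear_extension L (?w i) v \<in> K" if "i \<in> ?I" "v \<in> carrier V" for i v
      using linear_extension_invariants_in_K[OF _ Pi_mem[OF w that(1)]] that(2) V(1) by blast
    show "(\<Oplus>i\<in>?I. ?w i x \<otimes> ?h i y) = (if x = y then \<one> else \<zero>)" if "x \<in> M" "y \<in> M" for x y
      by (rule orbit_sum_frame[OF l dual t that])
  qed (use finite_M in simp)
  then show ?thesis using w by (rule that)
qed

text \<open>The \<open>L\<close>-span of \<open>L[M]\<^sup>G\<close> is \<open>L[M]\<close>.\<close>

lemma invariants_separate:
  assumes p: "p \<in> M \<rightarrow> carrier L" and q: "q \<in> M \<rightarrow> carrier L"
    and eq: "\<And>a. a \<in> invariants \<Longrightarrow> linear_extension L p a = linear_extension L q a" and x: "x \<in> M"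
  shows "p x = q x"
proof -
  let ?V = "(free_module L M)\<lparr>carrier := invariants\<rparr>"
  obtain I :: "('m \<times> nat) set" and w h where "framed_module L K M ?V I w h"
    by (rule exists_framed_module[of ?V]) (simp_all add: free_module_sel)
  then interpret V: framed_module L K M ?V I w h .
  show ?thesis by (rule V.frame_separates[OF p q _ x]) (simp add: eq)
qed

end

section \<open>Group algebras and group-like elements\<close>

lemma group_algebra_mult:
  "a \<otimes>\<^bsub>group_algebra R M\<^esub> b = free_map R (\<lambda>(x, y). x \<otimes>\<^bsub>M\<^esub> y) (\<lambda>(x, y). a x \<otimes>\<^bsub>R\<^esub> b y)"
  by (simp add: group_algebra_def)

context cring begin

context
  fixes M :: "('m, 's) monoid_scheme" and a b
  assumes mult_closed: "\<And>x y. \<lbrakk>x \<in> carrier M; y \<in> carrier M\<rbrakk> \<Longrightarrow> x \<otimes>\<^bsub>M\<^esub> y \<in> carrier M"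
    and a: "a \<in> carrier (free_module R (carrier M))" and b: "b \<in> carrier (free_module R (carrier M))"
begin

lemma group_algebra_mult_closed: "a \<otimes>\<^bsub>group_algebra R M\<^esub> b \<in> carrier (free_module R (carrier M))"
  unfolding group_algebra_mult
  by (rule free_map_closed[OF free_module_product_closed[OF a b]]) (use mult_closed in auto)

lemma linear_extension_group_algebra_mult:
  assumes e: "e \<in> carrier M \<rightarrow> carrier R"
  shows "linear_extension R e (a \<otimes>\<^bsub>group_algebra R M\<^esub> b)
    = linear_extension R (\<lambda>x. linear_extension R (\<lambda>y. e (x \<otimes>\<^bsub>M\<^esub> y)) b) a"
proof -
  have "linear_extension R e (a \<otimes>\<^bsub>group_algebra R M\<^esub> b)
      = linear_extension R (\<lambda>xy. e ((\<lambda>(x, y). x \<otimes>\<^bsub>M\<^esub> y) xy)) (\<lambda>(x, y). a x \<otimes> b y)"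
    unfolding group_algebra_mult
    by (rule linear_extension_free_map[OF free_module_product_closed[OF a b] _ e]) (use mult_closed in auto)
  also have "\<dots> = linear_extension R (\<lambda>x. linear_extension R (\<lambda>y. e (x \<otimes>\<^bsub>M\<^esub> y)) b) a"
    using e mult_closed by (subst linear_extension_product[OF a b]) auto
  finally show ?thesis .
qed

end

end

lemma (in domain) orthogonal_idempotents_sum_one:
  assumes Z: "finite Z" and r: "r \<in> Z \<rightarrow> carrier R"
    and orthogonal: "\<And>x y. \<lbrakk>x \<in> Z; y \<in> Z\<rbrakk> \<Longrightarrow> r x \<otimes> r y = (if x = y then r x else \<zero>)"
    and sum: "(\<Oplus>x\<in>Z. r x) = \<one>"
  obtains z where "z \<in> Z" "\<And>x. x \<in> Z \<Longrightarrow> r x = (if x = z then \<one> else \<zero>)"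
proof -
  have "\<exists>z\<in>Z. r z \<noteq> \<zero>"
  proof (rule ccontr)
    assume "\<not> ?thesis"
    then have "(\<Oplus>x\<in>Z. r x) = \<zero>" by (intro add.finprod_one_eqI) auto
    then show False using sum by simp
  qed
  then obtain z where z: "z \<in> Z" "r z \<noteq> \<zero>" by blast
  have rz: "r z \<in> carrier R" using r z(1) by blast
  have "r z \<otimes> r z = r z \<otimes> \<one>" using orthogonal[OF z(1) z(1)] rz by simp
  then have one: "r z = \<one>"
    using m_lcancel[OF z(2) rz rz one_closed] by simp
  have "r x = (if x = z then \<one> else \<zero>)" if x: "x \<in> Z" for x
    using orthogonal[OF z(1) x] one r x by (auto simp: Pi_iff)
  with z(1) show ?thesis by (rule that)
qed

locale galois_monoid = galois_set L G K "carrier M" act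
  for L :: "('a, 'l) ring_scheme" (structure) and G :: "('a \<Rightarrow> 'a) monoid" and K :: "'a set"
    and M :: "('m, 's) monoid_scheme" and act :: "('a \<Rightarrow> 'a) \<Rightarrow> 'm \<Rightarrow> 'm" +
  assumes M_mult_closed: "\<lbrakk>x \<in> carrier M; y \<in> carrier M\<rbrakk> \<Longrightarrow> x \<otimes>\<^bsub>M\<^esub> y \<in> carrier M"
    and act_distrib: "\<lbrakk>g \<in> carrier G; x \<in> carrier M; y \<in> carrier M\<rbrakk>
      \<Longrightarrow> act g (x \<otimes>\<^bsub>M\<^esub> y) = act g x \<otimes>\<^bsub>M\<^esub> act g y"
begin

lemma single_act:
  "\<lbrakk>g \<in> carrier G; x \<in> carrier M; z \<in> carrier M\<rbrakk> \<Longrightarrow> single L z (act (inv\<^bsub>G\<^esub> g) x) = single L (act g z) x"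
  by (auto simp: single_def)

lemma aut_coeff_row:
  assumes b: "b \<in> invariants" and g: "g \<in> carrier G" and x: "x \<in> carrier M" and z: "z \<in> carrier M"
  shows "g (linear_extension L (\<lambda>y. single L z (act (inv\<^bsub>G\<^esub> g) x \<otimes>\<^bsub>M\<^esub> y)) b)
    = linear_extension L (\<lambda>y. single L (act g z) (x \<otimes>\<^bsub>M\<^esub> y)) b"
proof -
  let ?i = "act (inv\<^bsub>G\<^esub> g)"
  have "g (linear_extension L (\<lambda>y. single L z (?i x \<otimes>\<^bsub>M\<^esub> y)) b)
      = linear_extension L (\<lambda>y. g (single L z (?i x \<otimes>\<^bsub>M\<^esub> ?i y))) b"
    by (rule aut_linear_extension[OF b g]) simp
  also have "\<dots> = linear_extension L (\<lambda>y. single L (act g z) (x \<otimes>\<^bsub>M\<^esub> y)) b"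
  proof (rule linear_extension_cong[OF invariants_free_module[OF b]])
    fix y assume y: "y \<in> carrier M"
    have "?i x \<otimes>\<^bsub>M\<^esub> ?i y = ?i (x \<otimes>\<^bsub>M\<^esub> y)" using act_distrib g x y by simp
    then have "single L z (?i x \<otimes>\<^bsub>M\<^esub> ?i y) = single L (act g z) (x \<otimes>\<^bsub>M\<^esub> y)"
      using single_act[OF g M_mult_closed[OF x y] z] by simp
    then show "g (single L z (?i x \<otimes>\<^bsub>M\<^esub> ?i y)) = single L (act g z) (x \<otimes>\<^bsub>M\<^esub> y)"
      using g by (simp add: single_def)
  qed simp
  finally show ?thesis .
qed

lemma invariants_mult:
  assumes a: "a \<in> invariants" and b: "b \<in> invariants"
  shows "a \<otimes>\<^bsub>group_algebra L M\<^esub> b \<in> invariants"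
proof -
  note aM = invariants_free_module[OF a] and bM = invariants_free_module[OF b]
  let ?c = "a \<otimes>\<^bsub>group_algebra L M\<^esub> b"
  let ?row = "\<lambda>z x. linear_extension L (\<lambda>y. single L z (x \<otimes>\<^bsub>M\<^esub> y)) b"
  have c: "?c \<in> carrier (free_module L (carrier M))"
    by (rule group_algebra_mult_closed[OF M_mult_closed aM bM])
  have coeff: "?c z = linear_extension L (?row z) a" for z
    using linear_extension_group_algebra_mult[OF M_mult_closed aM bM, of "single L z"]
    by (simp add: linear_extension_single_left[OF c])
  have row: "?row z x \<in> carrier L" for x z
    by (rule linear_extension_closed[OF _ bM]) simp
  have "?c (act g z) = g (?c z)" if g: "g \<in> carrier G" and z: "z \<in> carrier M" for g z
  proof -
    have "g (?c z) = linear_extension L (\<lambda>x. g (?row z (act (inv\<^bsub>G\<^esub> g) x))) a"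
      unfolding coeff using row by (intro aut_linear_extension[OF a g]) auto
    also have "\<dots> = ?c (act g z)"
      unfolding coeff using row aut_coeff_row[OF b g _ z] by (intro linear_extension_cong[OF aM]) auto
    finally show ?thesis by simp
  qed
  with c show ?thesis by (simp add: invariants_def)
qed

end

text \<open>
  The comultiplication of \<open>L[M]\<^sup>G\<close> enters through formal tensors \<open>u\<close> over \<open>L[M]\<^sup>G\<close> with image
  \<open>\<Sum> a\<^sub>m (m \<otimes> m)\<close> in \<open>L[M] \<otimes> L[M]\<close>.
\<close>

locale descended_bialgebra_epi =
  A: galois_monoid L G K M act + B: galois_monoid L G K M' act'
  for L :: "('a, 'l) ring_scheme" (structure) and G :: "('a \<Rightarrow> 'a) monoid" and K :: "'a set"
    and M :: "('m, 's) monoid_scheme" and act :: "('a \<Rightarrow> 'a) \<Rightarrow> 'm \<Rightarrow> 'm"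
    and M' :: "('k, 't) monoid_scheme" and act' :: "('a \<Rightarrow> 'a) \<Rightarrow> 'k \<Rightarrow> 'k" +
  fixes f :: "('m \<Rightarrow> 'a) \<Rightarrow> 'k \<Rightarrow> 'a"
  assumes f_image: "f ` A.invariants = B.invariants"
    and f_add: "\<lbrakk>a \<in> A.invariants; b \<in> A.invariants\<rbrakk> \<Longrightarrow> f (\<lambda>m. a m \<oplus> b m) = (\<lambda>m. f a m \<oplus> f b m)"
    and f_smult: "\<lbrakk>c \<in> K; a \<in> A.invariants\<rbrakk> \<Longrightarrow> f (\<lambda>m. c \<otimes> a m) = (\<lambda>m. c \<otimes> f a m)"
    and f_mult: "\<lbrakk>a \<in> A.invariants; b \<in> A.invariants\<rbrakk>
      \<Longrightarrow> f (a \<otimes>\<^bsub>group_algebra L M\<^esub> b) = f a \<otimes>\<^bsub>group_algebra L M'\<^esub> f b"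
    and f_counit: "a \<in> A.invariants \<Longrightarrow> linear_extension L (\<lambda>_. \<one>) (f a) = linear_extension L (\<lambda>_. \<one>) a"
    and f_comult: "a \<in> A.invariants \<Longrightarrow>
      \<exists>u\<in>carrier (free_module L (A.invariants \<times> A.invariants)).
        (\<forall>m\<in>carrier M. \<forall>k\<in>carrier M. tensor_coeff L u m k = (if m = k then a m else \<zero>)) \<and>
        (\<forall>x\<in>carrier M'. \<forall>y\<in>carrier M'.
          linear_extension L (\<lambda>(b, c). f b x \<otimes> f c y) u = (if x = y then f a x else \<zero>))"
begin

lemma f_invariant: "a \<in> A.invariants \<Longrightarrow> f a \<in> B.invariants"
  using f_image by blast

lemma f_closed: "a \<in> A.invariants \<Longrightarrow> f a x \<in> carrier L"
  using B.invariants_closed[OF f_invariant] .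

lemma exists_matrix:
  obtains \<Phi> where "\<And>x. (\<lambda>m. \<Phi> m x) \<in> carrier M \<rightarrow> carrier L"
    "\<And>a x. a \<in> A.invariants \<Longrightarrow> f a x = linear_extension L (\<lambda>m. \<Phi> m x) a"
proof -
  let ?V = "(free_module L (carrier M))\<lparr>carrier := A.invariants\<rparr>"
  obtain I :: "('m \<times> nat) set" and w h where "framed_module L K (carrier M) ?V I w h"
    by (rule A.exists_framed_module[of ?V]) (simp_all add: free_module_sel)
  then interpret V: framed_module L K "carrier M" ?V I w h .
  have h: "h i \<in> A.invariants" if "i \<in> I" for i using V.h_closed[OF that] by simp
  show ?thesis
  proof (rule that[of "\<lambda>m x. \<Oplus>i\<in>I. w i m \<otimes> f (h i) x"])
    show "(\<lambda>m. \<Oplus>i\<in>I. w i m \<otimes> f (h i) x) \<in> carrier M \<rightarrow> carrier L" for x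
      using Pi_mem[OF V.w_closed] f_closed[OF h] by (intro Pi_I A.finsum_closed A.m_closed)
    show "f a x = linear_extension L (\<lambda>m. \<Oplus>i\<in>I. w i m \<otimes> f (h i) x) a" if "a \<in> A.invariants" for a x
      by (rule V.linear_functional_repr[of "\<lambda>v. f v x" a])
        (use that in \<open>simp_all add: free_module_sel f_closed f_add f_smult\<close>)
  qed
qed

context
  fixes \<Phi> assumes \<Phi>_closed: "\<And>x. (\<lambda>m. \<Phi> m x) \<in> carrier M \<rightarrow> carrier L"
    and \<Phi>: "\<And>a x. a \<in> A.invariants \<Longrightarrow> f a x = linear_extension L (\<lambda>m. \<Phi> m x) a"
begin

lemma matrix_row_orthogonal:
  assumes m: "m \<in> carrier M" and x: "x \<in> carrier M'" and y: "y \<in> carrier M'"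
  shows "\<Phi> m x \<otimes> \<Phi> m y = (if x = y then \<Phi> m x else \<zero>)"
proof (rule A.invariants_separate[of "\<lambda>m. \<Phi> m x \<otimes> \<Phi> m y" "\<lambda>m. if x = y then \<Phi> m x else \<zero>", OF _ _ _ m])
  have \<Phi>L: "\<Phi> m z \<in> carrier L" if "m \<in> carrier M" for m z using \<Phi>_closed[of z] that by blast
  then show "(\<lambda>m. \<Phi> m x \<otimes> \<Phi> m y) \<in> carrier M \<rightarrow> carrier L"
    and "(\<lambda>m. if x = y then \<Phi> m x else \<zero>) \<in> carrier M \<rightarrow> carrier L" by auto
  fix a assume a: "a \<in> A.invariants"
  note aM = A.invariants_free_module[OF a]
  from f_comult[OF a] obtain u where u: "u \<in> carrier (free_module L (A.invariants \<times> A.invariants))"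
    and u_diagonal: "\<forall>m\<in>carrier M. \<forall>k\<in>carrier M. tensor_coeff L u m k = (if m = k then a m else \<zero>)"
    and fu_diagonal: "\<forall>x\<in>carrier M'. \<forall>y\<in>carrier M'.
          linear_extension L (\<lambda>(b, c). f b x \<otimes> f c y) u = (if x = y then f a x else \<zero>)"
    by blast
  let ?M2 = "carrier M \<times> carrier M"
  have "linear_extension L (\<lambda>m. if x = y then \<Phi> m x else \<zero>) a = (if x = y then f a x else \<zero>)"
    using \<Phi>[OF a] A.invariants_closed[OF a] by (auto simp: linear_extension_def A.add.finprod_one_eqI)
  also have "\<dots> = linear_extension L (\<lambda>(b, c). f b x \<otimes> f c y) u"
    using fu_diagonal x y by simp
  also have "\<dots> = linear_extension L
      (\<lambda>(b, c). linear_extension L (\<lambda>m. \<Phi> m x) b \<otimes> linear_extension L (\<lambda>m. \<Phi> m y) c) u"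
    by (rule A.linear_extension_cong[OF u])
      (auto simp: \<Phi> intro!: A.linear_extension_closed[OF \<Phi>_closed] A.invariants_free_module)
  also have "\<dots> = (\<Oplus>mk\<in>?M2. tensor_coeff L u (fst mk) (snd mk) \<otimes> (\<Phi> (fst mk) x \<otimes> \<Phi> (snd mk) y))"
    by (rule A.linear_extension_tensor_pairing[OF A.finite_M _ u \<Phi>_closed \<Phi>_closed])
      (use A.invariants_free_module in blast)
  also have "\<dots> = (\<Oplus>mk\<in>?M2. if snd mk = fst mk then a (fst mk) \<otimes> (\<Phi> (fst mk) x \<otimes> \<Phi> (fst mk) y) else \<zero>)"
    using u_diagonal A.invariants_closed[OF a] \<Phi>L by (intro A.finsum_cong') auto
  also have "\<dots> = (\<Oplus>m\<in>carrier M. a m \<otimes> (\<Phi> m x \<otimes> \<Phi> m y))"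
    using A.finite_M A.invariants_closed[OF a] \<Phi>L
    by (subst A.finsum_Times) (auto simp: A.finsum_delta intro!: A.finsum_cong' cong: if_cong)
  also have "\<dots> = linear_extension L (\<lambda>m. \<Phi> m x \<otimes> \<Phi> m y) a"
    using \<Phi>L by (intro A.linear_extension_finite[OF aM A.finite_M, symmetric]) auto
  finally show "linear_extension L (\<lambda>m. \<Phi> m x \<otimes> \<Phi> m y) a
      = linear_extension L (\<lambda>m. if x = y then \<Phi> m x else \<zero>) a" by simp
qed

lemma matrix_row_sum:
  assumes m: "m \<in> carrier M"
  shows "(\<Oplus>x\<in>carrier M'. \<Phi> m x) = \<one>"
proof (rule A.invariants_separate[of "\<lambda>m. \<Oplus>x\<in>carrier M'. \<Phi> m x" "\<lambda>_. \<one>", OF _ _ _ m])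
  have \<Phi>L: "\<Phi> m z \<in> carrier L" if "m \<in> carrier M" for m z using \<Phi>_closed[of z] that by blast
  then show row: "(\<lambda>m. \<Oplus>x\<in>carrier M'. \<Phi> m x) \<in> carrier M \<rightarrow> carrier L"
    by (intro Pi_I A.finsum_closed)
  fix a assume a: "a \<in> A.invariants"
  have "linear_extension L (\<lambda>m. \<Oplus>x\<in>carrier M'. \<Phi> m x) a
      = (\<Oplus>x\<in>carrier M'. linear_extension L (\<lambda>m. \<Phi> m x) a \<otimes> \<one>)"
    using \<Phi>L by (intro A.finsum_linear_extension[OF row B.finite_M \<Phi>_closed _ _
          A.invariants_free_module[OF a], symmetric])
      (auto intro!: A.finsum_cong')
  also have "\<dots> = (\<Oplus>x\<in>carrier M'. f a x \<otimes> \<one>)"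
    using \<Phi>[OF a] f_closed[OF a] by (intro A.finsum_cong') auto
  also have "\<dots> = linear_extension L (\<lambda>_. \<one>) (f a)"
    by (rule A.linear_extension_finite[OF B.invariants_free_module[OF f_invariant[OF a]]
          B.finite_M, symmetric]) simp
  finally show "linear_extension L (\<lambda>m. \<Oplus>x\<in>carrier M'. \<Phi> m x) a = linear_extension L (\<lambda>_. \<one>) a"
    using f_counit[OF a] by simp
qed simp

lemma matrix_row_unit:
  assumes m: "m \<in> carrier M"
  shows "\<exists>z\<in>carrier M'. \<forall>x\<in>carrier M'. \<Phi> m x = (if x = z then \<one> else \<zero>)"
proof (rule A.orthogonal_idempotents_sum_one[OF B.finite_M])
  show "\<Phi> m \<in> carrier M' \<rightarrow> carrier L" using \<Phi>_closed m by blast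
  show "\<Phi> m x \<otimes> \<Phi> m y = (if x = y then \<Phi> m x else \<zero>)" if "x \<in> carrier M'" "y \<in> carrier M'" for x y
    by (rule matrix_row_orthogonal[OF m that])
  show "(\<Oplus>x\<in>carrier M'. \<Phi> m x) = \<one>"
    by (rule matrix_row_sum[OF m])
qed blast

end

lemma exists_basis_map:
  obtains \<phi> where "\<phi> \<in> carrier M \<rightarrow> carrier M'" "\<And>a. a \<in> A.invariants \<Longrightarrow> f a = free_map L \<phi> a"
proof -
  obtain \<Phi> where \<Phi>_closed: "\<And>x. (\<lambda>m. \<Phi> m x) \<in> carrier M \<rightarrow> carrier L"
    and \<Phi>: "\<And>a x. a \<in> A.invariants \<Longrightarrow> f a x = linear_extension L (\<lambda>m. \<Phi> m x) a"
    by (rule exists_matrix) blast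
  note matrix_row_unit[OF \<Phi>_closed \<Phi>]
  then obtain \<phi> where \<phi>: "\<And>m. m \<in> carrier M \<Longrightarrow> \<phi> m \<in> carrier M'"
    and row: "\<And>m x. \<lbrakk>m \<in> carrier M; x \<in> carrier M'\<rbrakk> \<Longrightarrow> \<Phi> m x = (if x = \<phi> m then \<one> else \<zero>)"
    by metis
  show ?thesis
  proof (rule that[of \<phi>])
    show "\<phi> \<in> carrier M \<rightarrow> carrier M'" using \<phi> by blast
    fix a assume a: "a \<in> A.invariants"
    note aM = A.invariants_free_module[OF a]
    show "f a = free_map L \<phi> a"
    proof
      fix x
      show "f a x = free_map L \<phi> a x"
      proof (cases "x \<in> carrier M'")
        case True
        then show ?thesis
          unfolding \<Phi>[OF a] A.free_map_apply[OF aM]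
          by (intro A.linear_extension_cong[OF aM]) (auto simp: row single_def)
      next
        case False
        have "free_map L \<phi> a \<in> carrier (free_module L (carrier M'))"
          using A.free_map_closed[OF aM] \<phi> by blast
        then show ?thesis
          using free_module_outside[OF _ False] B.invariants_outside[OF f_invariant[OF a] False] by metis
      qed
    qed
  qed
qed

context
  fixes \<phi> assumes \<phi>: "\<phi> \<in> carrier M \<rightarrow> carrier M'" and f: "\<And>a. a \<in> A.invariants \<Longrightarrow> f a = free_map L \<phi> a"
begin

lemma linear_extension_f:
  "\<lbrakk>a \<in> A.invariants; e \<in> carrier M' \<rightarrow> carrier L\<rbrakk>
    \<Longrightarrow> linear_extension L e (f a) = linear_extension L (\<lambda>m. e (\<phi> m)) a"
  unfolding f by (rule A.linear_extension_free_map[OF A.invariants_free_module \<phi>])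

lemma basis_map_surj: "\<phi> ` carrier M = carrier M'"
proof (rule ccontr)
  assume "\<phi> ` carrier M \<noteq> carrier M'"
  then obtain x where x: "x \<in> carrier M'" "x \<notin> \<phi> ` carrier M" using \<phi> by blast
  have "single L x x = \<zero>"
  proof (rule B.invariants_separate[of "single L x" "\<lambda>_. \<zero>" x])
    fix b assume "b \<in> B.invariants"
    then obtain a where a: "a \<in> A.invariants" "b = f a" using f_image by blast
    have "linear_extension L (single L x) b = linear_extension L (\<lambda>m. single L x (\<phi> m)) a"
      unfolding a(2) by (rule linear_extension_f[OF a(1)]) simp
    also have "\<dots> = linear_extension L (\<lambda>_. \<zero>) a"
      using x by (intro A.linear_extension_cong[OF A.invariants_free_module[OF a(1)]]) (auto simp: single_def)
    also have "\<dots> = linear_extension L (\<lambda>_. \<zero>) b"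
      unfolding a(2) by (rule linear_extension_f[OF a(1), symmetric]) simp
    finally show "linear_extension L (single L x) b = linear_extension L (\<lambda>_. \<zero>) b" .
  qed (use x in auto)
  then show False by (simp add: single_def)
qed

lemma basis_map_mult:
  assumes x: "x \<in> carrier M" and y: "y \<in> carrier M"
  shows "\<phi> (x \<otimes>\<^bsub>M\<^esub> y) = \<phi> x \<otimes>\<^bsub>M'\<^esub> \<phi> y"
proof -
  let ?e = "single L (\<phi> (x \<otimes>\<^bsub>M\<^esub> y))"
  let ?p = "\<lambda>b x. linear_extension L (\<lambda>y. ?e (\<phi> (x \<otimes>\<^bsub>M\<^esub> y))) b"
    and ?q = "\<lambda>b x. linear_extension L (\<lambda>y. ?e (\<phi> x \<otimes>\<^bsub>M'\<^esub> \<phi> y)) b"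
  have mult_on_invariants: "linear_extension L (?p b) a = linear_extension L (?q b) a"
    if a: "a \<in> A.invariants" and b: "b \<in> A.invariants" for a b
  proof -
    note free = A.invariants_free_module B.invariants_free_module f_invariant
    have "linear_extension L (?p b) a = linear_extension L (\<lambda>z. ?e (\<phi> z)) (a \<otimes>\<^bsub>group_algebra L M\<^esub> b)"
      by (rule A.linear_extension_group_algebra_mult[symmetric]) (simp_all add: free a b A.M_mult_closed)
    also have "\<dots> = linear_extension L ?e (f a \<otimes>\<^bsub>group_algebra L M'\<^esub> f b)"
      using linear_extension_f[OF A.invariants_mult[OF a b], of ?e] f_mult[OF a b] by simp
    also have "\<dots> = linear_extension L (\<lambda>x. linear_extension L (\<lambda>y. ?e (x \<otimes>\<^bsub>M'\<^esub> y)) (f b)) (f a)"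
      by (rule A.linear_extension_group_algebra_mult) (simp_all add: free a b B.M_mult_closed)
    also have "\<dots> = linear_extension L (?q b) a"
      using linear_extension_f[OF b, of "\<lambda>y. ?e (_ \<otimes>\<^bsub>M'\<^esub> y)"]
      by (subst linear_extension_f[OF a])
        (auto intro!: A.linear_extension_closed[OF _ A.invariants_free_module[OF b]])
    finally show ?thesis .
  qed
  have "?p b x = ?q b x" if b: "b \<in> A.invariants" for b
    by (rule A.invariants_separate[of "?p b" "?q b", OF _ _ mult_on_invariants[OF _ b] x])
      (auto intro!: A.linear_extension_closed[OF _ A.invariants_free_module[OF b]])
  then have "?e (\<phi> (x \<otimes>\<^bsub>M\<^esub> y)) = ?e (\<phi> x \<otimes>\<^bsub>M'\<^esub> \<phi> y)"
    by (rule A.invariants_separate[of "\<lambda>y. ?e (\<phi> (x \<otimes>\<^bsub>M\<^esub> y))" "\<lambda>y. ?e (\<phi> x \<otimes>\<^bsub>M'\<^esub> \<phi> y)", OF _ _ _ y, rotated 2]) auto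
  then show ?thesis by (auto simp: single_def split: if_splits)
qed

lemma basis_map_act:
  assumes g: "g \<in> carrier G" and m: "m \<in> carrier M"
  shows "\<phi> (act g m) = act' g (\<phi> m)"
proof -
  let ?x = "\<phi> m" and ?i = "act (inv\<^bsub>G\<^esub> g)"
  have x: "?x \<in> carrier M'" using \<phi> m by blast
  have "single L ?x (\<phi> (?i (act g m))) = single L (act' g ?x) (\<phi> (act g m))"
  proof (rule A.invariants_separate[of "\<lambda>m. single L ?x (\<phi> (?i m))" "\<lambda>m. single L (act' g ?x) (\<phi> m)",
        OF _ _ _ A.act_closed[OF g m]])
    fix a assume a: "a \<in> A.invariants"
    have coeff: "f a z = linear_extension L (\<lambda>m. single L z (\<phi> m)) a" for z
      unfolding f[OF a] by (rule A.free_map_apply[OF A.invariants_free_module[OF a]])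
    have "linear_extension L (\<lambda>m. g (single L ?x (\<phi> (?i m)))) a = g (f a ?x)"
      unfolding coeff by (rule A.aut_linear_extension[OF a g, symmetric]) simp
    also have "\<dots> = f a (act' g ?x)"
      by (rule B.invariants_act[OF f_invariant[OF a] g x, symmetric])
    finally have "linear_extension L (\<lambda>m. g (single L ?x (\<phi> (?i m)))) a
        = linear_extension L (\<lambda>m. single L (act' g ?x) (\<phi> m)) a" unfolding coeff .
    moreover have "g (single L ?x z) = single L ?x z" for z using g by (simp add: single_def)
    ultimately show "linear_extension L (\<lambda>m. single L ?x (\<phi> (?i m))) a
        = linear_extension L (\<lambda>m. single L (act' g ?x) (\<phi> m)) a" by simp
  qed auto
  then show ?thesis using g m by (auto simp: single_def split: if_splits)
qed

end

theorem exists_equivariant_epi: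
  obtains \<phi> where "\<phi> \<in> epi M M'"
    "\<And>g m. \<lbrakk>g \<in> carrier G; m \<in> carrier M\<rbrakk> \<Longrightarrow> \<phi> (act g m) = act' g (\<phi> m)"
proof -
  obtain \<phi> where \<phi>: "\<phi> \<in> carrier M \<rightarrow> carrier M'" "\<And>a. a \<in> A.invariants \<Longrightarrow> f a = free_map L \<phi> a"
    by (rule exists_basis_map) blast
  show ?thesis
  proof (rule that[of \<phi>])
    have "\<phi> \<in> hom M M'" using \<phi>(1) basis_map_mult[OF \<phi>] by (intro homI) auto
    then show "\<phi> \<in> epi M M'" using basis_map_surj[OF \<phi>] by (simp add: epi_def)
    show "\<phi> (act g m) = act' g (\<phi> m)" if "g \<in> carrier G" "m \<in> carrier M" for g m
      by (rule basis_map_act[OF \<phi> that])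
  qed
qed

end

section \<open>Finite cyclic groups\<close>

lemma (in group) pow_eq_iff_cong:
  fixes i j :: nat
  assumes "x \<in> carrier G"
  shows "x [^] i = x [^] j \<longleftrightarrow> [i = j] (mod ord x)"
proof -
  have "x [^] i = x [^] j \<longleftrightarrow> x [^] int i = x [^] int j"
    by (simp add: int_pow_int)
  also have "\<dots> \<longleftrightarrow> [int j = int i] (mod int (ord x))"
    using assms by (simp add: int_pow_eq cong_iff_dvd_diff)
  also have "\<dots> \<longleftrightarrow> [i = j] (mod ord x)"
    unfolding cong_int_iff by (rule cong_sym_eq)
  finally show ?thesis .
qed

lemma (in group) pow_cong:
  assumes x: "x \<in> carrier G" and ij: "[i = j] (mod order G)"
  shows "x [^] (i :: nat) = x [^] j"
  using pow_eq_iff_cong[OF x] cong_dvd_modulus_nat[OF ij ord_dvd_group_order[OF x]] by simp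

lemma BijGroup_sel [simp]:
  "carrier (BijGroup S) = Bij S" "\<one>\<^bsub>BijGroup S\<^esub> = (\<lambda>x\<in>S. x)"
  "\<lbrakk>f \<in> Bij S; g \<in> Bij S\<rbrakk> \<Longrightarrow> f \<otimes>\<^bsub>BijGroup S\<^esub> g = compose S f g"
  by (simp_all add: BijGroup_def)

lemma AutoGroup_sel [simp]:
  "carrier (AutoGroup G) = auto G" "\<one>\<^bsub>AutoGroup G\<^esub> = (\<lambda>x\<in>carrier G. x)"
  "\<lbrakk>f \<in> auto G; g \<in> auto G\<rbrakk> \<Longrightarrow> f \<otimes>\<^bsub>AutoGroup G\<^esub> g = compose (carrier G) f g"
  by (simp_all add: AutoGroup_def auto_def)

lemma Bij_closed: "\<lbrakk>f \<in> Bij S; x \<in> S\<rbrakk> \<Longrightarrow> f x \<in> S"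
  using Bij_imp_funcset by blast

lemma Bij_eqI: "\<lbrakk>f \<in> Bij S; g \<in> Bij S; \<And>x. x \<in> S \<Longrightarrow> f x = g x\<rbrakk> \<Longrightarrow> f = g"
  using Bij_imp_extensional extensionalityI by blast

lemma finite_auto: "finite (carrier G) \<Longrightarrow> finite (auto G)"
  by (rule finite_subset[OF _ finite_PiE[of "carrier G" "\<lambda>_. carrier G"]])
    (auto simp: auto_def PiE_def dest: Bij_closed Bij_imp_extensional)

locale finite_cyclic_group = group G
  for G :: "('g, 't) monoid_scheme" (structure) and a :: 'g +
  assumes finite_carrier: "finite (carrier G)"
    and generator_closed [simp]: "a \<in> carrier G" and generated: "carrier G = generate G {a}"
begin

lemma generator_pow_obtains:
  assumes "x \<in> carrier G"
  obtains k :: nat where "x = a [^] k"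
  using assms generated generate_pow_on_finite_carrier[OF finite_carrier generator_closed] by auto

lemma ord_generator: "ord a = order G"
  using generate_pow_card[OF generator_closed] generated by (simp add: order_def)

lemma generator_pow_eq_iff: "a [^] (i::nat) = a [^] (j::nat) \<longleftrightarrow> [i = j] (mod order G)"
  using pow_eq_iff_cong[OF generator_closed] ord_generator by simp

lemma inv_generator: "finite_cyclic_group G (inv a)"
proof (intro finite_cyclic_group.intro finite_cyclic_group_axioms.intro)
  have "generate G {inv a} \<subseteq> carrier G" by (simp add: generate_incl)
  moreover have "card (generate G {inv a}) = card (carrier G)"
    using generate_pow_card[of "inv a"] ord_generator by (simp add: order_def)
  ultimately show "carrier G = generate G {inv a}"
    using card_subset_eq[OF finite_carrier] by metis
qed (use finite_carrier in simp_all)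

sublocale comm_group G
proof (rule group_comm_groupI)
  fix x y assume "x \<in> carrier G" "y \<in> carrier G"
  then obtain i j :: nat where "x = a [^] i" "y = a [^] j" by (metis generator_pow_obtains)
  then show "x \<otimes> y = y \<otimes> x" by (simp add: nat_pow_mult add.commute)
qed

lemma hom_eq_if_eq_generator:
  assumes H: "group H" and f: "f \<in> hom G H" and f': "f' \<in> hom G H" and a: "f a = f' a"
    and x: "x \<in> carrier G"
  shows "f x = f' x"
proof -
  interpret H: group H by (rule H)
  interpret f: group_hom G H f using f by unfold_locales
  interpret f': group_hom G H f' using f' by unfold_locales
  obtain k :: nat where k: "x = a [^] k" by (rule generator_pow_obtains[OF x])
  show ?thesis
    using f.hom_nat_pow[of a k] f'.hom_nat_pow[of a k] a by (simp add: k)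
qed

lemma exists_hom_with_value:
  assumes H: "group H" and y: "y \<in> carrier H" and order_y: "y [^]\<^bsub>H\<^esub> order G = \<one>\<^bsub>H\<^esub>"
  obtains f where "f \<in> hom G H" "f \<in> extensional (carrier G)" "f a = y"
proof -
  interpret H: group H by (rule H)
  define f where "f = (\<lambda>x\<in>carrier G. y [^]\<^bsub>H\<^esub> (SOME k::nat. x = a [^] k))"
  have f: "f (a [^] k) = y [^]\<^bsub>H\<^esub> k" for k :: nat
  proof -
    let ?k = "SOME j::nat. a [^] k = a [^] j"
    have "a [^] k = a [^] ?k" by (rule someI[of _ k]) simp
    then have "[k = ?k] (mod order G)" unfolding generator_pow_eq_iff .
    moreover have "H.ord y dvd order G" using H.pow_eq_id[OF y] order_y by blast
    ultimately have "y [^]\<^bsub>H\<^esub> k = y [^]\<^bsub>H\<^esub> ?k"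
      unfolding H.pow_eq_iff_cong[OF y] by (rule cong_dvd_modulus_nat)
    then show ?thesis by (simp add: f_def)
  qed
  show ?thesis
  proof (rule that[of f])
    show "f \<in> hom G H"
    proof (rule homI)
      fix u v assume u: "u \<in> carrier G" and v: "v \<in> carrier G"
      obtain i :: nat where i: "u = a [^] i" by (rule generator_pow_obtains[OF u])
      obtain j :: nat where j: "v = a [^] j" by (rule generator_pow_obtains[OF v])
      show "f u \<in> carrier H" using y by (simp add: i f)
      show "f (u \<otimes> v) = f u \<otimes>\<^bsub>H\<^esub> f v"
        using y by (simp add: i j nat_pow_mult H.nat_pow_mult f)
    qed
    show "f a = y" using f[of 1] y by simp
  qed (simp add: f_def)
qed

lemma ex1_hom_with_value:
  assumes "group H" and "y \<in> carrier H" and "y [^]\<^bsub>H\<^esub> order G = \<one>\<^bsub>H\<^esub>"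
  shows "\<exists>!f. f \<in> hom G H \<and> f \<in> extensional (carrier G) \<and> f a = y"
proof -
  obtain f where f: "f \<in> hom G H" "f \<in> extensional (carrier G)" "f a = y"
    by (rule exists_hom_with_value[OF assms])
  show ?thesis
  proof (rule ex1I[of _ f])
    fix f' assume "f' \<in> hom G H \<and> f' \<in> extensional (carrier G) \<and> f' a = y"
    then show "f' = f"
      using f hom_eq_if_eq_generator[OF assms(1), of f' f]
      by (intro extensionalityI[of f' "carrier G" f]) simp_all
  qed (use f in blast)
qed

lemma endomorphism_is_power_map:
  assumes f: "f \<in> hom G G"
  obtains k :: nat where "\<And>x. x \<in> carrier G \<Longrightarrow> f x = x [^] k"
proof -
  have "f a \<in> carrier G" using hom_in_carrier[OF f] by simp
  then obtain k :: nat where k: "f a = a [^] k" by (rule generator_pow_obtains)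
  have power_map: "(\<lambda>x. x [^] k) \<in> hom G G" by (intro homI) (simp_all add: nat_pow_distrib)
  have "f x = x [^] k" if "x \<in> carrier G" for x
    by (rule hom_eq_if_eq_generator[OF is_group f power_map k that])
  then show ?thesis by (rule that)
qed

lemma endomorphisms_commute:
  assumes f: "f \<in> hom G G" and g: "g \<in> hom G G" and x: "x \<in> carrier G"
  shows "f (g x) = g (f x)"
proof -
  obtain i :: nat where i: "\<And>x. x \<in> carrier G \<Longrightarrow> f x = x [^] i"
    by (rule endomorphism_is_power_map[OF f]) blast
  obtain j :: nat where j: "\<And>x. x \<in> carrier G \<Longrightarrow> g x = x [^] j"
    by (rule endomorphism_is_power_map[OF g]) blast
  show ?thesis using x by (simp add: i j nat_pow_pow mult.commute)
qed

lemma power_map_auto_iff: "(\<lambda>x\<in>carrier G. x [^] (u::nat)) \<in> auto G \<longleftrightarrow> coprime u (order G)"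
proof
  assume "(\<lambda>x\<in>carrier G. x [^] u) \<in> auto G"
  then have "(\<lambda>x\<in>carrier G. x [^] u) ` carrier G = carrier G"
    unfolding auto_def Bij_def bij_betw_def by blast
  then have "a \<in> (\<lambda>x\<in>carrier G. x [^] u) ` carrier G" by simp
  then obtain x where x: "x \<in> carrier G" "a = x [^] u" by auto
  obtain k :: nat where k: "x = a [^] k" by (rule generator_pow_obtains[OF x(1)])
  have "a [^] (u * k) = (a [^] k) [^] u" by (simp add: nat_pow_pow mult.commute)
  also have "\<dots> = a" unfolding k[symmetric] x(2)[symmetric] ..
  finally have "a [^] (u * k) = a [^] (1::nat)" by simp
  then show "coprime u (order G)"
    unfolding generator_pow_eq_iff coprime_iff_invertible_nat by auto
next
  assume "coprime u (order G)"
  then obtain v where v: "[u * v = 1] (mod order G)" using cong_solve_coprime_nat by auto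
  have inverse: "(x [^] u) [^] v = x" "(x [^] v) [^] u = x" if x: "x \<in> carrier G" for x
    using pow_cong[OF x v] x by (simp_all add: nat_pow_pow mult.commute[of v u])
  have "bij_betw (\<lambda>x\<in>carrier G. x [^] u) (carrier G) (carrier G)"
    by (rule bij_betw_byWitness[of _ "\<lambda>x. x [^] v"]) (use inverse in auto)
  then show "(\<lambda>x\<in>carrier G. x [^] u) \<in> auto G"
    by (simp add: auto_def Bij_def hom_def nat_pow_distrib)
qed

lemma auto_is_power_map:
  assumes f: "f \<in> auto G"
  obtains u :: nat where "coprime u (order G)" "\<And>x. x \<in> carrier G \<Longrightarrow> f x = x [^] u"
proof -
  have hom: "f \<in> hom G G" and bij: "f \<in> Bij (carrier G)" using f by (auto simp: auto_def)
  obtain u :: nat where u: "\<And>x. x \<in> carrier G \<Longrightarrow> f x = x [^] u"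
    by (rule endomorphism_is_power_map[OF hom]) blast
  have "f = (\<lambda>x\<in>carrier G. x [^] u)"
    using u Bij_imp_extensional[OF bij] by (intro extensionalityI[of _ "carrier G"]) auto
  with f have "coprime u (order G)" using power_map_auto_iff by simp
  with u show ?thesis by (rule that[rotated])
qed

lemma totient_le_order_AutoGroup: "totient (order G) \<le> order (AutoGroup G)"
proof -
  have "inj_on (\<lambda>u. \<lambda>x\<in>carrier G. x [^] u) (totatives (order G))"
  proof (rule inj_onI)
    fix u v assume uv: "u \<in> totatives (order G)" "v \<in> totatives (order G)"
      and eq: "(\<lambda>x\<in>carrier G. x [^] u) = (\<lambda>x\<in>carrier G. x [^] v)"
    have "[u = v] (mod order G)"
      using fun_cong[OF eq, of a] by (simp add: generator_pow_eq_iff)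
    then show "u = v"
      using uv cong_less_modulus_unique_nat[of u v "order G"] totatives_less
      by (cases "order G = 1") (auto simp: totatives_def)
  qed
  moreover have "(\<lambda>u. \<lambda>x\<in>carrier G. x [^] u) ` totatives (order G) \<subseteq> auto G"
    using power_map_auto_iff by (auto simp: totatives_def)
  ultimately show ?thesis
    using card_inj_on_le[OF _ _ finite_auto[OF finite_carrier]] by (simp add: totient_def order_def)
qed

end

lemma (in comm_group) affine_map_pow_apply:
  assumes B: "B \<in> Bij (carrier G)" and affine: "\<And>x. x \<in> carrier G \<Longrightarrow> B x = x [^] D \<otimes> y"
    and y: "y \<in> carrier G" and x: "x \<in> carrier G"
  shows "(B [^]\<^bsub>BijGroup (carrier G)\<^esub> k) x = x [^] (D ^ k) \<otimes> y [^] geometric_sum D k"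
  using x
proof (induction k arbitrary: x)
  case (Suc k)
  interpret Perm: group "BijGroup (carrier G)" by (rule group_BijGroup)
  have "B [^]\<^bsub>BijGroup (carrier G)\<^esub> k \<in> Bij (carrier G)" using Perm.nat_pow_closed[of B k] B by simp
  then have "(B [^]\<^bsub>BijGroup (carrier G)\<^esub> Suc k) x = (B [^]\<^bsub>BijGroup (carrier G)\<^esub> k) (B x)"
    using B Suc.prems by (simp add: compose_eq)
  also have "\<dots> = (x [^] D \<otimes> y) [^] (D ^ k) \<otimes> y [^] geometric_sum D k"
    using Suc y by (simp add: affine)
  also have "\<dots> = x [^] (D ^ Suc k) \<otimes> (y [^] (D ^ k) \<otimes> y [^] geometric_sum D k)"
    using Suc.prems y by (simp add: nat_pow_distrib nat_pow_pow m_assoc)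
  also have "y [^] (D ^ k) \<otimes> y [^] geometric_sum D k = y [^] geometric_sum D (Suc k)"
    using y by (simp add: nat_pow_mult add.commute)
  finally show ?case .
qed (use y in simp)

lemma (in group) auto_pow_apply:
  assumes f: "f \<in> auto G" and power: "\<And>x. x \<in> carrier G \<Longrightarrow> f x = x [^] (u::nat)" and x: "x \<in> carrier G"
  shows "(f [^]\<^bsub>AutoGroup G\<^esub> (k::nat)) x = x [^] (u ^ k)"
  using x
proof (induction k arbitrary: x)
  case (Suc k)
  interpret Aut: group "AutoGroup G" by (rule AutoGroup)
  have "(f [^]\<^bsub>AutoGroup G\<^esub> Suc k) x = (f [^]\<^bsub>AutoGroup G\<^esub> k) (f x)"
    using f Aut.nat_pow_closed[of f k] Suc.prems by (simp add: compose_eq)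
  then show ?case
    using Suc power by (simp add: nat_pow_pow)
qed simp

locale cyclic_p_group = finite_cyclic_group N \<eta>
  for N :: "('n, 'm) monoid_scheme" (structure) and \<eta> :: 'n +
  fixes p n :: nat and \<gamma> \<delta> :: "'n \<Rightarrow> 'n"
  assumes p: "Factorial_Ring.prime p" "odd p" and n: "n \<ge> 1"
    and order_N: "order N = p ^ n"
    and \<gamma>: "\<gamma> \<in> carrier (AutoGroup N)" and Aut_generated: "carrier (AutoGroup N) = generate (AutoGroup N) {\<gamma>}"
    and \<delta>: "\<delta> = \<gamma> [^]\<^bsub>AutoGroup N\<^esub> (p - 1)"
begin

sublocale Aut: finite_cyclic_group "AutoGroup N" \<gamma>
  using AutoGroup finite_auto[OF finite_carrier] \<gamma> Aut_generated
  by (intro finite_cyclic_group.intro finite_cyclic_group_axioms.intro) simp_all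

lemma \<delta>_pow_auto: "\<delta> [^]\<^bsub>AutoGroup N\<^esub> (k::nat) \<in> auto N"
  using Aut.nat_pow_closed[OF Aut.nat_pow_closed[OF \<gamma>]] by (simp add: \<delta>)

lemma \<delta>_pow_hom: "\<delta> [^]\<^bsub>AutoGroup N\<^esub> (k::nat) \<in> hom N N"
  using \<delta>_pow_auto by (auto simp: auto_def)

lemma \<delta>_pow_is_power_map:
  obtains D where "[D = 1] (mod p)" "\<And>x. x \<in> carrier N \<Longrightarrow> (\<delta> [^]\<^bsub>AutoGroup N\<^esub> (k::nat)) x = x [^] D"
proof -
  have \<gamma>_auto: "\<gamma> \<in> auto N" using \<gamma> by simp
  obtain u where u: "coprime u (order N)" "\<And>x. x \<in> carrier N \<Longrightarrow> \<gamma> x = x [^] u"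
    by (rule auto_is_power_map[OF \<gamma>_auto]) blast
  have "\<not> p dvd u"
    using u(1) n p(1) order_N coprime_common_divisor_nat[of u "p ^ n" p] by (auto simp: dvd_power)
  then have "[u ^ (p - 1) = 1] (mod p)" by (rule fermat_theorem[OF p(1)])
  then have "[u ^ ((p - 1) * k) = 1] (mod p)" using cong_pow[of "u ^ (p - 1)" 1 p k] by (simp add: power_mult)
  then show ?thesis
    by (rule that) (use auto_pow_apply[OF \<gamma>_auto u(2)] Aut.nat_pow_pow[OF \<gamma>] in \<open>simp add: \<delta>\<close>)
qed

lemma \<delta>_pow_inj:
  assumes r: "r < p ^ (n - 1)" and s: "s < p ^ (n - 1)"
    and eq: "\<And>x. x \<in> carrier N \<Longrightarrow> (\<delta> [^]\<^bsub>AutoGroup N\<^esub> r) x = (\<delta> [^]\<^bsub>AutoGroup N\<^esub> s) x"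
  shows "r = s"
proof -
  have "\<delta> [^]\<^bsub>AutoGroup N\<^esub> r = \<delta> [^]\<^bsub>AutoGroup N\<^esub> s"
    using \<delta>_pow_auto eq by (intro Bij_eqI[of _ "carrier N"]) (auto simp: auto_def)
  then have "\<gamma> [^]\<^bsub>AutoGroup N\<^esub> ((p - 1) * r) = \<gamma> [^]\<^bsub>AutoGroup N\<^esub> ((p - 1) * s)"
    using Aut.nat_pow_pow[OF \<gamma>] by (simp add: \<delta>)
  then have cong: "[(p - 1) * r = (p - 1) * s] (mod order (AutoGroup N))"
    unfolding Aut.generator_pow_eq_iff .
  have p1: "p - 1 > 0" using prime_gt_1_nat[OF p(1)] by simp
  have "(p - 1) * t < order (AutoGroup N)" if "t < p ^ (n - 1)" for t
  proof -
    have "(p - 1) * t < totient (order N)"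
      using that p1 n totient_prime_power[OF p(1), of n] order_N by (simp add: mult.commute)
    then show ?thesis using totient_le_order_AutoGroup by (rule less_le_trans)
  qed
  then have "(p - 1) * r = (p - 1) * s"
    using cong_less_modulus_unique_nat[OF cong] r s by blast
  then show ?thesis using p1 by simp
qed

end

section \<open>The regular subgroups\<close>

context group begin

interpretation Perm: group "BijGroup (carrier G)"
  by (rule group_BijGroup)

lemma left_regular_Bij: "g \<in> carrier G \<Longrightarrow> left_regular G g \<in> Bij (carrier G)"
  using bij_betw_byWitness[of "carrier G" "\<lambda>x. inv g \<otimes> x" "left_regular G g" "carrier G"]
  by (auto simp: Bij_def left_regular_def m_assoc[symmetric])

lemma right_regular_Bij: "g \<in> carrier G \<Longrightarrow> right_regular G g \<in> Bij (carrier G)"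
  using bij_betw_byWitness[of "carrier G" "\<lambda>x. x \<otimes> g" "right_regular G g" "carrier G"]
  by (auto simp: Bij_def right_regular_def m_assoc)

lemma left_regular_one: "left_regular G \<one> = \<one>\<^bsub>BijGroup (carrier G)\<^esub>"
  unfolding left_regular_def BijGroup_sel by (rule restrict_ext) simp

lemma left_regular_mult:
  "\<lbrakk>g \<in> carrier G; h \<in> carrier G\<rbrakk>
    \<Longrightarrow> left_regular G (g \<otimes> h) = left_regular G g \<otimes>\<^bsub>BijGroup (carrier G)\<^esub> left_regular G h"
  using left_regular_Bij by (simp add: compose_def left_regular_def m_assoc cong: restrict_cong)

lemma conj_left_regular_one: "m \<in> Bij (carrier G) \<Longrightarrow> conj_left_regular G \<one> m = m"
  using Perm.inv_one Perm.l_one[of m] Perm.r_one[of m]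
  by (simp only: conj_left_regular_def left_regular_one BijGroup_sel(1))

lemma conj_left_regular_mult:
  assumes g: "g \<in> carrier G" and h: "h \<in> carrier G" and m: "m \<in> Bij (carrier G)"
  shows "conj_left_regular G (g \<otimes> h) m = conj_left_regular G g (conj_left_regular G h m)"
proof -
  have closed: "left_regular G g \<in> carrier (BijGroup (carrier G))"
      "left_regular G h \<in> carrier (BijGroup (carrier G))"
    "m \<in> carrier (BijGroup (carrier G))"
    using g h m left_regular_Bij by simp_all
  show ?thesis
    unfolding conj_left_regular_def left_regular_mult[OF g h]
    using closed by (simp only: Perm.inv_mult_group Perm.m_assoc Perm.m_closed Perm.inv_closed)
qed

lemma conj_left_regular_distrib:
  assumes g: "g \<in> carrier G" and m: "m \<in> Bij (carrier G)" and k: "k \<in> Bij (carrier G)"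
  shows "conj_left_regular G g (m \<otimes>\<^bsub>BijGroup (carrier G)\<^esub> k)
    = conj_left_regular G g m \<otimes>\<^bsub>BijGroup (carrier G)\<^esub> conj_left_regular G g k"
proof -
  let ?l = "left_regular G g"
  have closed: "?l \<in> carrier (BijGroup (carrier G))"
      "m \<in> carrier (BijGroup (carrier G))" "k \<in> carrier (BijGroup (carrier G))"
    using g m k left_regular_Bij by simp_all
  have "inv\<^bsub>BijGroup (carrier G)\<^esub> ?l \<otimes>\<^bsub>BijGroup (carrier G)\<^esub> (?l \<otimes>\<^bsub>BijGroup (carrier G)\<^esub> x) = x"
    if "x \<in> carrier (BijGroup (carrier G))" for x
    using Perm.m_assoc[OF Perm.inv_closed[OF closed(1)] closed(1) that]
      Perm.l_inv[OF closed(1)] Perm.l_one[OF that]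
    by (simp only:)
  then show ?thesis
    unfolding conj_left_regular_def
    using closed by (simp only: Perm.m_assoc Perm.m_closed Perm.inv_closed)
qed

lemma conj_left_regular_eqI:
  assumes g: "g \<in> carrier G" and m: "m \<in> Bij (carrier G)" and k: "k \<in> Bij (carrier G)"
    and eq: "\<And>x. x \<in> carrier G \<Longrightarrow> g \<otimes> m x = k (g \<otimes> x)"
  shows "conj_left_regular G g m = k"
proof -
  note l = left_regular_Bij[OF g]
  have "left_regular G g \<otimes>\<^bsub>BijGroup (carrier G)\<^esub> m = k \<otimes>\<^bsub>BijGroup (carrier G)\<^esub> left_regular G g"
    using l m k eq Bij_closed[OF m] g by (simp add: compose_def left_regular_def cong: restrict_cong)
  then show ?thesis
    unfolding conj_left_regular_def
    using Perm.inv_solve_right[of k "left_regular G g \<otimes>\<^bsub>BijGroup (carrier G)\<^esub> m" "left_regular G g"]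
      Perm.m_closed[of k "left_regular G g"] l k
    by (metis BijGroup_sel(1))
qed

end

locale cyclic_regular_embedding =
  cyclic_p_group N \<eta> p n \<gamma> \<delta> + G: finite_cyclic_group G \<sigma>
  for N :: "('n, 'm) monoid_scheme" (structure) and \<eta> p n \<gamma> \<delta> and G :: "('g, 't) monoid_scheme" and \<sigma> +
  assumes order_G: "order G = p ^ n"
begin

abbreviation Perm_N where "Perm_N \<equiv> BijGroup (carrier N)"
abbreviation Perm_G where "Perm_G \<equiv> BijGroup (carrier G)"

sublocale Perm_N: group Perm_N
  by (rule group_BijGroup)

sublocale Perm_G: group Perm_G
  by (rule group_BijGroup)

sublocale inv_\<eta>: finite_cyclic_group N "inv \<eta>"
  by (rule inv_generator)

context
  fixes s :: nat
begin

definition beta_generator where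
  "beta_generator = right_regular N \<eta> \<otimes>\<^bsub>Perm_N\<^esub> (\<delta> [^]\<^bsub>AutoGroup N\<^esub> s)"

lemma beta_generator_Bij: "beta_generator \<in> Bij (carrier N)"
  unfolding beta_generator_def
  using Perm_N.m_closed right_regular_Bij[OF generator_closed] \<delta>_pow_auto by (auto simp: auto_def)

lemma beta_generator_apply:
  "x \<in> carrier N \<Longrightarrow> beta_generator x = (\<delta> [^]\<^bsub>AutoGroup N\<^esub> s) x \<otimes> inv \<eta>"
  unfolding beta_generator_def
  using right_regular_Bij[OF generator_closed] \<delta>_pow_auto[of s]
    Bij_closed[of "\<delta> [^]\<^bsub>AutoGroup N\<^esub> s" "carrier N" x]
  by (simp add: auto_def compose_eq right_regular_def)

lemma beta_generator_pow_apply: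
  assumes "\<And>x. x \<in> carrier N \<Longrightarrow> (\<delta> [^]\<^bsub>AutoGroup N\<^esub> s) x = x [^] D" and "x \<in> carrier N"
  shows "(beta_generator [^]\<^bsub>Perm_N\<^esub> k) x = x [^] (D ^ k) \<otimes> inv \<eta> [^] geometric_sum D k"
  using assms by (intro affine_map_pow_apply[OF beta_generator_Bij]) (simp_all add: beta_generator_apply)

lemma beta_generator_pow_order: "beta_generator [^]\<^bsub>Perm_N\<^esub> (p ^ n) = \<one>\<^bsub>Perm_N\<^esub>"
proof -
  obtain D where D: "[D = 1] (mod p)" "\<And>x. x \<in> carrier N \<Longrightarrow> (\<delta> [^]\<^bsub>AutoGroup N\<^esub> s) x = x [^] D"
    by (rule \<delta>_pow_is_power_map) blast
  show ?thesis
  proof (rule Bij_eqI[of _ "carrier N"])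
    show "beta_generator [^]\<^bsub>Perm_N\<^esub> (p ^ n) \<in> Bij (carrier N)" "\<one>\<^bsub>Perm_N\<^esub> \<in> Bij (carrier N)"
      using Perm_N.nat_pow_closed[of beta_generator] beta_generator_Bij Perm_N.one_closed by simp_all
    fix x assume x: "x \<in> carrier N"
    have "x [^] (D ^ (p ^ n)) = x [^] (1::nat)"
      by (rule pow_cong[OF x]) (unfold order_N, rule power_prime_power_cong[OF p D(1)])
    moreover have "inv \<eta> [^] geometric_sum D (p ^ n) = inv \<eta> [^] (0::nat)"
      unfolding inv_\<eta>.generator_pow_eq_iff order_N cong_0_iff
      using prime_power_dvd_geometric_sum_iff[OF p D(1)] by simp
    ultimately show "(beta_generator [^]\<^bsub>Perm_N\<^esub> (p ^ n)) x = \<one>\<^bsub>Perm_N\<^esub> x"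
      using x by (simp add: beta_generator_pow_apply[OF D(2)])
  qed
qed

abbreviation \<beta> where "\<beta> \<equiv> beta G \<sigma> N \<eta> \<delta> s"
abbreviation b where "b \<equiv> b_map G \<sigma> N \<eta> \<delta> s"
abbreviation \<alpha> where "\<alpha> \<equiv> alpha G \<sigma> N \<eta> \<delta> s"
abbreviation \<alpha>_group where "\<alpha>_group \<equiv> alpha_group G \<sigma> N \<eta> \<delta> s"

lemma beta_hom: "\<beta> \<in> hom G Perm_N" and beta_\<sigma>: "\<beta> \<sigma> = beta_generator"
  using theI'[OF G.ex1_hom_with_value[OF Perm_N.is_group, of beta_generator]]
    beta_generator_Bij beta_generator_pow_order
  by (simp_all add: beta_def beta_generator_def[symmetric] order_G)

interpretation \<beta>: group_hom G Perm_N \<beta>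
  using beta_hom by unfold_locales

lemma beta_Bij: "x \<in> carrier G \<Longrightarrow> \<beta> x \<in> Bij (carrier N)"
  using \<beta>.hom_closed by simp

lemma b_closed: "x \<in> carrier G \<Longrightarrow> b x \<in> carrier N"
  unfolding b_map_def by (rule Bij_closed[OF beta_Bij one_closed])

lemma b_one: "b \<one>\<^bsub>G\<^esub> = \<one>"
  by (simp add: b_map_def \<beta>.hom_one)

lemma b_mult_\<sigma>:
  assumes x: "x \<in> carrier G"
  shows "b (\<sigma> \<otimes>\<^bsub>G\<^esub> x) = (\<delta> [^]\<^bsub>AutoGroup N\<^esub> s) (b x) \<otimes> inv \<eta>"
proof -
  have "\<beta> (\<sigma> \<otimes>\<^bsub>G\<^esub> x) = compose (carrier N) beta_generator (\<beta> x)"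
    using \<beta>.hom_mult[OF G.generator_closed x] beta_generator_Bij beta_Bij[OF x] by (simp add: beta_\<sigma>)
  then have "b (\<sigma> \<otimes>\<^bsub>G\<^esub> x) = beta_generator (b x)" by (simp add: b_map_def compose_eq)
  then show ?thesis using beta_generator_apply[OF b_closed[OF x]] by simp
qed

lemma b_bij: "bij_betw b (carrier G) (carrier N)"
proof -
  obtain D where D: "[D = 1] (mod p)" "\<And>x. x \<in> carrier N \<Longrightarrow> (\<delta> [^]\<^bsub>AutoGroup N\<^esub> s) x = x [^] D"
    by (rule \<delta>_pow_is_power_map) blast
  have b_pow: "b (\<sigma> [^]\<^bsub>G\<^esub> k) = inv \<eta> [^] geometric_sum D k" for k
    using \<beta>.hom_nat_pow[OF G.generator_closed] beta_generator_pow_apply[OF D(2) one_closed]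
    by (simp add: b_map_def beta_\<sigma>)
  have inj: "inj_on b (carrier G)"
  proof (rule inj_onI)
    fix x y assume x: "x \<in> carrier G" and y: "y \<in> carrier G" and eq: "b x = b y"
    obtain i :: nat where i: "x = \<sigma> [^]\<^bsub>G\<^esub> i" by (rule G.generator_pow_obtains[OF x])
    obtain j :: nat where j: "y = \<sigma> [^]\<^bsub>G\<^esub> j" by (rule G.generator_pow_obtains[OF y])
    have "[geometric_sum D i = geometric_sum D j] (mod p ^ n)"
      using eq unfolding i j b_pow inv_\<eta>.generator_pow_eq_iff order_N .
    then show "x = y" unfolding i j G.generator_pow_eq_iff order_G geometric_sum_cong_iff[OF p D(1)] .
  qed
  moreover have "b ` carrier G = carrier N"
    using card_image[OF inj] order_G order_N b_closed
    by (intro card_subset_eq[OF finite_carrier]) (auto simp: order_def)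
  ultimately show ?thesis by (simp add: bij_betw_def)
qed

lemma b_eqD: "\<lbrakk>b x = b y; x \<in> carrier G; y \<in> carrier G\<rbrakk> \<Longrightarrow> x = y"
  using bij_betw_imp_inj_on[OF b_bij] by (auto dest: inj_onD)

lemma alpha_closed: "\<lbrakk>\<nu> \<in> carrier N; x \<in> carrier G\<rbrakk> \<Longrightarrow> \<alpha> \<nu> x \<in> carrier G"
  and b_alpha: "\<lbrakk>\<nu> \<in> carrier N; x \<in> carrier G\<rbrakk> \<Longrightarrow> b (\<alpha> \<nu> x) = \<nu> \<otimes> b x"
  using inv_into_into[of _ b "carrier G"] f_inv_into_f[of _ b "carrier G"]
    bij_betw_imp_surj_on[OF b_bij] b_closed[of x]
  by (simp_all add: alpha_def left_regular_def)

lemma alpha_mult_apply: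
  assumes "\<nu> \<in> carrier N" "\<mu> \<in> carrier N" and x: "x \<in> carrier G"
  shows "\<alpha> (\<nu> \<otimes> \<mu>) x = \<alpha> \<nu> (\<alpha> \<mu> x)"
proof (rule b_eqD)
  show "b (\<alpha> (\<nu> \<otimes> \<mu>) x) = b (\<alpha> \<nu> (\<alpha> \<mu> x))"
    using assms b_closed by (simp add: alpha_closed b_alpha m_assoc)
qed (use assms alpha_closed in simp_all)

lemma alpha_one_apply: "x \<in> carrier G \<Longrightarrow> \<alpha> \<one> x = x"
  by (rule b_eqD) (simp_all add: alpha_closed b_alpha b_closed)

lemma alpha_Bij:
  assumes \<nu>: "\<nu> \<in> carrier N" shows "\<alpha> \<nu> \<in> Bij (carrier G)"
proof -
  have "bij_betw (\<alpha> \<nu>) (carrier G) (carrier G)"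
    by (rule bij_betw_byWitness[of _ "\<alpha> (inv \<nu>)"])
      (use \<nu> alpha_closed in \<open>auto simp: alpha_mult_apply[symmetric] alpha_one_apply\<close>)
  then show ?thesis by (simp add: Bij_def alpha_def)
qed

lemma alpha_hom: "\<alpha> \<in> hom N Perm_G"
proof (rule homI)
  fix \<nu> \<mu> assume \<nu>: "\<nu> \<in> carrier N" and \<mu>: "\<mu> \<in> carrier N"
  show "\<alpha> (\<nu> \<otimes> \<mu>) = \<alpha> \<nu> \<otimes>\<^bsub>Perm_G\<^esub> \<alpha> \<mu>"
    using alpha_Bij \<nu> \<mu> compose_Bij[OF alpha_Bij[OF \<nu>] alpha_Bij[OF \<mu>]]
    by (intro Bij_eqI[of _ "carrier G"]) (simp_all add: alpha_mult_apply compose_eq)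
qed (simp add: alpha_Bij)

lemma alpha_inj: "inj_on \<alpha> (carrier N)"
proof (rule inj_onI)
  fix \<nu> \<mu> assume \<nu>: "\<nu> \<in> carrier N" and \<mu>: "\<mu> \<in> carrier N" and eq: "\<alpha> \<nu> = \<alpha> \<mu>"
  have "\<nu> = b (\<alpha> \<nu> \<one>\<^bsub>G\<^esub>)" using \<nu> by (simp add: b_alpha b_one)
  also have "\<dots> = \<mu>" unfolding eq using \<mu> by (simp add: b_alpha b_one)
  finally show "\<nu> = \<mu>" .
qed

lemma alpha_group_sel:
  "carrier \<alpha>_group = \<alpha> ` carrier N" "monoid.mult \<alpha>_group = monoid.mult Perm_G"
  by (simp_all add: alpha_group_def)

lemma alpha_iso: "\<alpha> \<in> iso N \<alpha>_group"
proof (rule isoI)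
  show "\<alpha> \<in> hom N \<alpha>_group"
    by (rule homI) (auto simp: alpha_group_sel(1) alpha_group_sel(2) hom_mult[OF alpha_hom]
        simp del: BijGroup_sel)
  show "bij_betw \<alpha> (carrier N) (carrier \<alpha>_group)"
    using alpha_inj by (simp add: bij_betw_def alpha_group_sel)
qed

lemma conj_\<sigma>_alpha:
  assumes \<nu>: "\<nu> \<in> carrier N"
  shows "conj_left_regular G \<sigma> (\<alpha> \<nu>) = \<alpha> ((\<delta> [^]\<^bsub>AutoGroup N\<^esub> s) \<nu>)"
proof (rule G.conj_left_regular_eqI[OF G.generator_closed alpha_Bij[OF \<nu>] alpha_Bij])
  let ?\<delta>s = "\<delta> [^]\<^bsub>AutoGroup N\<^esub> s"
  note \<delta>s_closed = hom_in_carrier[OF \<delta>_pow_hom]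
  show "?\<delta>s \<nu> \<in> carrier N" by (rule \<delta>s_closed[OF \<nu>])
  fix x assume x: "x \<in> carrier G"
  show "\<sigma> \<otimes>\<^bsub>G\<^esub> \<alpha> \<nu> x = \<alpha> (?\<delta>s \<nu>) (\<sigma> \<otimes>\<^bsub>G\<^esub> x)"
  proof (rule b_eqD)
    have "b (\<sigma> \<otimes>\<^bsub>G\<^esub> \<alpha> \<nu> x) = ?\<delta>s \<nu> \<otimes> ?\<delta>s (b x) \<otimes> inv \<eta>"
      using \<nu> x b_closed by (simp add: b_mult_\<sigma> alpha_closed b_alpha hom_mult[OF \<delta>_pow_hom])
    also have "\<dots> = b (\<alpha> (?\<delta>s \<nu>) (\<sigma> \<otimes>\<^bsub>G\<^esub> x))"
      using \<nu> x b_closed \<delta>s_closed by (simp add: b_mult_\<sigma> b_alpha m_assoc)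
    finally show "b (\<sigma> \<otimes>\<^bsub>G\<^esub> \<alpha> \<nu> x) = b (\<alpha> (?\<delta>s \<nu>) (\<sigma> \<otimes>\<^bsub>G\<^esub> x))" .
  qed (use \<nu> x \<delta>s_closed alpha_closed in simp_all)
qed

lemma alpha_group_Bij: "m \<in> carrier \<alpha>_group \<Longrightarrow> m \<in> Bij (carrier G)"
  using alpha_Bij by (auto simp: alpha_group_sel)

lemma conj_closed:
  assumes g: "g \<in> carrier G" and m: "m \<in> carrier \<alpha>_group"
  shows "conj_left_regular G g m \<in> carrier \<alpha>_group"
proof -
  have conj_\<sigma>_closed: "conj_left_regular G \<sigma> m \<in> carrier \<alpha>_group" if "m \<in> carrier \<alpha>_group" for m
    using that conj_\<sigma>_alpha hom_in_carrier[OF \<delta>_pow_hom] by (auto simp: alpha_group_sel)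
  have "conj_left_regular G (\<sigma> [^]\<^bsub>G\<^esub> (k::nat)) m \<in> carrier \<alpha>_group" for k
    using m
  proof (induction k arbitrary: m)
    case 0
    then show ?case using G.conj_left_regular_one[OF alpha_group_Bij[OF 0]] by simp
  next
    case (Suc k)
    have "conj_left_regular G (\<sigma> [^]\<^bsub>G\<^esub> Suc k) m = conj_left_regular G (\<sigma> [^]\<^bsub>G\<^esub> k) (conj_left_regular G \<sigma> m)"
      using G.conj_left_regular_mult[OF _ G.generator_closed alpha_group_Bij[OF Suc.prems]] by simp
    then show ?case using Suc.IH[OF conj_\<sigma>_closed[OF Suc.prems]] by simp
  qed
  then show ?thesis using G.generator_pow_obtains[OF g] by metis
qed

end

end

theorem index_eq_if_equivariant_epi:
  assumes "cyclic_regular_embedding N \<eta> p n \<gamma> \<delta> G \<sigma>" and r: "r < p ^ (n - 1)" and s: "s < p ^ (n - 1)"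
    and \<phi>: "\<phi> \<in> epi (alpha_group G \<sigma> N \<eta> \<delta> r) (alpha_group G \<sigma> N \<eta> \<delta> s)"
    and equivariant: "\<And>m. m \<in> carrier (alpha_group G \<sigma> N \<eta> \<delta> r)
      \<Longrightarrow> \<phi> (conj_left_regular G \<sigma> m) = conj_left_regular G \<sigma> (\<phi> m)"
  shows "r = s"
proof -
  interpret cyclic_regular_embedding N \<eta> p n \<gamma> \<delta> G \<sigma> by (rule assms(1))
  let ?\<psi> = "\<lambda>\<nu>. inv_into (carrier N) (\<alpha> s) (\<phi> (\<alpha> r \<nu>))"
  note s_inv = iso_set_sym[OF alpha_iso[of s]]
  have "\<phi> \<in> hom (\<alpha>_group r) (\<alpha>_group s)" using \<phi> by (simp add: epi_def)
  then have \<psi>_hom: "?\<psi> \<in> hom N N"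
    using Group.hom_compose[OF Group.hom_compose[OF iso_imp_homomorphism[OF alpha_iso]]
        iso_imp_homomorphism[OF s_inv], of \<phi> r]
    by (simp add: comp_def)
  have "?\<psi> ` carrier N = inv_into (carrier N) (\<alpha> s) ` \<phi> ` \<alpha> r ` carrier N"
    by (simp only: image_image)
  also have "\<dots> = carrier N"
    using \<phi> alpha_iso[of r] s_inv by (simp add: epi_def iso_iff)
  finally have \<psi>_inj: "inj_on ?\<psi> (carrier N)"
    by (intro eq_card_imp_inj_on[OF finite_carrier]) (rule arg_cong)
  have \<alpha>_\<psi>: "\<alpha> s (?\<psi> \<nu>) = \<phi> (\<alpha> r \<nu>)" if "\<nu> \<in> carrier N" for \<nu>
  proof (rule f_inv_into_f)
    show "\<phi> (\<alpha> r \<nu>) \<in> \<alpha> s ` carrier N"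
      using \<phi> that unfolding epi_def alpha_group_sel by blast
  qed
  have intertwines: "?\<psi> ((\<delta> [^]\<^bsub>AutoGroup N\<^esub> r) \<nu>) = (\<delta> [^]\<^bsub>AutoGroup N\<^esub> s) (?\<psi> \<nu>)"
    if \<nu>: "\<nu> \<in> carrier N" for \<nu>
  proof -
    note \<psi>\<nu> = hom_in_carrier[OF \<psi>_hom \<nu>]
    have "\<phi> (\<alpha> r ((\<delta> [^]\<^bsub>AutoGroup N\<^esub> r) \<nu>)) = conj_left_regular G \<sigma> (\<alpha> s (?\<psi> \<nu>))"
      using equivariant[of "\<alpha> r \<nu>"] \<nu> by (simp add: conj_\<sigma>_alpha alpha_group_sel(1) \<alpha>_\<psi>)
    also have "\<dots> = \<alpha> s ((\<delta> [^]\<^bsub>AutoGroup N\<^esub> s) (?\<psi> \<nu>))" by (rule conj_\<sigma>_alpha[OF \<psi>\<nu>])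
    finally show ?thesis
      using inv_into_f_f[OF alpha_inj] hom_in_carrier[OF \<delta>_pow_hom \<psi>\<nu>] by simp
  qed
  show "r = s"
  proof (rule \<delta>_pow_inj[OF r s])
    fix \<nu> assume \<nu>: "\<nu> \<in> carrier N"
    have "?\<psi> ((\<delta> [^]\<^bsub>AutoGroup N\<^esub> r) \<nu>) = ?\<psi> ((\<delta> [^]\<^bsub>AutoGroup N\<^esub> s) \<nu>)"
      unfolding intertwines[OF \<nu>] by (rule endomorphisms_commute[OF \<delta>_pow_hom \<psi>_hom \<nu>])
    then show "(\<delta> [^]\<^bsub>AutoGroup N\<^esub> r) \<nu> = (\<delta> [^]\<^bsub>AutoGroup N\<^esub> s) \<nu>"
      using inj_onD[OF \<psi>_inj] hom_in_carrier[OF \<delta>_pow_hom \<nu>] by blast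
  qed
qed

section \<open>Descended group Hopf algebras\<close>

lemma galois_group_sel:
  "carrier (galois_group L K) = {g \<in> ring_hom L L \<inter> Bij (carrier L). \<forall>k\<in>K. g k = k}"
  "\<one>\<^bsub>galois_group L K\<^esub> = (\<lambda>x\<in>carrier L. x)"
  "\<lbrakk>f \<in> Bij (carrier L); g \<in> Bij (carrier L)\<rbrakk> \<Longrightarrow> f \<otimes>\<^bsub>galois_group L K\<^esub> g = compose (carrier L) f g"
  by (simp_all add: galois_group_def)

lemma (in ring) group_galois_group:
  assumes K: "K \<subseteq> carrier R"
  shows "group (galois_group R K)"
proof -
  let ?S = "{g \<in> ring_hom R R \<inter> Bij (carrier R). \<forall>k\<in>K. g k = k}"
  have "subgroup ?S (BijGroup (carrier R))"
  proof (rule subgroup.intro)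
    show "\<one>\<^bsub>BijGroup (carrier R)\<^esub> \<in> ?S"
      using K id_Bij[of "carrier R"] by (auto intro!: ring_hom_memI)
  next
    fix f g assume f: "f \<in> ?S" and g: "g \<in> ?S"
    have "f \<circ> g \<in> ring_hom R R" using ring_hom_trans[of g R R f R] f g by simp
    then have "compose (carrier R) f g \<in> ring_hom R R" by (rule ring_hom_restrict) (simp add: compose_eq)
    then show "f \<otimes>\<^bsub>BijGroup (carrier R)\<^esub> g \<in> ?S"
      using f g K by (auto simp: compose_Bij compose_eq subset_iff)
  next
    fix f assume f: "f \<in> ?S"
    then have f_Bij: "f \<in> Bij (carrier R)"
      and f_bij: "bij_betw f (carrier R) (carrier R)" by (auto simp: Bij_def)
    let ?i = "\<lambda>x\<in>carrier R. inv_into (carrier R) f x"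
    have "inv_into (carrier R) f \<in> ring_hom R R"
      using ring_iso_set_sym[OF ring_axioms, of f R] f f_bij by (simp add: ring_iso_def)
    then have "?i \<in> ring_hom R R" by (rule ring_hom_restrict) simp
    moreover have "?i k = k" if "k \<in> K" for k
      using inv_into_f_f[OF bij_betw_imp_inj_on[OF f_bij], of k] f K that by auto
    ultimately show "inv\<^bsub>BijGroup (carrier R)\<^esub> f \<in> ?S"
      using restrict_inv_into_Bij[OF f_Bij] by (simp add: inv_BijGroup[OF f_Bij])
  qed auto
  then show ?thesis
    unfolding galois_group_def by (rule subgroup.subgroup_is_group[OF _ group_BijGroup])
qed

theorem galois_descent_galois_group:
  assumes ext: "galois_extension L K"
  shows "galois_descent L (galois_group L K) K"
proof -
  have L: "field L" and K_subfield: "subfield K L"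
    and fixed: "{x \<in> carrier L. \<forall>g\<in>carrier (galois_group L K). g x = x} = K"
    using ext by (auto simp: galois_extension_def)
  interpret field L by (rule L)
  have "K \<subseteq> carrier L" using subringE(1)[OF subfieldE(1)[OF K_subfield]] .
  note group = group_galois_group[OF this]
  show ?thesis
  proof (intro galois_descent.intro field_automorphisms.intro field_automorphisms_axioms.intro
      galois_descent_axioms.intro L K_subfield group)
    fix g h assume "g \<in> carrier (galois_group L K)" "h \<in> carrier (galois_group L K)"
      and "\<And>x. x \<in> carrier L \<Longrightarrow> g x = h x"
    then show "g = h" by (intro Bij_eqI[of _ "carrier L"]) (auto simp: galois_group_sel)
  next
    fix x assume "x \<in> carrier L" "\<And>g. g \<in> carrier (galois_group L K) \<Longrightarrow> g x = x"
    then show "x \<in> K" using fixed by blast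
  qed (auto simp: galois_group_sel compose_eq)
qed

lemma group_hopf_sel [simp]:
  "carrier (group_hopf L M) = carrier (free_module L (carrier M))"
  "\<zero>\<^bsub>group_hopf L M\<^esub> = (\<lambda>_. \<zero>\<^bsub>L\<^esub>)"
  "u \<oplus>\<^bsub>group_hopf L M\<^esub> v = (\<lambda>x. u x \<oplus>\<^bsub>L\<^esub> v x)"
  "c \<odot>\<^bsub>group_hopf L M\<^esub> u = (\<lambda>x. c \<otimes>\<^bsub>L\<^esub> u x)"
  "a \<otimes>\<^bsub>group_hopf L M\<^esub> b = a \<otimes>\<^bsub>group_algebra L M\<^esub> b"
  "counit (group_hopf L M) a = finsum L a {m. a m \<noteq> \<zero>\<^bsub>L\<^esub>}"
  by (simp_all add: group_hopf_def group_algebra_def module.extend_def free_module_def)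

lemma tensor_class_cong:
  assumes "carrier V = carrier V'" "add V = add V'" "smult V = smult V'"
  shows "tensor_class R V V = tensor_class R V' V'" "tensor_carrier R V V = tensor_carrier R V' V'"
    "tensor_map R V V = tensor_map R V' V'"
  using assms by (simp_all add: fun_eq_iff tensor_class_def tensor_kernel_def
      bilinear_relations_def tensor_carrier_def tensor_map_def)

lemma comult_group_hopf:
  "comult (group_hopf L M) a
    = tensor_class L (group_hopf L M) (group_hopf L M) (free_map L (\<lambda>m. (single L m, single L m)) a)"
proof -
  have "tensor_class L (group_algebra L M) (group_algebra L M)
      = tensor_class L (group_hopf L M) (group_hopf L M)"
    by (rule tensor_class_cong) (simp_all add: group_hopf_def group_algebra_def module.extend_def free_module_def)
  then show ?thesis by (simp add: group_hopf_def module.extend_def)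
qed

context cring begin

context
  fixes M :: "('m, 's) monoid_scheme"
  assumes finite_M: "finite (carrier M)"
begin

lemma group_hopf_framed_module:
  "framed_module R (carrier R) (carrier M) (group_hopf R M) (carrier M) (single R) (single R)"
proof (intro framed_module.intro framed_module_axioms.intro cring_axioms carrier_is_subring finite_M)
  interpret F: module R "free_module R (carrier M)" by (rule free_module_is_module)
  show "(\<lambda>_. \<zero>) \<in> carrier (group_hopf R M)"
    using F.M.zero_closed by (simp add: free_module_sel)
  show "(\<lambda>m. v m \<oplus> v' m) \<in> carrier (group_hopf R M)"
    if "v \<in> carrier (group_hopf R M)" "v' \<in> carrier (group_hopf R M)" for v v'
    using F.M.a_closed[of v v'] that by (simp add: free_module_sel)
  show "(\<lambda>m. c \<otimes> v m) \<in> carrier (group_hopf R M)" if "c \<in> carrier R" "v \<in> carrier (group_hopf R M)" for c v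
    using F.smult_closed[of c v] that by (simp add: free_module_sel)
  show "(\<Oplus>i\<in>carrier M. single R i x \<otimes> single R i y) = (if x = y then \<one> else \<zero>)"
    if "x \<in> carrier M" "y \<in> carrier M" for x y
  proof -
    have "(\<Oplus>i\<in>carrier M. single R i x \<otimes> single R i y)
        = (\<Oplus>i\<in>carrier M. if i = x then (if x = y then \<one> else \<zero>) else \<zero>)"
      by (rule finsum_cong'[OF refl]) (auto simp: single_def)
    then show ?thesis using that finite_M by (simp add: finsum_delta)
  qed
  show "linear_extension R (single R i) v \<in> carrier R" if "v \<in> carrier (group_hopf R M)" for i v
    using that by (intro linear_extension_closed[of _ "carrier M"]) simp_all
qed (simp_all add: single_closed)

lemma tensor_coeff_diagonal:
  assumes a: "a \<in> carrier (free_module R (carrier M))"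
  shows "tensor_coeff R (free_map R (\<lambda>m. (single R m, single R m)) a) x y = (if x = y then a x else \<zero>)"
proof -
  let ?B = "carrier (free_module R (carrier M))"
  have "tensor_coeff R (free_map R (\<lambda>m. (single R m, single R m)) a) x y
      = linear_extension R (\<lambda>m. single R m x \<otimes> single R m y) a"
    unfolding tensor_coeff_def
    by (subst linear_extension_free_map[OF a, of _ "?B \<times> ?B"]) (auto simp: single_closed free_module_closed)
  also have "\<dots> = linear_extension R (\<lambda>m. single R x m \<otimes> (if x = y then \<one> else \<zero>)) a"
    by (rule linear_extension_cong[OF a]) (auto simp: single_def)
  also have "\<dots> = linear_extension R (single R x) a \<otimes> (if x = y then \<one> else \<zero>)"
    by (rule linear_extension_mult_right[OF a]) (simp_all add: single_def)
  also have "\<dots> = (if x = y then a x else \<zero>)"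
    using free_module_closed[OF a] by (simp add: linear_extension_single_left[OF a])
  finally show ?thesis .
qed

end

end

locale hopf_descent = galois_monoid L "galois_group L K" K M "conj_left_regular (galois_group L K)"
  for L :: "('a, 'l) ring_scheme" (structure) and K :: "'a set"
    and M :: "(('a \<Rightarrow> 'a) \<Rightarrow> ('a \<Rightarrow> 'a), 's) monoid_scheme"
begin

abbreviation G where "G \<equiv> galois_group L K"
abbreviation H where "H \<equiv> descent_hopf L K M"
abbreviation A where "A \<equiv> group_hopf L M"

lemma descent_action_conj:
  assumes a: "a \<in> carrier A" and g: "g \<in> carrier G" and m: "m \<in> carrier M"
  shows "descent_action L G g a (conj_left_regular G g m) = g (a m)"
proof -
  have a_free: "a \<in> carrier (free_module L (carrier M))" using a by simp
  note a_closed = free_module_closed[OF a_free]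
  have ga: "(\<lambda>m. g (a m)) \<in> carrier (free_module L (carrier M))"
    using g a_closed free_module_outside[OF a_free] by (intro free_module_finiteI[OF finite_M]) auto
  have "descent_action L G g a (conj_left_regular G g m)
      = linear_extension L (\<lambda>x. single L (conj_left_regular G g m) (conj_left_regular G g x)) (\<lambda>m. g (a m))"
    unfolding descent_action_def by (rule free_map_apply[OF ga])
  also have "\<dots> = linear_extension L (single L m) (\<lambda>m. g (a m))"
    using act_eq_iff[OF g _ m] by (intro linear_extension_cong[OF ga]) (auto simp: single_def)
  finally show ?thesis by (simp add: linear_extension_single_left[OF ga])
qed

lemma descent_action_outside:
  assumes a: "a \<in> carrier A" and g: "g \<in> carrier G" and m: "m \<notin> carrier M"
  shows "descent_action L G g a m = \<zero>"
proof -
  have a_free: "a \<in> carrier (free_module L (carrier M))" using a by simp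
  have "(\<lambda>m. g (a m)) \<in> carrier (free_module L (carrier M))"
    using g free_module_closed[OF a_free] free_module_outside[OF a_free]
    by (intro free_module_finiteI[OF finite_M]) auto
  then have "descent_action L G g a \<in> carrier (free_module L (carrier M))"
    unfolding descent_action_def by (rule free_map_closed) (use act_closed[OF g] in blast)
  then show ?thesis using m by (rule free_module_outside)
qed

lemma descent_action_eq_iff:
  assumes a: "a \<in> carrier A" and g: "g \<in> carrier G"
  shows "descent_action L G g a = a \<longleftrightarrow> (\<forall>m\<in>carrier M. a (conj_left_regular G g m) = g (a m))"
proof
  assume fixed: "descent_action L G g a = a"
  show "\<forall>m\<in>carrier M. a (conj_left_regular G g m) = g (a m)"
    using descent_action_conj[OF a g] unfolding fixed by blast
next
  assume invariant: "\<forall>m\<in>carrier M. a (conj_left_regular G g m) = g (a m)"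
  show "descent_action L G g a = a"
  proof
    fix m
    show "descent_action L G g a m = a m"
    proof (cases "m \<in> carrier M")
      case True
      let ?m = "conj_left_regular G (inv\<^bsub>G\<^esub> g) m"
      have m: "?m \<in> carrier M" "conj_left_regular G g ?m = m" using True act_closed g by simp_all
      have "descent_action L G g a m = g (a ?m)" using descent_action_conj[OF a g m(1)] m(2) by simp
      then show ?thesis using bspec[OF invariant m(1)] m(2) by simp
    next
      case False
      have "a m = \<zero>" using a False free_module_outside[of a L "carrier M" m] by simp
      then show ?thesis using descent_action_outside[OF a g False] by simp
    qed
  qed
qed

lemma carrier_H: "carrier H = invariants"
proof -
  have "carrier H = {a \<in> carrier A. \<forall>g\<in>carrier G. descent_action L G g a = a}"
    by (simp add: descent_hopf_def Let_def)
  also have "\<dots> = invariants"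
    unfolding invariants_def group_hopf_sel(1)[symmetric] using descent_action_eq_iff by blast
  finally show ?thesis .
qed

lemma H_sel:
  "\<zero>\<^bsub>H\<^esub> = (\<lambda>_. \<zero>)" "u \<oplus>\<^bsub>H\<^esub> v = (\<lambda>x. u x \<oplus> v x)" "c \<odot>\<^bsub>H\<^esub> u = (\<lambda>x. c \<otimes> u x)"
  "a \<otimes>\<^bsub>H\<^esub> b = a \<otimes>\<^bsub>group_algebra L M\<^esub> b"
  using group_hopf_sel[of L M] by (simp_all add: descent_hopf_def Let_def)

lemma counit_H:
  assumes a: "a \<in> invariants"
  shows "counit H a = linear_extension L (\<lambda>_. \<one>) a"
  unfolding linear_extension_def using invariants_closed[OF a]
  by (simp add: descent_hopf_def Let_def Pi_def cong: finsum_cong)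

lemma comult_H:
  "comult H a = (THE t. t \<in> tensor_carrier (L\<lparr>carrier := K\<rparr>) H H
    \<and> tensor_map L A A (\<lambda>a. a) (\<lambda>a. a) t = comult A a)"
proof -
  let ?H = "A\<lparr>carrier := {a \<in> carrier A. \<forall>g\<in>carrier G. descent_action L G g a = a}\<rparr>"
  have "tensor_carrier (L\<lparr>carrier := K\<rparr>) ?H ?H = tensor_carrier (L\<lparr>carrier := K\<rparr>) H H"
    by (rule tensor_class_cong) (simp_all add: descent_hopf_def Let_def)
  then show ?thesis by (simp add: descent_hopf_def Let_def)
qed

lemma comult_H_obtains:
  assumes a: "a \<in> invariants"
  obtains I :: "((('a \<Rightarrow> 'a) \<Rightarrow> 'a \<Rightarrow> 'a) \<times> nat) set" and w h u
  where "framed_module L K (carrier M) H I w h"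
    "u \<in> carrier (free_module (L\<lparr>carrier := K\<rparr>) (carrier H \<times> carrier H))"
    "\<forall>x\<in>carrier M. \<forall>y\<in>carrier M. tensor_coeff L u x y = (if x = y then a x else \<zero>)"
    "comult H a = tensor_class (L\<lparr>carrier := K\<rparr>) H H u"
proof -
  obtain I :: "((('a \<Rightarrow> 'a) \<Rightarrow> 'a \<Rightarrow> 'a) \<times> nat) set" and w h
    where framed: "framed_module L K (carrier M) H I w h" and w: "w \<in> I \<rightarrow> invariants"
    by (rule exists_framed_module[OF carrier_H H_sel(1,2,3)])
  interpret H: framed_module L K "carrier M" H I w h by (rule framed)
  note a_free = invariants_free_module[OF a]
  obtain u where u: "u \<in> carrier H.F"
    and coeff: "\<And>x y. \<lbrakk>x \<in> carrier M; y \<in> carrier M\<rbrakk> \<Longrightarrow> tensor_coeff L u x y = (if x = y then a x else \<zero>)"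
  proof (rule H.exists_diagonal_tensor[OF a_free])
    show "linear_extension L (\<lambda>m. w i m \<otimes> w j m) a \<in> K" if "i \<in> I" "j \<in> I" for i j
      by (rule linear_extension_invariants_in_K[OF a invariants_times[OF Pi_mem[OF w that(1)]
                Pi_mem[OF w that(2)]]])
  qed blast
  let ?u = "free_map L (\<lambda>m. (single L m, single L m)) a"
  have u': "?u \<in> carrier (free_module L (carrier A \<times> carrier A))"
    by (rule free_map_closed[OF a_free]) (simp add: single_closed)
  have "comult H a = tensor_class H.R H H u"
    unfolding comult_H comult_group_hopf
  proof (rule H.the_tensor_with_image[OF group_hopf_framed_module[OF finite_M] _ u u'])
    show "carrier H \<subseteq> carrier A" using carrier_H invariants_free_module by auto
    show "tensor_coeff L u x y = tensor_coeff L ?u x y" if "x \<in> carrier M" "y \<in> carrier M" for x y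
      using coeff[OF that] tensor_coeff_diagonal[OF finite_M a_free] by simp
  qed
  with framed u show ?thesis using that coeff by blast
qed

lemma hopf_isomorphic_refl: "hopf_isomorphic (L\<lparr>carrier := K\<rparr>) H H"
proof -
  have "comult H a = tensor_map (L\<lparr>carrier := K\<rparr>) H H (\<lambda>a. a) (\<lambda>a. a) (comult H a)"
    if a: "a \<in> carrier H" for a
  proof (rule comult_H_obtains[OF a[unfolded carrier_H]])
    fix I :: "((('a \<Rightarrow> 'a) \<Rightarrow> 'a \<Rightarrow> 'a) \<times> nat) set" and w h u
    assume framed: "framed_module L K (carrier M) H I w h"
      and u: "u \<in> carrier (free_module (L\<lparr>carrier := K\<rparr>) (carrier H \<times> carrier H))"
      and comult: "comult H a = tensor_class (L\<lparr>carrier := K\<rparr>) H H u"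
    interpret H: framed_module L K "carrier M" H I w h by (rule framed)
    have "map_prod (\<lambda>a. a) (\<lambda>a. a) = (\<lambda>x. x)" by auto
    then show ?thesis
      using H.tensor_map_tensor_class[OF framed subset_refl, of "\<lambda>a. a" u] u H.V.free_map_id[OF u]
      by (simp add: comult)
  qed
  then have "(\<lambda>a. a) \<in> hopf_iso (L\<lparr>carrier := K\<rparr>) H H"
    unfolding hopf_iso_def ring_iso_def by (auto intro!: ring_hom_memI simp: bij_betw_def)
  then show ?thesis unfolding hopf_isomorphic_def by blast
qed

end

locale hopf_descent_iso = A: hopf_descent L K M + B: hopf_descent L K M'
  for L :: "('a, 'l) ring_scheme" (structure) and K :: "'a set"
    and M :: "(('a \<Rightarrow> 'a) \<Rightarrow> ('a \<Rightarrow> 'a), 's) monoid_scheme"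
    and M' :: "(('a \<Rightarrow> 'a) \<Rightarrow> ('a \<Rightarrow> 'a), 't) monoid_scheme" +
  fixes f assumes f: "f \<in> hopf_iso (L\<lparr>carrier := K\<rparr>) A.H B.H"
begin

lemma f_ring_iso: "f \<in> ring_iso A.H B.H"
  and f_smult: "\<lbrakk>c \<in> K; a \<in> A.invariants\<rbrakk> \<Longrightarrow> f (c \<odot>\<^bsub>A.H\<^esub> a) = c \<odot>\<^bsub>B.H\<^esub> f a"
  and f_comult: "a \<in> A.invariants \<Longrightarrow> comult B.H (f a) = tensor_map (L\<lparr>carrier := K\<rparr>) B.H B.H f f (comult A.H a)"
  and f_counit: "a \<in> A.invariants \<Longrightarrow> counit B.H (f a) = counit A.H a"
  using f A.carrier_H by (auto simp: hopf_iso_def)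

lemma f_hom: "f \<in> ring_hom A.H B.H"
  using f_ring_iso by (simp add: ring_iso_def)

lemma f_image: "f ` A.invariants = B.invariants"
  using f_ring_iso A.carrier_H B.carrier_H by (simp add: ring_iso_def bij_betw_def)

lemma f_invariants: "a \<in> A.invariants \<Longrightarrow> f a \<in> B.invariants"
  using f_image by blast

lemma f_grouplike_comult:
  assumes a: "a \<in> A.invariants"
  shows "\<exists>u\<in>carrier (free_module L (A.invariants \<times> A.invariants)).
    (\<forall>m\<in>carrier M. \<forall>k\<in>carrier M. tensor_coeff L u m k = (if m = k then a m else \<zero>)) \<and>
    (\<forall>x\<in>carrier M'. \<forall>y\<in>carrier M'. linear_extension L (\<lambda>(b, c). f b x \<otimes> f c y) u =
          (if x = y then f a x else \<zero>))"
proof -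
  let ?R = "L\<lparr>carrier := K\<rparr>"
  obtain I :: "((('a \<Rightarrow> 'a) \<Rightarrow> 'a \<Rightarrow> 'a) \<times> nat) set" and w h u
    where A_framed: "framed_module L K (carrier M) A.H I w h"
      and u: "u \<in> carrier (free_module ?R (carrier A.H \<times> carrier A.H))"
      and u_coeff: "\<forall>x\<in>carrier M. \<forall>y\<in>carrier M. tensor_coeff L u x y = (if x = y then a x else \<zero>)"
      and u_comult: "comult A.H a = tensor_class ?R A.H A.H u"
    by (rule A.comult_H_obtains[OF a])
  obtain I' :: "((('a \<Rightarrow> 'a) \<Rightarrow> 'a \<Rightarrow> 'a) \<times> nat) set" and w' h' u'
    where B_framed: "framed_module L K (carrier M') B.H I' w' h'"
      and u': "u' \<in> carrier (free_module ?R (carrier B.H \<times> carrier B.H))"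
      and u'_coeff: "\<forall>x\<in>carrier M'. \<forall>y\<in>carrier M'. tensor_coeff L u' x y = (if x = y then f a x else \<zero>)"
      and u'_comult: "comult B.H (f a) = tensor_class ?R B.H B.H u'"
    by (rule B.comult_H_obtains[OF f_invariants[OF a]])
  interpret FA: framed_module L K "carrier M" A.H I w h by (rule A_framed)
  interpret FB: framed_module L K "carrier M'" B.H I' w' h' by (rule B_framed)
  have f_closed: "f \<in> carrier A.H \<rightarrow> carrier B.H" using ring_hom_closed[OF f_hom] by blast
  have f_add: "f (v \<oplus>\<^bsub>A.H\<^esub> v') = f v \<oplus>\<^bsub>B.H\<^esub> f v'" if "v \<in> carrier A.H" "v' \<in> carrier A.H" for v v'
    by (rule ring_hom_add[OF f_hom that])
  note f_linear = subset_refl f_closed f_add f_smult[folded A.carrier_H]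
  let ?fu = "free_map ?R (map_prod f f) u"
  have fu: "?fu \<in> carrier FB.F" by (rule FA.free_map_tensor_closed[OF B_framed f_linear u])
  have "tensor_class ?R B.H B.H u' = tensor_class ?R B.H B.H ?fu"
    using f_comult[OF a] FA.tensor_map_tensor_class[OF B_framed f_linear u] by (simp add: u_comult u'_comult)
  then have "\<forall>x\<in>carrier M'. \<forall>y\<in>carrier M'. tensor_coeff L ?fu x y = (if x = y then f a x else \<zero>)"
    using FB.tensor_class_eq_iff[OF u' fu] u'_coeff by simp
  then have "\<forall>x\<in>carrier M'. \<forall>y\<in>carrier M'. linear_extension L (\<lambda>(b, c). f b x \<otimes> f c y) u
      = (if x = y then f a x else \<zero>)"
    by (simp add: FA.tensor_coeff_free_map[OF B_framed f_linear u])
  with u_coeff show ?thesis using FA.F_free_module[OF u] unfolding A.carrier_H by blast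
qed

sublocale descended_bialgebra_epi L "galois_group L K" K
  M "conj_left_regular (galois_group L K)" M' "conj_left_regular (galois_group L K)" f
proof unfold_locales
  show "f ` A.invariants = B.invariants" by (rule f_image)
  show "f (\<lambda>m. a m \<oplus> b m) = (\<lambda>m. f a m \<oplus> f b m)" if "a \<in> A.invariants" "b \<in> A.invariants" for a b
    using ring_hom_add[OF f_hom, of a b] that A.carrier_H unfolding A.H_sel B.H_sel by simp
  show "f (\<lambda>m. c \<otimes> a m) = (\<lambda>m. c \<otimes> f a m)" if "c \<in> K" "a \<in> A.invariants" for c a
    using f_smult[OF that] unfolding A.H_sel B.H_sel .
  show "f (a \<otimes>\<^bsub>group_algebra L M\<^esub> b) = f a \<otimes>\<^bsub>group_algebra L M'\<^esub> f b"
    if "a \<in> A.invariants" "b \<in> A.invariants" for a b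
    using ring_hom_mult[OF f_hom, of a b] that A.carrier_H unfolding A.H_sel B.H_sel by simp
  show "linear_extension L (\<lambda>_. \<one>) (f a) = linear_extension L (\<lambda>_. \<one>) a" if "a \<in> A.invariants" for a
    using f_counit[OF that] A.counit_H[OF that] B.counit_H[OF f_invariants[OF that]] by simp
qed (rule f_grouplike_comult)

end

theorem hopf_descent_cyclic:
  assumes "galois_extension L K" and "cyclic_regular_embedding N \<eta> p n \<gamma> \<delta> (galois_group L K) \<sigma>"
  shows "hopf_descent L K (alpha_group (galois_group L K) \<sigma> N \<eta> \<delta> s)"
proof -
  interpret galois_descent L "galois_group L K" K by (rule galois_descent_galois_group[OF assms(1)])
  interpret C: cyclic_regular_embedding N \<eta> p n \<gamma> \<delta> "galois_group L K" \<sigma> by (rule assms(2))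
  note Bij = C.alpha_group_Bij[of _ s]
  show ?thesis
  proof (intro hopf_descent.intro galois_monoid.intro galois_set.intro galois_set_axioms.intro
      galois_monoid_axioms.intro galois_descent_axioms C.G.finite_carrier C.conj_closed)
    show "finite (carrier (C.\<alpha>_group s))" using C.finite_carrier by (simp add: C.alpha_group_sel)
    show "x \<otimes>\<^bsub>C.\<alpha>_group s\<^esub> y \<in> carrier (C.\<alpha>_group s)"
      if "x \<in> carrier (C.\<alpha>_group s)" "y \<in> carrier (C.\<alpha>_group s)" for x y
      using that hom_mult[OF C.alpha_hom[of s], symmetric] by (auto simp: C.alpha_group_sel)
    show "conj_left_regular (galois_group L K) g (x \<otimes>\<^bsub>C.\<alpha>_group s\<^esub> y)
        = conj_left_regular (galois_group L K) g x \<otimes>\<^bsub>C.\<alpha>_group s\<^esub> conj_left_regular (galois_group L K) g y"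
      if "g \<in> carrier (galois_group L K)" "x \<in> carrier (C.\<alpha>_group s)" "y \<in> carrier (C.\<alpha>_group s)" for g x y
      unfolding C.alpha_group_sel(2)
      by (rule G.conj_left_regular_distrib[OF that(1) Bij[OF that(2)] Bij[OF that(3)]])
  qed (simp_all add: G.conj_left_regular_one G.conj_left_regular_mult Bij)
qed

theorem equivariant_epi_if_hopf_isomorphic:
  assumes "hopf_descent L K M" and "hopf_descent L K M'"
    and "hopf_isomorphic (L\<lparr>carrier := K\<rparr>) (descent_hopf L K M) (descent_hopf L K M')"
  obtains \<phi> where "\<phi> \<in> epi M M'"
    "\<And>g m. \<lbrakk>g \<in> carrier (galois_group L K); m \<in> carrier M\<rbrakk>
      \<Longrightarrow> \<phi> (conj_left_regular (galois_group L K) g m) = conj_left_regular (galois_group L K) g (\<phi> m)"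
proof -
  obtain f where "f \<in> hopf_iso (L\<lparr>carrier := K\<rparr>) (descent_hopf L K M) (descent_hopf L K M')"
    using assms(3) unfolding hopf_isomorphic_def by blast
  then interpret hopf_descent_iso L K M M' f
    by (intro hopf_descent_iso.intro hopf_descent_iso_axioms.intro assms)
  show ?thesis by (rule exists_equivariant_epi) (rule that)
qed

theorem theorem4p1:
  fixes p n r s :: nat
    and L :: "('a, 'l) ring_scheme" and K :: "'a set" and \<sigma> :: "'a \<Rightarrow> 'a"
    and N :: "('n, 'm) monoid_scheme" and \<eta> :: 'n and \<gamma> \<delta> :: "'n \<Rightarrow> 'n"
  assumes "Factorial_Ring.prime p" and "odd p" and "n \<ge> 1"
    and "galois_extension L K"
    and "ring.dimension L (p ^ n) K (carrier L)"
    and "\<sigma> \<in> carrier (galois_group L K)"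
    and "carrier (galois_group L K) = generate (galois_group L K) {\<sigma>}"
    and "group N" and "order N = p ^ n"
    and "\<eta> \<in> carrier N" and "carrier N = generate N {\<eta>}"
    and "\<gamma> \<in> carrier (AutoGroup N)"
    and "carrier (AutoGroup N) = generate (AutoGroup N) {\<gamma>}"
    and "\<delta> = \<gamma> [^]\<^bsub>AutoGroup N\<^esub> (p - 1)"
    and "r < p ^ (n - 1)" and "s < p ^ (n - 1)"
  shows "hopf_isomorphic (L\<lparr>carrier := K\<rparr>)
           (hopf_galois_structure L K \<sigma> N \<eta> \<delta> r) (hopf_galois_structure L K \<sigma> N \<eta> \<delta> s)
         \<longleftrightarrow> r = s"
proof -
  let ?G = "galois_group L K"
  interpret galois_descent L ?G K by (rule galois_descent_galois_group) fact
  have order_G: "order ?G = p ^ n"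
    unfolding order_def by (rule card_automorphisms) fact
  have finite: "finite (carrier ?G)" "finite (carrier N)"
    using order_G assms(1,9) prime_gt_0_nat[of p] by (auto simp: order_def intro: card_ge_0_finite)
  have embedding: "cyclic_regular_embedding N \<eta> p n \<gamma> \<delta> ?G \<sigma>"
    using assms order_G finite G.group_axioms
    by (intro cyclic_regular_embedding.intro cyclic_regular_embedding_axioms.intro cyclic_p_group.intro
        cyclic_p_group_axioms.intro finite_cyclic_group.intro finite_cyclic_group_axioms.intro)
  note descent = hopf_descent_cyclic[OF assms(4) embedding]
  show ?thesis
    unfolding hopf_galois_structure_def
  proof
    assume "hopf_isomorphic (L\<lparr>carrier := K\<rparr>)
      (descent_hopf L K (alpha_group ?G \<sigma> N \<eta> \<delta> r)) (descent_hopf L K (alpha_group ?G \<sigma> N \<eta> \<delta> s))"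
    from equivariant_epi_if_hopf_isomorphic[OF descent descent this]
    show "r = s"
      using index_eq_if_equivariant_epi[OF embedding assms(15,16)] assms(6) by metis
  qed (use hopf_descent.hopf_isomorphic_refl[OF descent] in simp)
qed

end
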